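(* There is a polynomial-time algorithm (polynomial in $|V(G)|$) for the following decision problem (PSOP-MCS restricted to chordal graphs): given a connected chordal graph $G$ and a partial order $R$ on $V(G)$, decide whether there exists an MCS ordering of $G$ that extends $R$.
   Context: All graphs are finite, simple and undirected. A graph is chordal if it has no induced cycle of length greater than three. Maximum cardinality search (MCS) visits the vertices of a connected graph one at a time: the first visited vertex is arbitrary, and at each subsequent step an unvisited vertex having the maximum number of already visited neighbours (among all unvisited vertices) is visited, ties broken arbitrarily. An MCS ordering of $G$ is any ordering of $V(G)$ that can be produced in this way. A linear order $\sigma$ on $V(G)$ extends a partial order $R$ on $V(G)$ if $(x,y)\in R$ implies that $x$ does not come after $y$ in $\sigma$ (i.e., $x=y$ or $x$ precedes $y$). *)

theory Defs
  imports "HOL-Computational_Algebra.Polynomial" "Graph_Theory.Graph_Theory"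
begin

section \<open>Graphs and maximum cardinality search\<close>

text \<open>
  A finite simple undirected graph is a \<^locale>\<open>pair_graph\<close>: a finite, loop-free, symmetric
  set of vertex pairs.
\<close>

definition induced_cycle :: "'a pair_pre_digraph \<Rightarrow> 'a list \<Rightarrow> bool" where
  "induced_cycle G c \<longleftrightarrow> length c \<ge> 3 \<and> distinct c \<and> set c \<subseteq> pverts G \<and>
    (\<forall>i < length c. \<forall>j < length c. (c ! i, c ! j) \<in> parcs G \<longleftrightarrow>
       j = Suc i mod length c \<or> i = Suc j mod length c)"

definition chordal :: "'a pair_pre_digraph \<Rightarrow> bool" where
  "chordal G \<longleftrightarrow> (\<forall>c. induced_cycle G c \<longrightarrow> \<not> length c > 3)"

definition visited_neighbours :: "'a pair_pre_digraph \<Rightarrow> 'a list \<Rightarrow> 'a \<Rightarrow> nat" where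
  "visited_neighbours G xs v = card {u \<in> set xs. (u, v) \<in> parcs G}"

text \<open>
  The lists that the search can have visited at some stage, in order of visit. For the empty list
  the maximality condition is void, so the first vertex is arbitrary.
\<close>

inductive mcs_visited :: "'a pair_pre_digraph \<Rightarrow> 'a list \<Rightarrow> bool" for G where
  start: "mcs_visited G []"
| visit: "mcs_visited G (xs @ [v])"
    if "mcs_visited G xs" and "v \<in> pverts G - set xs"
      and "\<And>w. w \<in> pverts G - set xs \<Longrightarrow> visited_neighbours G xs w \<le> visited_neighbours G xs v"

definition mcs_ordering :: "'a pair_pre_digraph \<Rightarrow> 'a list \<Rightarrow> bool" where
  "mcs_ordering G xs \<longleftrightarrow> mcs_visited G xs \<and> set xs = pverts G"

definition order_extends :: "'a list \<Rightarrow> 'a rel \<Rightarrow> bool" where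
  "order_extends xs R \<longleftrightarrow>
    (\<forall>i < length xs. \<forall>j < length xs. (xs ! i, xs ! j) \<in> R \<longrightarrow> i \<le> j)"


section \<open>Random access machines\<close>

text \<open>
  Algorithms are structured programs for a unit-cost random access machine over the natural
  numbers, with registers and arrays named by numbers, and with indirect addressing. A program
  mentions only finitely many registers and arrays. The only arithmetic operations are addition
  and (truncated) subtraction; there is no multiplication, so that every number occurring within
  \<open>t\<close> steps has at most \<open>O(t)\<close> bits more than the numbers in the input. Hence polynomial time on
  this machine coincides with polynomial time on Turing machines, although every operation has
  cost one. Expressions contribute no cost beyond that of the command they occur in, since their
  size is bounded by a constant depending only on the program.
\<close>

record store =
  reg :: "nat \<Rightarrow> nat"
  arr :: "nat \<Rightarrow> nat \<Rightarrow> nat"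

datatype aexp =
    Num nat
  | Reg nat
  | Get nat aexp
  | Add aexp aexp
  | Sub aexp aexp

datatype bexp =
    Less aexp aexp
  | Neg bexp
  | Conj bexp bexp

datatype com =
    Skip
  | Assign nat aexp
  | Put nat aexp aexp
  | Seq com com
  | Cond bexp com com
  | While bexp com

fun aval :: "aexp \<Rightarrow> store \<Rightarrow> nat" where
  "aval (Num n) s = n"
| "aval (Reg x) s = reg s x"
| "aval (Get a e) s = arr s a (aval e s)"
| "aval (Add e1 e2) s = aval e1 s + aval e2 s"
| "aval (Sub e1 e2) s = aval e1 s - aval e2 s"

fun bval :: "bexp \<Rightarrow> store \<Rightarrow> bool" where
  "bval (Less e1 e2) s \<longleftrightarrow> aval e1 s < aval e2 s"
| "bval (Neg b) s \<longleftrightarrow> \<not> bval b s"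
| "bval (Conj b1 b2) s \<longleftrightarrow> bval b1 s \<and> bval b2 s"

text \<open>
  \<open>exec c s t s'\<close>: started in \<open>s\<close>, the program \<open>c\<close> terminates in \<open>s'\<close> after exactly \<open>t\<close> steps.
\<close>

inductive exec :: "com \<Rightarrow> store \<Rightarrow> nat \<Rightarrow> store \<Rightarrow> bool" where
  Skip: "exec Skip s 1 s"
| Assign: "exec (Assign x e) s 1 (s\<lparr>reg := (reg s)(x := aval e s)\<rparr>)"
| Put: "exec (Put a i e) s 1
    (s\<lparr>arr := (arr s)(a := (arr s a)(aval i s := aval e s))\<rparr>)"
| Seq: "exec c1 s1 t1 s2 \<Longrightarrow> exec c2 s2 t2 s3 \<Longrightarrow> exec (Seq c1 c2) s1 (t1 + t2) s3"
| CondTrue: "bval b s \<Longrightarrow> exec c1 s t s' \<Longrightarrow> exec (Cond b c1 c2) s (1 + t) s'"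
| CondFalse: "\<not> bval b s \<Longrightarrow> exec c2 s t s' \<Longrightarrow> exec (Cond b c1 c2) s (1 + t) s'"
| WhileFalse: "\<not> bval b s \<Longrightarrow> exec (While b c) s 1 s"
| WhileTrue: "bval b s1 \<Longrightarrow> exec c s1 t1 s2 \<Longrightarrow> exec (While b c) s2 t2 s3 \<Longrightarrow>
    exec (While b c) s1 (1 + t1 + t2) s3"

inductive_cases exec_elims:
  "exec Skip s t s'" "exec (Assign x e) s t s'" "exec (Put a i e) s t s'"
  "exec (Seq c1 c2) s t s'" "exec (Cond b c1 c2) s t s'" "exec (While b c) s t s'"

lemma exec_deterministic:
  "exec c s t s' \<Longrightarrow> exec c s u s'' \<Longrightarrow> t = u \<and> s' = s''"
proof (induction arbitrary: u s'' rule: exec.induct)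
  case Skip
  then show ?case by (rule exec_elims(1)) simp
next
  case Assign
  then show ?case by (rule exec_elims(2)) simp
next
  case Put
  then show ?case by (rule exec_elims(3)) simp
next
  case (Seq c1 s1 t1 s2 c2 t2 s3)
  from Seq.prems obtain v1 r v2 where v: "exec c1 s1 v1 r" "exec c2 r v2 s''" "u = v1 + v2"
    by (rule exec_elims(4))
  from Seq.IH(1)[OF v(1)] have "t1 = v1" "s2 = r" by simp_all
  with Seq.IH(2)[of v2 s''] v show ?case by simp
next
  case (CondTrue b s c1 t s' c2)
  from CondTrue.prems show ?case
    by (rule exec_elims(5)) (use CondTrue.hyps in \<open>auto dest: CondTrue.IH\<close>)
next
  case (CondFalse b s c2 t s' c1)
  from CondFalse.prems show ?case
    by (rule exec_elims(5)) (use CondFalse.hyps in \<open>auto dest: CondFalse.IH\<close>)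
next
  case (WhileFalse b s c)
  from WhileFalse.prems show ?case
    by (rule exec_elims(6)) (use WhileFalse.hyps in auto)
next
  case (WhileTrue b s1 c t1 s2 t2 s3)
  from WhileTrue.prems(1) \<open>bval b s1\<close> obtain v1 r v2
    where v: "exec c s1 v1 r" "exec (While b c) r v2 s''" "u = 1 + v1 + v2"
    by (cases rule: exec.cases) auto
  from WhileTrue.IH(1)[OF v(1)] have "t1 = v1" "s2 = r" by simp_all
  with WhileTrue.IH(2)[of v2 s''] v show ?case by simp
qed

text \<open>
  A decision problem consists of a set of instances, their encodings as initial stores, their
  sizes, and the set of yes-instances. The answer is read off register 0 of the final store. A
  single program and a single polynomial must serve all instances. Since execution is
  deterministic, the existential quantifier over \<open>t\<close> and \<open>s\<close> expresses termination of the unique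
  run.
\<close>

definition poly_time_decidable ::
    "'i set \<Rightarrow> ('i \<Rightarrow> store) \<Rightarrow> ('i \<Rightarrow> nat) \<Rightarrow> ('i \<Rightarrow> bool) \<Rightarrow> bool" where
  "poly_time_decidable instances encode sz yes \<longleftrightarrow>
    (\<exists>(c :: com) (p :: nat poly). \<forall>x \<in> instances. \<exists>t s.
       exec c (encode x) t s \<and> t \<le> poly p (sz x) \<and> reg s 0 = (if yes x then 1 else 0))"


section \<open>The partial search order problem\<close>

text \<open>
  As usual for the input of an algorithm, the vertices of a graph with \<open>n\<close> vertices are the numbers
  below \<open>n\<close>. The input consists of \<open>n\<close> in register 0 and of the \<open>n \<times> n\<close> adjacency matrices of \<open>G\<close>
  and \<open>R\<close>, stored row by row in arrays 0 and 1; everything else is initially 0.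
\<close>

definition matrix_array :: "nat \<Rightarrow> nat rel \<Rightarrow> nat \<Rightarrow> nat" where
  "matrix_array n A k = (if k < n * n \<and> (k div n, k mod n) \<in> A then 1 else 0)"

definition encode_graph_rel :: "nat pair_pre_digraph \<times> nat rel \<Rightarrow> store" where
  "encode_graph_rel = (\<lambda>(G, R). let n = card (pverts G) in
    \<lparr>reg = (\<lambda>_. 0)(0 := n),
     arr = (\<lambda>_ _. 0)(0 := matrix_array n (parcs G), 1 := matrix_array n R)\<rparr>)"

definition psop_chordal_instances :: "(nat pair_pre_digraph \<times> nat rel) set" where
  "psop_chordal_instances = {(G, R).
     pair_graph G \<and> pverts G = {..<card (pverts G)} \<and>
     Digraph_Component.connected (with_proj G) \<and> chordal G \<and>
     partial_order_on (pverts G) R}"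

end

theory Submission
  imports Defs
begin

text \<open>
  In a chordal graph the visited neighbours of the vertex chosen by a maximum cardinality search form
  a clique \<open>S\<close>. After choosing a vertex with visited neighbourhood \<open>S\<close> of size \<open>k\<close>, the search
  first exhausts a block that depends only on \<open>S\<close> and on the maximal clique \<open>Q\<close> entered: the closure
  of \<open>Q\<close> under adding vertices with more than \<open>k\<close> neighbours. Inside the block it visits \<open>Q\<close> and
  then, repeatedly, a whole smaller block whose separator has the maximal possible size. Moreover
  \<open>S = P \<inter> Q\<close> for a maximal clique \<open>P\<close>, so there are only quadratically many blocks. A block can be
  searched consistently with the partial order if and only if it is obtained from \<open>Q\<close> by greedily
  adding blocks that can themselves be searched and whose vertices have no missing predecessor in
  the block; adding one never invalidates another choice of the same size. Hence saturating all
  blocks simultaneously decides the problem. The maximal cliques come from an arbitrary search.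
\<close>

section \<open>Maximum cardinality search on chordal graphs\<close>

text \<open>The growing step is not monotone: a block that may be added now can violate the label
  bound once other blocks have been added. A saturated table is therefore just some fixed point, and
  its adequacy cannot come from minimality. It is compared instead with one ordering that extends
  \<open>R\<close>. At the first vertex of a block missing from the table, that ordering enters a
  block with a strictly larger separator, which is full by induction; the table could still have
  added it, a contradiction. The delicate point is that the table may have grown in another order
  than the search. Hence \<open>grows_visit\<close> also records that an unvisited vertex of label
  at least \<open>j\<close> forces everything grown so far to be reachable from \<open>Q\<close>
  with threshold \<open>j\<close>. That separators are intersections of two maximal cliques rests on
  a fact about labels: whenever the label does not rise, the visited neighbourhood of the next
  vertex lies in a maximal clique of the whole graph that has been visited completely.\<close>

lemma mcs_visited_snoc:
  "mcs_visited G (xs @ [v]) \<longleftrightarrow> mcs_visited G xs \<and> v \<in> pverts G - set xs \<and>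
    (\<forall>w \<in> pverts G - set xs. visited_neighbours G xs w \<le> visited_neighbours G xs v)"
  by (auto elim: mcs_visited.cases intro: mcs_visited.visit)

lemma mcs_visited_appendD: "mcs_visited G (xs @ ys) \<Longrightarrow> mcs_visited G xs"
  by (induction ys rule: rev_induct) (auto simp: mcs_visited_snoc simp flip: append_assoc)

lemma mcs_visited_distinct: "mcs_visited G xs \<Longrightarrow> distinct xs \<and> set xs \<subseteq> pverts G"
  by (induction rule: mcs_visited.induct) auto

lemma mcs_visited_take: "mcs_visited G xs \<Longrightarrow> mcs_visited G (take i xs)"
  by (metis append_take_drop_id mcs_visited_appendD)

lemma mcs_visited_nth:
  assumes "mcs_visited G xs" "i < length xs" "w \<in> pverts G - set (take i xs)"
  shows "visited_neighbours G (take i xs) w \<le> visited_neighbours G (take i xs) (xs ! i)"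
  using mcs_visited_take[OF assms(1), of "Suc i"] assms
  by (auto simp: take_Suc_conv_app_nth mcs_visited_snoc)

section \<open>Visited neighbourhoods in chordal graphs\<close>

locale chordal_graph = pair_graph +
  assumes chordal: "chordal G"
begin

definition nb :: "'a \<Rightarrow> 'a set" where
  "nb v = {u. (u, v) \<in> parcs G}"

definition lab :: "'a set \<Rightarrow> 'a \<Rightarrow> nat" where
  "lab A v = card (nb v \<inter> A)"

definition clique :: "'a set \<Rightarrow> bool" where
  "clique A \<longleftrightarrow> A \<subseteq> pverts G \<and> (\<forall>x \<in> A. \<forall>y \<in> A. x \<noteq> y \<longrightarrow> x \<in> nb y)"

lemma nb_sym: "u \<in> nb v \<longleftrightarrow> v \<in> nb u"
  using arcs_symmetric[of u v] arcs_symmetric[of v u] by (auto simp: nb_def)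

lemma nb_irrefl [simp]: "v \<notin> nb v"
  by (auto simp: nb_def dest: no_loops')

lemma nb_subset: "nb v \<subseteq> pverts G"
  by (auto simp: nb_def dest: in_arcsD1)

lemma nb_empty: "v \<notin> pverts G \<Longrightarrow> nb v = {}"
  by (auto simp: nb_def dest: in_arcsD2)

lemma finite_nb [simp]: "finite (nb v)"
  using nb_subset pair_finite_verts by (rule finite_subset)

lemma finite_subset_verts: "A \<subseteq> pverts G \<Longrightarrow> finite A"
  using pair_finite_verts by (rule finite_subset[rotated])

lemma lab_mono: "A \<subseteq> B \<Longrightarrow> lab A v \<le> lab B v"
  by (auto simp: lab_def intro: card_mono)

lemma visited_neighbours_lab: "visited_neighbours G xs v = lab (set xs) v"
  by (auto simp: visited_neighbours_def lab_def nb_def intro: arg_cong[where f = card])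

lemma mcs_snoc:
  "mcs_visited G (xs @ [v]) \<longleftrightarrow> mcs_visited G xs \<and> v \<in> pverts G - set xs \<and>
    (\<forall>w \<in> pverts G - set xs. lab (set xs) w \<le> lab (set xs) v)"
  by (simp add: mcs_visited_snoc visited_neighbours_lab)

lemma mcs_nth:
  assumes "mcs_visited G xs" "i < length xs" "w \<in> pverts G - set (take i xs)"
  shows "lab (set (take i xs)) w \<le> lab (set (take i xs)) (xs ! i)"
  using mcs_visited_nth[OF assms] by (simp add: visited_neighbours_lab)

text \<open>If every neighbour of \<open>xs ! b\<close> visited before it were also a neighbour of
  \<open>xs ! c\<close>, then, \<open>xs ! a\<close> being an extra one, \<open>xs ! c\<close> would
  have had the strictly larger label at time \<open>b\<close>.\<close>

lemma mcs_earlier_neighbour: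
  assumes "mcs_visited G xs" "a < b" "b < c" "c < length xs"
    and "xs ! a \<in> nb (xs ! c)" "xs ! a \<notin> nb (xs ! b)"
  shows "\<exists>d < b. xs ! d \<in> nb (xs ! b) \<and> xs ! d \<notin> nb (xs ! c)"
proof (rule ccontr)
  assume neg: "\<not> ?thesis"
  let ?A = "set (take b xs)"
  have A: "?A = (!) xs ` {..<b}"
    using assms by (simp add: nth_image lessThan_atLeast0)
  have "nb (xs ! b) \<inter> ?A \<subset> nb (xs ! c) \<inter> ?A"
    using neg assms unfolding A by auto
  then have "lab ?A (xs ! b) < lab ?A (xs ! c)"
    unfolding lab_def by (intro psubset_card_mono) auto
  moreover have "xs ! c \<in> pverts G - ?A"
    using mcs_visited_distinct[OF assms(1)] assms(2-4) unfolding A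
    by (auto simp: nth_eq_iff_index_eq)
  ultimately show False
    using mcs_nth[OF assms(1), of b "xs ! c"] assms(2-4) by simp
qed

text \<open>
  Tarjan and Yannakakis: a chordless path whose inner vertices are all visited after both of its
  ends would either extend to a chordless cycle or produce such a path whose later end is visited
  earlier.
\<close>

lemma no_late_path:
  assumes mcs: "mcs_visited G xs"
    and "k \<ge> 2" "inj_on v {..k}" "\<forall>i \<le> k. v i < length xs"
    and "\<forall>i \<le> k. \<forall>j \<le> k. xs ! v i \<in> nb (xs ! v j) \<longleftrightarrow> j = Suc i \<or> i = Suc j"
    and "v 0 < v k" "\<forall>i. 0 < i \<and> i < k \<longrightarrow> v k < v i"
  shows False
  using assms(2-)
proof (induction "v k" arbitrary: v k rule: less_induct)
  case less
  note inj = less.prems(2) and bnd = less.prems(3) and pth = less.prems(4)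
  have dist: "distinct xs" and vs: "set xs \<subseteq> pverts G"
    using mcs_visited_distinct[OF mcs] by auto
  have "xs ! v 0 \<in> nb (xs ! v 1)" "xs ! v 0 \<notin> nb (xs ! v k)"
    using pth less.prems(1) by auto
  \<comment> \<open>\<open>v 1\<close> is visited after \<open>v k\<close>, yet sees
    \<open>v 0\<close>, which \<open>v k\<close> does not; so \<open>v k\<close> must see some
    earlier \<open>d\<close> that \<open>v 1\<close> does not see.\<close>
  then obtain d where d: "d < v k" "xs ! d \<in> nb (xs ! v k)" "xs ! d \<notin> nb (xs ! v 1)"
    using mcs_earlier_neighbour[OF mcs, of "v 0" "v k" "v 1"] less.prems by auto
  \<comment> \<open>The path is cut at the first vertex that sees \<open>d\<close>, and
    \<open>d\<close> is appended. Counting starts at 2 because \<open>v 1\<close> does not see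
    \<open>d\<close>; hence an edge from \<open>d\<close> to \<open>v 0\<close> closes a cycle of at
    least four vertices.\<close>
  define j where "j = (LEAST j. 2 \<le> j \<and> j \<le> k \<and> xs ! d \<in> nb (xs ! v j))"
  have j: "2 \<le> j \<and> j \<le> k \<and> xs ! d \<in> nb (xs ! v j)"
    unfolding j_def by (rule LeastI[of _ k]) (use d less.prems(1) in auto)
  have j_min: "xs ! d \<notin> nb (xs ! v i)" if "1 \<le> i" "i < j" for i
    using that d(3) not_less_Least[of i "\<lambda>j. 2 \<le> j \<and> j \<le> k \<and> xs ! d \<in> nb (xs ! v j)"] j
    unfolding j_def[symmetric] by (cases "i = 1") auto
  have dne0: "d \<noteq> v 0"
    using d(2) \<open>xs ! v 0 \<notin> nb (xs ! v k)\<close> by auto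
  have later: "v k \<le> v i" if "0 < i" "i \<le> k" for i
    using less.prems(6) that by (cases "i = k") auto
  have dne: "d \<noteq> v i" if "i \<le> k" for i
    using later[of i] that dne0 d(1) by (cases "i = 0") auto
  define w where "w = v(Suc j := d)"
  have w_simps: "w (Suc j) = d" "\<And>i. i \<le> j \<Longrightarrow> w i = v i"
    by (auto simp: w_def)
  have w_inj: "inj_on w {..Suc j}"
    using inj j dne unfolding w_def inj_on_def by (auto simp: le_Suc_eq; metis le_trans)
  have w_bnd: "\<forall>i \<le> Suc j. w i < length xs"
    using bnd j d(1) by (auto simp: w_def intro: less_trans)
  have w_adj: "xs ! w i \<in> nb (xs ! w l) \<longleftrightarrow> l = Suc i \<or> i = Suc l \<or>
      xs ! d \<in> nb (xs ! v 0) \<and> (i = 0 \<and> l = Suc j \<or> l = 0 \<and> i = Suc j)"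
    if il: "i \<le> Suc j" "l \<le> Suc j" for i l
  proof -
    have end_adj: "xs ! d \<in> nb (xs ! v i) \<longleftrightarrow> i = j \<or> i = 0 \<and> xs ! d \<in> nb (xs ! v 0)"
      if "i \<le> j" for i
      using that j j_min[of i] by (cases "i = 0"; cases "i = j") auto
    consider "i \<le> j" "l \<le> j" | "i = Suc j" "l \<le> j" | "i \<le> j" "l = Suc j" | "i = Suc j" "l = Suc j"
      using il by linarith
    then show ?thesis
    proof cases
      case 1
      then show ?thesis using pth j by (auto simp: w_simps)
    next
      case 2
      then show ?thesis using end_adj[of l] j by (auto simp: w_simps)
    next
      case 3
      then show ?thesis using end_adj[of i] j nb_sym[of "xs ! v i"] by (auto simp: w_simps)
    next
      case 4
      then show ?thesis by simp
    qed
  qed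
  show False
  proof (cases "xs ! d \<in> nb (xs ! v 0)")
    case True
    let ?c = "map (\<lambda>i. xs ! w i) [0..<Suc (Suc j)]"
    have nth: "?c ! i = xs ! w i" if "i < Suc (Suc j)" for i
      using that by (simp del: upt_Suc)
    have len: "length ?c = Suc (Suc j)"
      by simp
    have "distinct ?c"
      using w_inj w_bnd dist unfolding distinct_map
      by (auto simp: inj_on_def nth_eq_iff_index_eq le_simps simp del: upt_Suc)
    moreover have "set ?c \<subseteq> pverts G"
      using w_bnd vs by (auto simp del: upt_Suc intro!: subsetD[OF vs] nth_mem)
    moreover have "(?c ! i, ?c ! l) \<in> parcs G \<longleftrightarrow>
        l = Suc i mod length ?c \<or> i = Suc l mod length ?c"
      if "i < length ?c" "l < length ?c" for i l
    proof -
      have il: "i \<le> Suc j" "l \<le> Suc j" using that by simp_all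
      have modS: "Suc a mod Suc (Suc j) = (if a = Suc j then 0 else Suc a)" if "a \<le> Suc j" for a
        using that by auto
      have "(?c ! i, ?c ! l) \<in> parcs G \<longleftrightarrow> xs ! w i \<in> nb (xs ! w l)"
        using that by (simp add: nth nb_def del: upt_Suc)
      also have "\<dots> \<longleftrightarrow> l = Suc i mod length ?c \<or> i = Suc l mod length ?c"
        using w_adj[OF il] True il unfolding len modS[OF il(1)] modS[OF il(2)] by auto
      finally show ?thesis .
    qed
    ultimately have "induced_cycle G ?c"
      unfolding induced_cycle_def using j by simp
    then show False
      using chordal j unfolding chordal_def by fastforce
  next
    case False
    have adj: "\<forall>i \<le> Suc j. \<forall>l \<le> Suc j. xs ! w i \<in> nb (xs ! w l) \<longleftrightarrow> l = Suc i \<or> i = Suc l"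
      using w_adj False by auto
    have mid: "d < w i \<and> v 0 < w i" if "0 < i" "i < Suc j" for i
      using later[of i] that j d(1) less.prems(5) by (auto simp: w_simps)
    show False
    proof (cases "v 0 < d")
      case True
      show False
        by (rule less.hyps[of w "Suc j"])
          (use True d(1) j w_inj w_bnd adj mid in \<open>auto simp: w_simps\<close>)
    next
      case False
      with dne0 have dv: "d < v 0" by simp
      \<comment> \<open>The new path is reversed so that its earlier end comes first; its later end
        is now \<open>v 0\<close>, still before \<open>v k\<close>.\<close>
      let ?w = "\<lambda>i. w (Suc j - i)"
      show False
      proof (rule less.hyps[of ?w "Suc j"])
        show "inj_on ?w {..Suc j}"
          unfolding inj_on_def
        proof (intro ballI impI)
          fix a b assume "a \<in> {..Suc j}" "b \<in> {..Suc j}" "?w a = ?w b"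
          then show "a = b"
            using inj_onD[OF w_inj, of "Suc j - a" "Suc j - b"] by auto
        qed
        show "\<forall>i \<le> Suc j. \<forall>l \<le> Suc j. xs ! ?w i \<in> nb (xs ! ?w l) \<longleftrightarrow> l = Suc i \<or> i = Suc l"
          using adj by (auto simp: le_diff_conv)
        show "\<forall>i. 0 < i \<and> i < Suc j \<longrightarrow> ?w (Suc j) < ?w i"
          using mid by (auto simp: w_simps)
      qed (use dv j w_bnd less.prems(5) in \<open>auto simp: w_simps\<close>)
    qed
  qed
qed

text \<open>Two non-adjacent visited neighbours of \<open>v\<close>, with \<open>v\<close> between
  them, form a chordless path whose inner vertex is visited last: the case \<open>k = 2\<close> of
  \<open>no_late_path\<close>.\<close>

lemma mcs_clique:
  assumes "mcs_visited G (xs @ [v])"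
  shows "clique (nb v \<inter> set xs)"
proof -
  let ?ys = "xs @ [v]"
  have dist: "distinct ?ys" "set ?ys \<subseteq> pverts G"
    using mcs_visited_distinct[OF assms] by auto
  have main: "xs ! a \<in> nb (xs ! b)"
    if ab: "a < b" "b < length xs" "xs ! a \<in> nb v" "xs ! b \<in> nb v" for a b
  proof (rule ccontr)
    assume n: "xs ! a \<notin> nb (xs ! b)"
    let ?v = "\<lambda>i::nat. if i = 0 then a else if i = 1 then length xs else b"
    have le2: "i \<le> 2 \<longleftrightarrow> i = 0 \<or> i = 1 \<or> i = 2" for i :: nat by linarith
    show False
    proof (rule no_late_path[OF assms, of 2 ?v])
      show "inj_on ?v {..2}" using ab unfolding inj_on_def by (fastforce simp: le2)
      show "\<forall>i\<le>2. \<forall>j\<le>2. (?ys ! ?v i \<in> nb (?ys ! ?v j)) = (j = Suc i \<or> i = Suc j)"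
        using ab n nb_sym by (auto simp: le2 nth_append)
    qed (use ab in \<open>auto simp: le2\<close>)
  qed
  show ?thesis
    unfolding clique_def
  proof (intro conjI ballI impI)
    fix x y assume "x \<in> nb v \<inter> set xs" "y \<in> nb v \<inter> set xs" "x \<noteq> y"
    then obtain a b where "a < length xs" "b < length xs" "x = xs ! a" "y = xs ! b" "a \<noteq> b"
      "x \<in> nb v" "y \<in> nb v"
      by (auto simp: in_set_conv_nth)
    then show "x \<in> nb y"
      using main[of a b] main[of b a] nb_sym by (cases "a < b") auto
  qed (use dist in auto)
qed

end

text \<open>\<open>clos m A\<close> is what the search visits after \<open>A\<close> before all labels are below \<open>m\<close>.\<close>

inductive_set (in chordal_graph) clos :: "nat \<Rightarrow> 'a set \<Rightarrow> 'a set" for m A where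
  base: "x \<in> A \<Longrightarrow> x \<in> clos m A"
| step: "\<forall>y \<in> Y. y \<in> clos m A \<Longrightarrow> Y \<subseteq> nb u \<Longrightarrow> m \<le> card Y \<Longrightarrow> u \<in> pverts G \<Longrightarrow> u \<in> clos m A"

section \<open>Closures and the states in which a block can be entered\<close>

context chordal_graph
begin

lemma clos_superset: "A \<subseteq> clos m A"
  by (auto intro: clos.base)

text \<open>Leastness of the closure in terms of labels. The sets \<open>Y\<close> in the rule of
  \<open>clos\<close> are only witnesses for a large label; they keep the inductive definition
  monotone.\<close>

lemma clos_subset:
  assumes "A \<subseteq> X" and "\<And>u. u \<in> pverts G \<Longrightarrow> m \<le> lab X u \<Longrightarrow> u \<in> X"
  shows "clos m A \<subseteq> X"
proof
  fix x assume "x \<in> clos m A"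
  then show "x \<in> X"
  proof induction
    case (step Y u)
    then have "card Y \<le> lab X u"
      unfolding lab_def by (intro card_mono) auto
    with step show ?case using assms(2) by simp
  qed (use assms in auto)
qed

lemma clos_closed: "u \<in> pverts G \<Longrightarrow> m \<le> lab (clos m A) u \<Longrightarrow> u \<in> clos m A"
  unfolding lab_def by (rule clos.step) auto

lemma clos_verts: "A \<subseteq> pverts G \<Longrightarrow> clos m A \<subseteq> pverts G"
  by (rule clos_subset)

lemma clos_least:
  assumes "A \<subseteq> clos m B" "m \<le> m'"
  shows "clos m' A \<subseteq> clos m B"
  by (rule clos_subset) (use assms clos_closed in auto)

lemma cliqueD: "clique A \<Longrightarrow> x \<in> A \<Longrightarrow> y \<in> A \<Longrightarrow> x \<noteq> y \<Longrightarrow> x \<in> nb y"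
  by (simp add: clique_def)

lemma clique_verts: "clique A \<Longrightarrow> A \<subseteq> pverts G"
  by (simp add: clique_def)

lemma clique_insert_nb:
  assumes "clique A" "A \<subseteq> nb v" "v \<in> pverts G"
  shows "clique (insert v A)"
  using assms nb_sym unfolding clique_def by (auto simp: subset_iff)

text \<open>The state in which a block with a separator of size \<open>k\<close> may be entered: any
  unvisited vertex with \<open>k\<close> visited neighbours is a legal next choice.\<close>

definition closed_at :: "'a list \<Rightarrow> nat \<Rightarrow> bool" where
  "closed_at ws k \<longleftrightarrow> mcs_visited G ws \<and> (\<forall>u \<in> pverts G - set ws. lab (set ws) u \<le> k)"

text \<open>The set \<open>W\<close> meets the new vertices of \<open>X\<close> only through
  \<open>X\<close> itself, so that labels above the old bound can be computed inside
  \<open>X\<close>.\<close>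

definition attached :: "'a set \<Rightarrow> 'a set \<Rightarrow> bool" where
  "attached W X \<longleftrightarrow> (\<forall>x \<in> X - W. nb x \<inter> W \<subseteq> X)"

text \<open>
  The visited neighbours of a vertex of large label form a clique that contains a new vertex,
  so all of them belong to the part \<open>X\<close> that is only attached to \<open>W\<close>.
\<close>

lemma large_label_attached:
  assumes "closed_at ws k" "mcs_visited G zs" "set zs = set ws \<union> X" "attached (set ws) X"
    and u: "u \<in> pverts G - set zs" "k < lab (set zs) u"
  shows "\<exists>v \<in> pverts G - set zs. lab (set zs) u \<le> lab (set zs) v \<and> nb v \<inter> set zs \<subseteq> X"
proof -
  let ?L = "lab (set zs) ` (pverts G - set zs)"
  have fin: "finite ?L" using pair_finite_verts by simp
  then have "Max ?L \<in> ?L" using u(1) by (intro Max_in) auto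
  then obtain v where v: "v \<in> pverts G - set zs" and "lab (set zs) v = Max ?L" by auto
  then have vmax: "\<forall>w \<in> pverts G - set zs. lab (set zs) w \<le> lab (set zs) v"
    using fin by simp
  from v vmax have "mcs_visited G (zs @ [v])"
    using assms(2) by (simp add: mcs_snoc)
  then have cl: "clique (nb v \<inter> set zs)" by (rule mcs_clique)
  have big: "k < lab (set zs) v" using u vmax by force
  have "lab (set ws) v \<le> k"
    using assms(1,3) v unfolding closed_at_def by auto
  have "\<not> nb v \<inter> set zs \<subseteq> nb v \<inter> set ws"
  proof
    assume "nb v \<inter> set zs \<subseteq> nb v \<inter> set ws"
    then have "lab (set zs) v \<le> lab (set ws) v"
      unfolding lab_def by (intro card_mono) auto
    with big \<open>lab (set ws) v \<le> k\<close> show False by simp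
  qed
  then obtain b where b: "b \<in> nb v \<inter> set zs" "b \<notin> set ws" by auto
  then have bX: "b \<in> X - set ws" using assms(3) by auto
  have "nb v \<inter> set zs \<subseteq> X"
  proof
    fix y assume y: "y \<in> nb v \<inter> set zs"
    show "y \<in> X"
    proof (cases "y = b \<or> y \<notin> set ws")
      case False
      then have "y \<in> nb b" using cl y b unfolding clique_def by auto
      then show ?thesis using assms(4) bX False unfolding attached_def by auto
    qed (use y bX assms(3) in auto)
  qed
  with v vmax u show ?thesis by blast
qed

text \<open>A label above \<open>j\<close> would, by \<open>large_label_attached\<close>, yield a
  vertex of at least that label whose visited neighbours all lie in \<open>X\<close>. So a bound
  relative to \<open>X\<close> alone bounds the labels relative to everything visited.\<close>

lemma block_closed:
  assumes "closed_at ws k" "mcs_visited G zs" "set zs = set ws \<union> X" "attached (set ws) X"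
    and "\<And>u. u \<in> pverts G - X \<Longrightarrow> lab X u \<le> j" "k \<le> j"
  shows "closed_at zs j"
  unfolding closed_at_def
proof (intro conjI ballI)
  fix u assume u: "u \<in> pverts G - set zs"
  show "lab (set zs) u \<le> j"
  proof (rule ccontr)
    assume "\<not> ?thesis"
    then have gt: "j < lab (set zs) u" by simp
    then obtain v where v: "v \<in> pverts G - set zs" "lab (set zs) u \<le> lab (set zs) v"
      "nb v \<inter> set zs \<subseteq> X"
      using large_label_attached[OF assms(1-4) u] assms(6) by auto
    then have "nb v \<inter> set zs = nb v \<inter> X" using assms(3) by auto
    then show False using v assms(3) assms(5)[of v] gt unfolding lab_def by auto
  qed
qed (use assms in simp)

text \<open>The \<open>k\<close> visited vertices of \<open>Q\<close> already exhaust the label of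
  \<open>x\<close>, which is at most \<open>k\<close>.\<close>

lemma closed_clique_inter:
  assumes "closed_at ws k" "clique Q" "card (Q \<inter> set ws) = k" "x \<in> Q - set ws"
  shows "nb x \<inter> set ws = Q \<inter> set ws"
proof -
  have "Q \<inter> set ws \<subseteq> nb x \<inter> set ws"
    using assms(2,4) unfolding clique_def by auto
  moreover have "card (nb x \<inter> set ws) \<le> k"
    using assms(1,2,4) unfolding closed_at_def clique_def lab_def by auto
  ultimately show ?thesis
    using assms(3) card_seteq[of "nb x \<inter> set ws" "Q \<inter> set ws"] by simp
qed

text \<open>After \<open>i\<close> new vertices of \<open>Q\<close> no label exceeds
  \<open>k + i\<close>, and the rest of \<open>Q\<close> attains this value. Hence the new part of
  \<open>Q\<close> may be visited in any order, which leaves room for a topological order of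
  \<open>R\<close>.\<close>

lemma visit_clique:
  assumes "closed_at ws k" "clique Q" "card (Q \<inter> set ws) = k"
    and "distinct xs" "set xs \<subseteq> Q - set ws"
  shows "mcs_visited G (ws @ xs)"
  using assms(4,5)
proof (induction xs rule: rev_induct)
  case Nil
  then show ?case using assms(1) by (simp add: closed_at_def)
next
  case (snoc x xs)
  let ?A = "set (ws @ xs)"
  have Q: "Q \<subseteq> pverts G" using assms(2) by (simp add: clique_def)
  have lab_le: "lab ?A w \<le> k + length xs" if "w \<in> pverts G - ?A" for w
  proof -
    have "lab ?A w \<le> card ((nb w \<inter> set ws) \<union> set xs)"
      unfolding lab_def by (intro card_mono) auto
    also have "\<dots> \<le> card (nb w \<inter> set ws) + card (set xs)" by (rule card_Un_le)
    also have "\<dots> \<le> k + length xs"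
      using assms(1) that by (intro add_mono card_length) (auto simp: closed_at_def lab_def)
    finally show ?thesis .
  qed
  have "card ((Q \<inter> set ws) \<union> set xs) = k + length xs"
    using assms(3) snoc.prems by (subst card_Un_disjoint) (auto simp: distinct_card)
  moreover have "(Q \<inter> set ws) \<union> set xs \<subseteq> nb x \<inter> ?A"
    using assms(2) snoc.prems unfolding clique_def by auto
  ultimately have "k + length xs \<le> lab ?A x"
    unfolding lab_def by (metis card_mono finite_Int finite_nb)
  with lab_le have "\<forall>w \<in> pverts G - ?A. lab ?A w \<le> lab ?A x"
    using le_trans by blast
  moreover have "x \<in> pverts G - ?A" using snoc.prems Q by auto
  ultimately show ?case
    using snoc mcs_snoc[of "ws @ xs" x] by auto
qed

text \<open>With threshold 1 a closure cannot stop before it fills the connected graph; this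
  identifies the block that the search starts with as the whole vertex set.\<close>

lemma connected_closed:
  assumes "Digraph_Component.connected (with_proj G)"
    and "A \<noteq> {}" "A \<subseteq> pverts G" "\<And>u. u \<in> pverts G \<Longrightarrow> 1 \<le> lab A u \<Longrightarrow> u \<in> A"
  shows "A = pverts G"
proof -
  obtain a where a: "a \<in> A" using assms(2) by auto
  have "parcs (mk_symmetric (with_proj G)) = parcs G"
    using arcs_symmetric by (auto simp: mk_symmetric_def)
  then have reach: "(a, v) \<in> rtrancl_on (pverts G) (parcs G)" if "v \<in> pverts G" for v
    using assms(1,3) a that
    by (auto simp: connected_def strongly_connected_def reachable_def mk_symmetric_def)
  have "v \<in> A" if "v \<in> pverts G" for v
    using reach[OF that]
  proof (induction rule: rtrancl_on_induct)
    case base then show ?case using a by simp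
  next
    case (step x y)
    then have "x \<in> nb y \<inter> A" "y \<in> pverts G" by (auto simp: nb_def dest: in_arcsD2)
    then have "1 \<le> lab A y"
      unfolding lab_def by (metis One_nat_def Suc_leI card_gt_0_iff empty_iff finite_Int finite_nb)
    then show ?case using assms(4) \<open>y \<in> pverts G\<close> by blast
  qed
  then show ?thesis using assms(3) by auto
qed

end

text \<open>Taking \<open>Suc i\<close> elements instead of \<open>i\<close> accommodates the
  reflexive pairs of \<open>R\<close>.\<close>

lemma topological_list:
  assumes "finite A" "trans R" "antisym R"
  shows "\<exists>xs. distinct xs \<and> set xs = A \<and>
    (\<forall>i < length xs. \<forall>x \<in> A. (x, xs ! i) \<in> R \<longrightarrow> x \<in> set (take (Suc i) xs))"
  using assms(1)
proof (induction "card A" arbitrary: A)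
  case 0
  then show ?case by (intro exI[of _ "[]"]) auto
next
  case (Suc c)
  let ?r = "{(x, y). x \<in> A \<and> y \<in> A \<and> (x, y) \<in> R \<and> x \<noteq> y}"
  have "trans ?r"
    using assms(2,3) unfolding trans_def antisym_def by blast
  then have "?r\<^sup>+ = ?r" by (rule trancl_id)
  then have "acyclic ?r" unfolding acyclic_def by auto
  then have "acyclic (?r\<inverse>)" by (simp only: acyclic_converse)
  moreover have "finite ?r"
    using Suc.prems by (intro finite_subset[of ?r "A \<times> A"]) auto
  ultimately have "wf (?r\<inverse>)" by (intro finite_acyclic_wf) auto
  moreover obtain a where "a \<in> A" using Suc.hyps(2) by fastforce
  \<comment> \<open>Well-foundedness is applied to the converse relation, so \<open>z\<close> is
    maximal for \<open>R\<close> and can be put last.\<close>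
  ultimately obtain z where z: "z \<in> A" "\<And>y. (y, z) \<in> ?r\<inverse> \<Longrightarrow> y \<notin> A"
    by (rule wfE_min) blast
  have "c = card (A - {z})" "finite (A - {z})"
    using Suc.hyps(2) Suc.prems z(1) by simp_all
  from Suc.hyps(1)[OF this] obtain xs where xs: "distinct xs" "set xs = A - {z}"
    "\<forall>i < length xs. \<forall>x \<in> A - {z}. (x, xs ! i) \<in> R \<longrightarrow> x \<in> set (take (Suc i) xs)"
    by blast
  have nz: "(z, xs ! i) \<notin> R" if "i < length xs" for i
  proof
    assume "(z, xs ! i) \<in> R"
    moreover have "xs ! i \<in> A" "xs ! i \<noteq> z" using xs(2) nth_mem[OF that] by auto
    ultimately show False using z(1) z(2)[of "xs ! i"] by simp
  qed
  show ?case
  proof (intro exI[of _ "xs @ [z]"] conjI allI impI ballI)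
    fix i x assume "i < length (xs @ [z])" "x \<in> A" "(x, (xs @ [z]) ! i) \<in> R"
    then show "x \<in> set (take (Suc i) (xs @ [z]))"
    proof (cases "i = length xs")
      case False
      then have i: "i < length xs" "(x, xs ! i) \<in> R"
        using \<open>i < length (xs @ [z])\<close> \<open>(x, (xs @ [z]) ! i) \<in> R\<close> by (auto simp: nth_append)
      then have "x \<noteq> z" using nz by blast
      then show ?thesis using xs(3) i \<open>x \<in> A\<close> by auto
    qed (use xs z(1) in auto)
  qed (use xs(1,2) z(1) in auto)
qed

section \<open>Blocks of a search and the partial order\<close>

locale chordal_order = chordal_graph +
  fixes R :: "'a rel" and \<F> :: "'a set set"
  assumes connected: "Digraph_Component.connected (with_proj G)"
    and order: "partial_order_on (pverts G) R"
    and family_clique: "Q \<in> \<F> \<Longrightarrow> clique Q"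
    and family_empty: "{} \<in> \<F>"
    and family_maximal: "clique Q \<Longrightarrow> (\<And>v. v \<in> pverts G \<Longrightarrow> \<not> Q \<subseteq> nb v) \<Longrightarrow> Q \<in> \<F>"
begin

text \<open>
  \<open>blk P Q\<close> is visited when the search leaves the clique \<open>P\<close> through the separator \<open>P \<inter> Q\<close> and
  enters the clique \<open>Q\<close>; the vertices of the separator are visited already.
\<close>

definition blk :: "'a set \<Rightarrow> 'a set \<Rightarrow> 'a set" where
  "blk P Q = clos (Suc (card (P \<inter> Q))) Q"

text \<open>The vertices of \<open>Q - P\<close> come before the rest of the block, so none of them
  may wait for a vertex of the rest. Predecessors outside the block are the concern of the enclosing
  block.\<close>

definition start_ok :: "'a set \<Rightarrow> 'a set \<Rightarrow> bool" where
  "start_ok P Q \<longleftrightarrow> (\<forall>y \<in> Q - P. \<forall>x \<in> blk P Q. (x, y) \<in> R \<longrightarrow> x \<in> Q)"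

text \<open>\<open>P'\<close> serves to name the separator: \<open>P' \<inter> Q'\<close> has to be
  what \<open>X\<close> already contains of \<open>Q'\<close>. The bound on labels says that
  \<open>X\<close> offers no larger separator, as the search demands. The last clause looks only at
  predecessors within the current block; all others were visited before or are checked further
  out.\<close>

definition can_extend :: "'a set \<Rightarrow> 'a set \<Rightarrow> 'a set \<Rightarrow> 'a set \<Rightarrow> 'a set \<Rightarrow> bool" where
  "can_extend P Q X P' Q' \<longleftrightarrow> card (P \<inter> Q) < card (P' \<inter> Q') \<and> X \<inter> Q' = P' \<inter> Q' \<and>
    (\<forall>u \<in> pverts G - X. lab X u \<le> card (P' \<inter> Q')) \<and>
    (\<forall>y \<in> blk P' Q' - X. \<forall>x \<in> blk P Q. (x, y) \<in> R \<longrightarrow> x \<in> X \<union> blk P' Q')"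

inductive grows :: "'a set \<Rightarrow> 'a set \<Rightarrow> 'a set \<Rightarrow> bool" where
  start: "P \<in> \<F> \<Longrightarrow> Q \<in> \<F> \<Longrightarrow> grows P Q Q"
| extend: "grows P Q X \<Longrightarrow> can_extend P Q X P' Q' \<Longrightarrow> start_ok P' Q' \<Longrightarrow>
    grows P' Q' (blk P' Q') \<Longrightarrow> grows P Q (X \<union> blk P' Q')"

lemma grows_family: "grows P Q X \<Longrightarrow> P \<in> \<F> \<and> Q \<in> \<F>"
  by (induction rule: grows.induct) auto

lemma subset_blk: "Q \<subseteq> blk P Q"
  unfolding blk_def by (rule clos_superset)

text \<open>A vertex of \<open>Q'\<close> outside \<open>X\<close> sees at least \<open>m\<close>
  vertices of the closure, so all of \<open>Q'\<close> is absorbed; from there the higher threshold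
  adds nothing new.\<close>

lemma clos_absorb:
  assumes "X \<subseteq> clos m Q" "clique Q'" "m \<le> card (X \<inter> Q')" "m \<le> m'"
  shows "clos m' Q' \<subseteq> clos m Q"
proof (rule clos_least[OF _ assms(4)], rule subsetI)
  fix q assume q: "q \<in> Q'"
  show "q \<in> clos m Q"
  proof (cases "q \<in> X")
    case False
    then have "X \<inter> Q' \<subseteq> nb q \<inter> clos m Q"
      using assms(1) cliqueD[OF assms(2) _ q] False by blast
    then have "card (X \<inter> Q') \<le> lab (clos m Q) q"
      unfolding lab_def by (intro card_mono) auto
    then show ?thesis
      using assms(2,3) q clos_closed[of q m Q] unfolding clique_def by auto
  qed (use assms in auto)
qed

lemma grows_subset_blk: "grows P Q X \<Longrightarrow> X \<subseteq> blk P Q"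
proof (induction rule: grows.induct)
  case (extend P Q X P' Q')
  have "blk P' Q' \<subseteq> blk P Q"
    using extend.IH(1) extend.hyps(2) grows_family[OF extend.hyps(4)] family_clique
    unfolding blk_def can_extend_def by (intro clos_absorb[of X]) auto
  then show ?case using extend.IH(1) by auto
qed (rule subset_blk)

text \<open>Generality in the prefix \<open>ws\<close> makes the claim applicable to a sub-block,
  whose prefix includes a part of the outer block. The last conjunct prepares the comparison with a
  given ordering: as long as some unvisited vertex sees \<open>j\<close> vertices of
  \<open>X\<close>, all of \<open>X\<close> is reachable from \<open>Q\<close> with threshold
  \<open>j\<close>.\<close>

lemma grows_visit:
  assumes "grows P Q X" "start_ok P Q" "closed_at ws k" "k = card (P \<inter> Q)" "Q \<inter> set ws = P \<inter> Q"
  shows "\<exists>xs. mcs_visited G (ws @ xs) \<and> set xs = X - set ws \<and> X \<inter> set ws = P \<inter> Q \<and>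
    attached (set ws) X \<and>
    (\<forall>i < length xs. \<forall>x \<in> blk P Q. (x, xs ! i) \<in> R \<longrightarrow> x \<in> set ws \<union> set (take (Suc i) xs)) \<and>
    (\<forall>j > k. \<forall>u \<in> pverts G - (set ws \<union> X). j \<le> lab X u \<longrightarrow> X \<subseteq> clos j Q)"
  using assms
proof (induction arbitrary: ws k rule: grows.induct)
  case (start P Q)
  have cl: "clique Q" using start family_clique by auto
  then have fin: "finite (Q - set ws)" using finite_subset_verts by (auto simp: clique_def)
  from topological_list[OF fin partial_order_onD(2,3)[OF order]]
  obtain xs where xs: "distinct xs" "set xs = Q - set ws"
    "\<forall>i < length xs. \<forall>x \<in> Q - set ws. (x, xs ! i) \<in> R \<longrightarrow> x \<in> set (take (Suc i) xs)"
    by blast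
  have f0: "mcs_visited G (ws @ xs)"
    using start.prems xs cl by (intro visit_clique[of ws k Q]) auto
  have f3: "attached (set ws) Q"
    unfolding attached_def using closed_clique_inter[OF start.prems(2) cl] start.prems(3,4) by auto
  have f4: "x \<in> set ws \<union> set (take (Suc i) xs)"
    if "i < length xs" "x \<in> blk P Q" "(x, xs ! i) \<in> R" for i x
  proof -
    have "xs ! i \<in> Q - P"
      using nth_mem[OF that(1)] xs(2) start.prems(4) by auto
    then have "x \<in> Q" using start.prems(1) that unfolding start_ok_def by blast
    then show ?thesis using xs(3) that by auto
  qed
  show ?case
    by (intro exI[of _ xs] conjI allI ballI impI f0 xs(2) start.prems(4) f3 f4 clos_superset)
next
  case (extend P Q X P' Q')
  let ?B = "blk P' Q'" and ?j = "card (P' \<inter> Q')"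
  have ext: "k < ?j" "X \<inter> Q' = P' \<inter> Q'" "\<And>u. u \<in> pverts G - X \<Longrightarrow> lab X u \<le> ?j"
    "\<And>y x. y \<in> ?B - X \<Longrightarrow> x \<in> blk P Q \<Longrightarrow> (x, y) \<in> R \<Longrightarrow> x \<in> X \<union> ?B"
    using extend.hyps(2) extend.prems(3) unfolding can_extend_def by auto
  have cl: "clique Q'" using grows_family[OF extend.hyps(4)] family_clique by auto
  obtain xs where xs: "mcs_visited G (ws @ xs)" "set xs = X - set ws" "X \<inter> set ws = P \<inter> Q"
    "attached (set ws) X"
    and xs_R: "\<And>i x. i < length xs \<Longrightarrow> x \<in> blk P Q \<Longrightarrow> (x, xs ! i) \<in> R \<Longrightarrow>
      x \<in> set ws \<union> set (take (Suc i) xs)"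
    and xs_j: "\<And>j u. j > k \<Longrightarrow> u \<in> pverts G - (set ws \<union> X) \<Longrightarrow> j \<le> lab X u \<Longrightarrow> X \<subseteq> clos j Q"
    using extend.IH(1)[OF extend.prems] by blast
  have zs: "set (ws @ xs) = set ws \<union> X" using xs(2) by auto
  have closed: "closed_at (ws @ xs) ?j"
    using block_closed[OF extend.prems(2) xs(1) zs xs(4) ext(3)] ext(1) by simp
  \<comment> \<open>The new separator is larger than \<open>P \<inter> Q\<close>, so it contains a
    vertex \<open>b\<close> visited inside the block. A vertex of \<open>Q'\<close> visited before
    the block is a neighbour of \<open>b\<close> and lies in \<open>X\<close> by attachment.\<close>
  have QW: "Q' \<inter> set ws \<subseteq> X"
  proof
    fix w assume w: "w \<in> Q' \<inter> set ws"
    have "\<not> X \<inter> Q' \<subseteq> P \<inter> Q"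
    proof
      assume "X \<inter> Q' \<subseteq> P \<inter> Q"
      moreover have "finite (P \<inter> Q)" using xs(3) by (metis finite_Int finite_set)
      ultimately have "card (X \<inter> Q') \<le> card (P \<inter> Q)" by (intro card_mono)
      with ext(1,2) extend.prems(3) show False by simp
    qed
    then obtain b where "b \<in> X \<inter> Q'" "b \<notin> P \<inter> Q" by blast
    then have b: "b \<in> X \<inter> Q'" "b \<notin> set ws" using xs(3) by blast+
    then have "w \<in> nb b" using w cliqueD[OF cl, of w b] by auto
    then show "w \<in> X" using xs(4) b w unfolding attached_def by blast
  qed
  then have Q'_zs: "Q' \<inter> set (ws @ xs) = P' \<inter> Q'" using zs ext(2) by blast
  obtain ys where ys: "mcs_visited G ((ws @ xs) @ ys)" "set ys = ?B - set (ws @ xs)"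
    "?B \<inter> set (ws @ xs) = P' \<inter> Q'" "attached (set (ws @ xs)) ?B"
    and ys_R: "\<And>i x. i < length ys \<Longrightarrow> x \<in> ?B \<Longrightarrow> (x, ys ! i) \<in> R \<Longrightarrow>
      x \<in> set (ws @ xs) \<union> set (take (Suc i) ys)"
    using extend.IH(2)[OF extend.hyps(3) closed refl Q'_zs] by blast
  have BW: "?B \<inter> set ws \<subseteq> X" using ys(3) ext(2) zs by blast
  have f1: "set (xs @ ys) = (X \<union> ?B) - set ws" using xs(2) ys(2) zs by auto
  have f2: "(X \<union> ?B) \<inter> set ws = P \<inter> Q" using xs(3) BW by blast
  have f3: "attached (set ws) (X \<union> ?B)"
    unfolding attached_def
  proof
    fix x assume x: "x \<in> X \<union> ?B - set ws"
    show "nb x \<inter> set ws \<subseteq> X \<union> ?B"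
    proof (cases "x \<in> X")
      case True
      then show ?thesis using xs(4) x unfolding attached_def by blast
    next
      case False
      then show ?thesis using ys(4) x zs unfolding attached_def by blast
    qed
  qed
  have f4: "x \<in> set ws \<union> set (take (Suc i) (xs @ ys))"
    if i: "i < length (xs @ ys)" and x: "x \<in> blk P Q" "(x, (xs @ ys) ! i) \<in> R" for i x
  proof (cases "i < length xs")
    case True
    then show ?thesis using xs_R[of i x] x by (auto simp: nth_append)
  next
    case False
    let ?y = "ys ! (i - length xs)"
    have y: "i - length xs < length ys" "(x, ?y) \<in> R" using False i x by (auto simp: nth_append)
    then have "?y \<in> ?B - X" using nth_mem[of "i - length xs" ys] ys(2) zs by auto
    then have "x \<in> X \<union> ?B" using ext(4) x(1) y(2) by blast
    then show ?thesis
    proof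
      assume "x \<in> X"
      then show ?thesis using xs(2) False by auto
    next
      assume "x \<in> ?B"
      then show ?thesis using ys_R[OF y(1) _ y(2)] False by (auto simp: Suc_diff_le)
    qed
  qed
  \<comment> \<open>After the sub-block no remaining label exceeds the size of its separator, so
    \<open>j\<close> is at most that size. A vertex of \<open>Q'\<close> outside \<open>X\<close>
    then had label at least \<open>j\<close> before the sub-block; the induction hypothesis for it
    covers \<open>X\<close>, and \<open>clos_absorb\<close> covers the sub-block.\<close>
  have f5: "X \<union> ?B \<subseteq> clos j Q"
    if j: "j > k" and u: "u \<in> pverts G - (set ws \<union> (X \<union> ?B))" "j \<le> lab (X \<union> ?B) u" for j u
  proof (cases "?B \<subseteq> X")
    case True
    then have "X \<union> ?B = X" by auto
    then show ?thesis using xs_j[OF j] u by auto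
  next
    case False
    have zs': "set ((ws @ xs) @ ys) = set (ws @ xs) \<union> ?B" using ys(2) by auto
    have "lab ?B v \<le> ?j" if "v \<in> pverts G - ?B" for v
      using clos_closed[of v "Suc ?j" Q'] that unfolding blk_def by (metis DiffD1 DiffD2 not_less_eq_eq)
    then have "closed_at ((ws @ xs) @ ys) ?j"
      using block_closed[OF closed ys(1) zs' ys(4)] by auto
    moreover have "set ((ws @ xs) @ ys) = set ws \<union> (X \<union> ?B)" using zs zs' by auto
    ultimately have "lab (set ws \<union> (X \<union> ?B)) u \<le> ?j"
      using u(1) unfolding closed_at_def by auto
    then have jj: "j \<le> ?j"
      using u(2) lab_mono[of "X \<union> ?B" "set ws \<union> (X \<union> ?B)" u] by auto
    have "\<not> Q' \<subseteq> X"
    proof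
      assume "Q' \<subseteq> X"
      then have "?B \<subseteq> X"
        unfolding blk_def using ext(3) by (intro clos_subset) (auto simp: not_less_eq_eq[symmetric])
      with False show False by simp
    qed
    then obtain q where q: "q \<in> Q'" "q \<notin> X" by auto
    have "X \<inter> Q' \<subseteq> nb q \<inter> X" using cliqueD[OF cl _ q(1)] q(2) by blast
    then have "?j \<le> lab X q"
      unfolding lab_def ext(2)[symmetric] by (intro card_mono) auto
    moreover have "q \<in> pverts G - (set ws \<union> X)" using q QW clique_verts[OF cl] by blast
    ultimately have X: "X \<subseteq> clos j Q" using xs_j[OF j, of q] jj by auto
    moreover have "?B \<subseteq> clos j Q"
      unfolding blk_def using X cl jj ext(2) by (intro clos_absorb[of X]) auto
    ultimately show ?thesis by simp
  qed
  have f0: "mcs_visited G (ws @ xs @ ys)" using ys(1) by simp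
  show ?case
    by (intro exI[of _ "xs @ ys"] conjI allI ballI impI f0 f1 f2 f3 f4 f5)
qed

text \<open>Any fixed point of the growth reached from the initial cliques qualifies. A sub-block
  counts as searchable once its own entry of the table is full.\<close>

definition saturated :: "('a set \<Rightarrow> 'a set \<Rightarrow> 'a set) \<Rightarrow> bool" where
  "saturated D \<longleftrightarrow> (\<forall>P \<in> \<F>. \<forall>Q \<in> \<F>. grows P Q (D P Q) \<and>
    (\<forall>P' \<in> \<F>. \<forall>Q' \<in> \<F>. can_extend P Q (D P Q) P' Q' \<and> start_ok P' Q' \<and> blk P' Q' \<subseteq> D P' Q'
      \<longrightarrow> blk P' Q' \<subseteq> D P Q))"

text \<open>Leaving the empty clique gives a separator of size 0 and hence threshold 1, so by
  connectedness the block is the whole graph, and visiting it is a complete search.\<close>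

lemma grows_sound:
  assumes gr: "grows {} Q (blk {} Q)" and "Q \<noteq> {}" "start_ok {} Q"
  shows "\<exists>\<sigma>. mcs_ordering G \<sigma> \<and> order_extends \<sigma> R"
proof -
  have clq: "clique Q" using grows_family[OF gr] family_clique by auto
  have V: "blk {} Q = pverts G"
  proof (rule connected_closed[OF connected])
    show "blk {} Q \<noteq> {}" using subset_blk[of Q "{}"] assms(2) by auto
    show "blk {} Q \<subseteq> pverts G" using clq unfolding blk_def clique_def by (intro clos_verts) auto
    show "u \<in> pverts G \<Longrightarrow> 1 \<le> lab (blk {} Q) u \<Longrightarrow> u \<in> blk {} Q" for u
      unfolding blk_def using clos_closed[of u 1 Q] by simp
  qed
  have "closed_at [] 0" by (simp add: closed_at_def mcs_visited.start lab_def)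
  from grows_visit[OF gr assms(3) this] obtain xs where xs: "mcs_visited G xs" "set xs = pverts G"
    "\<forall>i < length xs. \<forall>x \<in> pverts G. (x, xs ! i) \<in> R \<longrightarrow> x \<in> set (take (Suc i) xs)"
    unfolding V by auto
  have "order_extends xs R"
    unfolding order_extends_def
  proof (intro allI impI)
    fix i j assume ij: "i < length xs" "j < length xs" "(xs ! i, xs ! j) \<in> R"
    then have "xs ! i \<in> set (take (Suc j) xs)" using xs(2,3) nth_mem[OF ij(1)] by auto
    then obtain a where "a < Suc j" "a < length xs" "xs ! i = xs ! a"
      by (auto simp: in_set_conv_nth)
    then show "i \<le> j"
      using ij(1) mcs_visited_distinct[OF xs(1)] by (auto simp: nth_eq_iff_index_eq)
  qed
  then show ?thesis using xs unfolding mcs_ordering_def by auto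
qed

end

section \<open>Completeness: following one ordering that extends the partial order\<close>

locale mcs_run = chordal_order +
  fixes xs :: "'a list"
  assumes ordering: "mcs_ordering G xs" and extends: "order_extends xs R"
begin

definition W :: "nat \<Rightarrow> 'a set" where
  "W i = set (take i xs)"

definition L :: "nat \<Rightarrow> nat" where
  "L i = lab (W i) (xs ! i)"

lemma mcs: "mcs_visited G xs" and set_xs: "set xs = pverts G"
  using ordering by (auto simp: mcs_ordering_def)

lemma distinct_xs: "distinct xs"
  using mcs_visited_distinct[OF mcs] by simp

lemma nth_verts: "i < length xs \<Longrightarrow> xs ! i \<in> pverts G"
  using set_xs nth_mem by blast

lemma W_nth: "i \<le> length xs \<Longrightarrow> W i = (!) xs ` {..<i}"
  by (simp add: W_def nth_image lessThan_atLeast0)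

lemma W_length: "W (length xs) = pverts G"
  by (simp add: W_def set_xs)

lemma W_mono: "i \<le> j \<Longrightarrow> W i \<subseteq> W j"
  unfolding W_def by (rule set_take_subset_set_take)

lemma W_split: "i \<le> e \<Longrightarrow> e \<le> length xs \<Longrightarrow> W e = W i \<union> (!) xs ` {i..<e}"
proof -
  assume ie: "i \<le> e" "e \<le> length xs"
  then have "{..<e} = {..<i} \<union> {i..<e}" by auto
  then show ?thesis using ie by (simp add: W_nth image_Un)
qed

lemma W_verts: "W i \<subseteq> pverts G"
  unfolding W_def using set_take_subset[of i xs] set_xs by simp

lemma nth_in_W: "i < length xs \<Longrightarrow> j \<le> length xs \<Longrightarrow> xs ! i \<in> W j \<longleftrightarrow> i < j"
  using distinct_xs by (auto simp: W_nth nth_eq_iff_index_eq)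

lemma W_Suc: "i < length xs \<Longrightarrow> W (Suc i) = insert (xs ! i) (W i)"
  by (simp add: W_def take_Suc_conv_app_nth)

lemma lab_W_le: "i < length xs \<Longrightarrow> u \<in> pverts G - W i \<Longrightarrow> lab (W i) u \<le> L i"
  unfolding W_def L_def by (rule mcs_nth[OF mcs])

lemma closed_at_take: "i < length xs \<Longrightarrow> closed_at (take i xs) (L i)"
  unfolding closed_at_def using mcs_visited_take[OF mcs] lab_W_le[unfolded W_def] by blast

lemma clique_nb_W: "i < length xs \<Longrightarrow> clique (nb (xs ! i) \<inter> W i)"
  unfolding W_def using mcs_visited_take[OF mcs, of "Suc i"]
  by (intro mcs_clique) (simp add: take_Suc_conv_app_nth)

lemma clique_insert_W: "i < length xs \<Longrightarrow> clique (insert (xs ! i) (nb (xs ! i) \<inter> W i))"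
  using clique_nb_W nth_verts by (intro clique_insert_nb) auto

lemma lab_W_Suc:
  "i < length xs \<Longrightarrow> lab (W (Suc i)) u = (if xs ! i \<in> nb u then Suc (lab (W i) u) else lab (W i) u)"
  using nth_in_W[of i i] by (auto simp: lab_def W_Suc Int_insert_right)

text \<open>A rise of the label means that the next vertex sees \<open>xs ! i\<close>. Its visited
  neighbours form a clique containing \<open>xs ! i\<close>, so the others are earlier neighbours of
  \<open>xs ! i\<close>, and the sizes leave only equality.\<close>

lemma lab_raise:
  assumes i: "Suc i < length xs" and "L i < L (Suc i)"
  shows "nb (xs ! Suc i) \<inter> W (Suc i) = insert (xs ! i) (nb (xs ! i) \<inter> W i)"
proof -
  let ?v = "xs ! Suc i" and ?D = "insert (xs ! i) (nb (xs ! i) \<inter> W i)"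
  let ?C = "nb ?v \<inter> W (Suc i)"
  have il: "i < length xs" using i by simp
  have "lab (W i) ?v \<le> L i"
    using lab_W_le[OF il] nth_verts[OF i] nth_in_W[OF i, of i] il by simp
  also have "L i < lab (W (Suc i)) ?v" using assms(2) by (simp add: L_def)
  finally have "xs ! i \<in> nb ?v" using lab_W_Suc[OF il, of ?v] by (simp split: if_splits)
  then have "xs ! i \<in> ?C" using W_Suc[OF il] by simp
  then have "?C \<subseteq> ?D" using cliqueD[OF clique_nb_W[OF i]] W_Suc[OF il] by blast
  moreover have "card ?D \<le> card ?C" using assms(2) by (simp add: L_def lab_def)
  ultimately show ?thesis by (intro card_seteq) auto
qed

lemma nb_W_run:
  assumes "i \<le> m" "m < length xs" "\<And>t. i \<le> t \<Longrightarrow> t < m \<Longrightarrow> L t < L (Suc t)"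
  shows "nb (xs ! m) \<inter> W m = (nb (xs ! i) \<inter> W i) \<union> (!) xs ` {i..<m}"
  using assms
proof (induction m rule: dec_induct)
  case (step m)
  have "nb (xs ! Suc m) \<inter> W (Suc m) = insert (xs ! m) (nb (xs ! m) \<inter> W m)"
    using lab_raise[of m] step by simp
  also have "\<dots> = insert (xs ! m) ((nb (xs ! i) \<inter> W i) \<union> (!) xs ` {i..<m})"
    using step by simp
  also have "\<dots> = (nb (xs ! i) \<inter> W i) \<union> (!) xs ` {i..<Suc m}"
    using step.hyps by (auto simp: atLeastLessThanSuc)
  finally show ?case .
qed simp

text \<open>\<open>m\<close> ends the run of rising labels that begins at \<open>i\<close>. A vertex
  seeing the whole final clique would still be unvisited and have label at least
  \<open>L m + 1\<close>, which would prolong the run.\<close>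

lemma run_clique:
  assumes i: "i < length xs"
  obtains m where "i \<le> m" "m < length xs" "\<And>t. i \<le> t \<Longrightarrow> t < m \<Longrightarrow> L t < L (Suc t)"
    "Suc m < length xs \<Longrightarrow> L (Suc m) \<le> L m"
    "insert (xs ! m) (nb (xs ! m) \<inter> W m) \<in> \<F>"
proof -
  define m where "m = (LEAST m. i \<le> m \<and> m < length xs \<and> (Suc m < length xs \<longrightarrow> L (Suc m) \<le> L m))"
  have m: "i \<le> m \<and> m < length xs \<and> (Suc m < length xs \<longrightarrow> L (Suc m) \<le> L m)"
    unfolding m_def by (rule LeastI[of _ "length xs - 1"]) (use i in auto)
  have run: "L t < L (Suc t)" if "i \<le> t" "t < m" for t
    using not_less_Least[OF that(2)[unfolded m_def]] that m by auto
  let ?Q = "insert (xs ! m) (nb (xs ! m) \<inter> W m)"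
  have "?Q \<in> \<F>"
  proof (rule family_maximal[OF clique_insert_W])
    fix v assume v: "v \<in> pverts G"
    show "\<not> ?Q \<subseteq> nb v"
    proof
      assume sub: "?Q \<subseteq> nb v"
      then have "v \<notin> ?Q" using nb_irrefl by blast
      moreover have "v \<in> nb (xs ! m)" using sub nb_sym by blast
      ultimately have nW: "v \<notin> W (Suc m)" using W_Suc[of m] m by auto
      then have lt: "Suc m < length xs"
        using W_length v m by (metis Suc_lessI)
      have "?Q \<subseteq> nb v \<inter> W (Suc m)" using sub W_Suc[of m] m by auto
      then have "card ?Q \<le> lab (W (Suc m)) v"
        unfolding lab_def by (intro card_mono) auto
      then have "Suc (L m) \<le> lab (W (Suc m)) v"
        using nth_in_W[of m m] m by (simp add: L_def lab_def)
      also have "\<dots> \<le> L (Suc m)" using lab_W_le[OF lt, of v] v nW by simp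
      finally show False using m lt by simp
    qed
  qed (use m in simp)
  with m run show ?thesis by (intro that) auto
qed

text \<open>\<open>P\<close> is chosen maximal among the visited cliques above the separator. If
  some vertex saw all of \<open>P\<close>, the label bound at time \<open>i\<close> would make
  \<open>P\<close> equal to the separator. The vertex following the last member of \<open>P\<close>
  would then either be \<open>xs ! i\<close> itself, with a rising label, or see all of
  \<open>P\<close> while being visited before \<open>i\<close>.\<close>

lemma exit_clique:
  assumes i: "0 < i" "i < length xs" "L i \<le> L (i - 1)"
  shows "\<exists>P \<in> \<F>. nb (xs ! i) \<inter> W i \<subseteq> P \<and> P \<subseteq> W i"
proof -
  let ?S = "nb (xs ! i) \<inter> W i"
  let ?C = "{P. clique P \<and> ?S \<subseteq> P \<and> P \<subseteq> W i}"
  have finW: "finite (W i)" by (simp add: W_def)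
  have "?C \<subseteq> Pow (W i)" by auto
  then have "finite ?C" using finW by (auto intro: finite_subset)
  moreover have "?S \<in> ?C" using clique_nb_W[OF i(2)] by auto
  ultimately obtain P where P: "P \<in> ?C" "?S \<subseteq> P" "\<And>P'. P' \<in> ?C \<Longrightarrow> P \<subseteq> P' \<Longrightarrow> P = P'"
    using finite_has_maximal2[of ?C ?S] by auto
  have finP: "finite P" using P(1) finW finite_subset by auto
  have max: "\<not> P \<subseteq> nb v" if "v \<in> W i" for v
  proof
    assume "P \<subseteq> nb v"
    moreover have "v \<in> pverts G" using that W_verts by auto
    ultimately have "insert v P \<in> ?C" using P(1) that clique_insert_nb by auto
    then have "v \<in> P" using P(3)[of "insert v P"] by auto
    with \<open>P \<subseteq> nb v\<close> show False using nb_irrefl by blast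
  qed
  have "P \<in> \<F>"
  proof (rule family_maximal)
    show "clique P" using P(1) by simp
    fix v assume v: "v \<in> pverts G"
    show "\<not> P \<subseteq> nb v"
    proof
      assume sub: "P \<subseteq> nb v"
      then have vW: "v \<notin> W i" using max by blast
      have "P \<subseteq> nb v \<inter> W i" using sub P(1) by auto
      then have "card P \<le> lab (W i) v" unfolding lab_def by (intro card_mono) auto
      also have "\<dots> \<le> card ?S" using lab_W_le[OF i(2), of v] v vW by (simp add: L_def lab_def)
      finally have PS: "P = ?S" using P(2) finP card_seteq by metis
      have ne: "P \<noteq> {}"
      proof
        assume "P = {}"
        moreover have "0 < length xs" using i by linarith
        then have "xs ! 0 \<in> W i" using nth_in_W[of 0 i] i by simp
        ultimately show False using max by blast
      qed
      let ?T = "{t. t < i \<and> xs ! t \<in> P}"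
      have finT: "finite ?T" by simp
      have Wi: "W i = (!) xs ` {..<i}" using W_nth i by simp
      have "?T \<noteq> {}" using ne P(1) Wi by auto
      define t where "t = Max ?T"
      have t: "t < i" "xs ! t \<in> P" using Max_in[OF finT \<open>?T \<noteq> {}\<close>] by (auto simp: t_def)
      have tl: "t < length xs" using t i by simp
      have before: "s \<le> t" if "s < i" "xs ! s \<in> P" for s
        using Max_ge[OF finT, of s] that by (auto simp: t_def)
      have "P \<subseteq> insert (xs ! t) (nb (xs ! t) \<inter> W t)"
      proof
        fix x assume x: "x \<in> P"
        then obtain s where s: "s < i" "x = xs ! s" using P(1) Wi by auto
        then have "s \<le> t" using before x by simp
        show "x \<in> insert (xs ! t) (nb (xs ! t) \<inter> W t)"
        proof (cases "s = t")
          case False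
          then have "x \<in> W t" using \<open>s \<le> t\<close> s tl nth_in_W[of s t] by auto
          moreover have "x \<noteq> xs ! t" using calculation nth_in_W[of t t] tl by auto
          then have "x \<in> nb (xs ! t)" using cliqueD[of P] P(1) x t(2) by blast
          ultimately show ?thesis by blast
        qed (use s in simp)
      qed
      moreover have "insert (xs ! t) (nb (xs ! t) \<inter> W t) \<in> ?C"
        using calculation clique_insert_W[OF tl] P(2) W_mono[of t i] t(1) nth_in_W[of t i] i(2)
        by auto
      ultimately have Pt: "P = insert (xs ! t) (nb (xs ! t) \<inter> W t)" using P(3) by blast
      have "xs ! t \<notin> nb (xs ! t) \<inter> W t" by simp
      then have cP: "card P = Suc (L t)" unfolding Pt L_def lab_def by simp
      then have Li: "L i = Suc (L t)" using PS by (simp add: L_def lab_def)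
      show False
      proof (cases "Suc t = i")
        case True
        then show False using i(3) Li by auto
      next
        case False
        then have t1: "Suc t < i" "Suc t < length xs" using t(1) i by auto
        have "P \<subseteq> nb (xs ! i) \<inter> W (Suc t)"
          using PS Pt W_Suc[OF tl] by auto
        then have "card P \<le> lab (W (Suc t)) (xs ! i)"
          unfolding lab_def by (intro card_mono) auto
        also have "\<dots> \<le> L (Suc t)"
          using lab_W_le[OF t1(2), of "xs ! i"] nth_verts i(2) nth_in_W[of i "Suc t"] t1 by auto
        finally have "L t < L (Suc t)" using cP by simp
        then have "nb (xs ! Suc t) \<inter> W (Suc t) = P"
          using lab_raise[OF t1(2)] Pt by simp
        then have "P \<subseteq> nb (xs ! Suc t)" by blast
        moreover have "xs ! Suc t \<in> W i" using nth_in_W[of "Suc t" i] t1 i by auto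
        ultimately show False using max by blast
      qed
    qed
  qed
  then show ?thesis using P(1) by auto
qed

text \<open>The block is visited in one stretch, ended by the first label that drops to
  \<open>L i\<close> or below. A vertex of the stretch has more than \<open>L i\<close> visited
  neighbours, so one of them, \<open>b\<close>, lies in the stretch; the neighbours visited before
  \<open>i\<close> are also neighbours of \<open>b\<close>, by the clique property, and inductively
  belong to \<open>Q\<close>.\<close>

lemma block_segment:
  assumes i: "i < length xs" and Q: "clique Q" "xs ! i \<in> Q" "card (Q \<inter> W i) = L i"
    and e: "i < e" "e \<le> length xs" "Q \<subseteq> W e"
    and inner: "\<And>t. i < t \<Longrightarrow> t < e \<Longrightarrow> L i < L t" and outer: "e < length xs \<Longrightarrow> L e \<le> L i"
  shows "clos (Suc (L i)) Q = Q \<union> (!) xs ` {i..<e}"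
proof
  let ?X = "Q \<union> (!) xs ` {i..<e}"
  have inter: "nb x \<inter> W i = Q \<inter> W i" if "x \<in> Q" "x \<notin> W i" for x
    using closed_clique_inter[OF closed_at_take[OF i] Q(1), folded W_def, OF Q(3)] that by simp
  have seg: "xs ! t \<in> clos (Suc (L i)) Q \<and> nb (xs ! t) \<inter> W i \<subseteq> Q" if "i \<le> t" "t < e" for t
    using that
  proof (induction t rule: less_induct)
    case (less t)
    have tl: "t < length xs" using less.prems e by simp
    show ?case
    proof (cases "t = i")
      case True
      then show ?thesis
        using inter[OF Q(2)] nth_in_W[of i i] i clos_superset Q(2) by auto
    next
      case False
      let ?C = "nb (xs ! t) \<inter> W t"
      have Wt: "W t = (!) xs ` {..<t}" using W_nth tl by simp
      have cl: "clique ?C" by (rule clique_nb_W[OF tl])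
      have big: "L i < card ?C" using inner[of t] False less.prems by (simp add: L_def lab_def)
      have "xs ! t \<in> pverts G - W i" using nth_verts[OF tl] nth_in_W[OF tl, of i] i less.prems by auto
      then have "card (nb (xs ! t) \<inter> W i) \<le> L i" using lab_W_le[OF i] by (simp add: lab_def)
      then have "\<not> ?C \<subseteq> nb (xs ! t) \<inter> W i" using big card_mono[of "nb (xs ! t) \<inter> W i" ?C] by auto
      then obtain b where b: "b < t" "xs ! b \<in> ?C" "xs ! b \<notin> W i" using Wt by auto
      have ib: "i \<le> b" using b nth_in_W[of b i] i tl by auto
      then have IHb: "nb (xs ! b) \<inter> W i \<subseteq> Q" using less.IH b less.prems by auto
      have CQ: "?C \<inter> W i \<subseteq> Q" using IHb cliqueD[OF cl _ b(2)] b(3) by blast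
      have "?C \<subseteq> clos (Suc (L i)) Q"
      proof
        fix c assume c: "c \<in> ?C"
        then obtain a where a: "a < t" "c = xs ! a" using Wt by auto
        show "c \<in> clos (Suc (L i)) Q"
        proof (cases "i \<le> a")
          case True
          then show ?thesis using less.IH[of a] a less.prems by auto
        next
          case False
          then have "c \<in> W i" using a nth_in_W[of a i] i by auto
          then show ?thesis using c CQ clos_superset by blast
        qed
      qed
      then have "Suc (L i) \<le> lab (clos (Suc (L i)) Q) (xs ! t)"
        using big card_mono[of "nb (xs ! t) \<inter> clos (Suc (L i)) Q" ?C] unfolding lab_def by auto
      then have "xs ! t \<in> clos (Suc (L i)) Q" using clos_closed nth_verts[OF tl] by blast
      moreover have "nb (xs ! t) \<inter> W i \<subseteq> Q" using CQ W_mono[of i t] less.prems by blast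
      ultimately show ?thesis by simp
    qed
  qed
  then show "?X \<subseteq> clos (Suc (L i)) Q" using clos_superset by auto
  have We: "W e = (!) xs ` {..<e}" using W_nth e by simp
  have XW: "?X \<subseteq> W e" using e(3) We by auto
  show "clos (Suc (L i)) Q \<subseteq> ?X"
  proof (rule clos_subset)
    fix u assume u: "u \<in> pverts G" "Suc (L i) \<le> lab ?X u"
    show "u \<in> ?X"
    proof (rule ccontr)
      assume nX: "u \<notin> ?X"
      show False
      proof (cases "u \<in> W e")
        case False
        then have el: "e < length xs" using u(1) W_length e(2) by (metis le_neq_implies_less)
        then have "lab (W e) u \<le> L e" using lab_W_le u(1) False by simp
        then show False using lab_mono[OF XW, of u] u(2) outer[OF el] by simp
      next
        case True
        then have uW: "u \<in> W i" using nX W_split[of i e] e by auto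
        \<comment> \<open>Here \<open>u\<close> was visited before \<open>i\<close> and lies outside
          \<open>Q\<close>; a neighbour in the stretch would put it into \<open>Q\<close> by
          \<open>seg\<close>.\<close>
        have "nb u \<inter> ?X \<subseteq> Q \<inter> W i"
        proof
          fix y assume y: "y \<in> nb u \<inter> ?X"
          have "y \<notin> (!) xs ` {i..<e}"
          proof
            assume "y \<in> (!) xs ` {i..<e}"
            then obtain t where t: "i \<le> t" "t < e" "y = xs ! t" by auto
            then have "u \<in> Q" using seg[of t] y uW nb_sym by blast
            then show False using nX by simp
          qed
          moreover have "y \<in> W e" using y XW by auto
          ultimately show "y \<in> Q \<inter> W i"
            using y W_split[of i e] e by auto
        qed
        moreover have "finite (Q \<inter> W i)" by (simp add: W_def)
        ultimately have "lab ?X u \<le> card (Q \<inter> W i)" unfolding lab_def by (intro card_mono)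
        then show False using u(2) Q(3) by simp
      qed
    qed
  qed simp
qed


text \<open>The last clause says, without naming the end, that the block occupies an interval of
  positions beginning at \<open>i\<close>. At position 0 the clique left has to be the empty one,
  which is where the answer is looked up.\<close>

definition entered :: "nat \<Rightarrow> 'a set \<Rightarrow> 'a set \<Rightarrow> bool" where
  "entered i P Q \<longleftrightarrow> P \<in> \<F> \<and> Q \<in> \<F> \<and> (i = 0 \<longrightarrow> P = {}) \<and> xs ! i \<in> Q \<and>
    Q \<inter> W i = P \<inter> Q \<and> card (P \<inter> Q) = L i \<and> blk P Q \<inter> W i = P \<inter> Q \<and>
    (\<forall>a b. i \<le> a \<longrightarrow> a \<le> b \<longrightarrow> b < length xs \<longrightarrow> xs ! b \<in> blk P Q \<longrightarrow> xs ! a \<in> blk P Q)"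

text \<open>
  In the proof, \<open>r\<close> is the first vertex of the block that is missing from \<open>D P Q\<close>; the search
  enters a new clique there, and its label is the maximal one among the missing vertices.
\<close>

lemma saturated_block:
  assumes D: "saturated D" and i: "i < length xs" "i = 0 \<or> L i \<le> L (i - 1)"
  shows "\<exists>P Q. entered i P Q \<and> start_ok P Q \<and> blk P Q \<subseteq> D P Q"
  using i
\<comment> \<open>Sub-blocks have larger separators, so the induction goes from large labels to
  small ones.\<close>
proof (induction "card (pverts G) - L i" arbitrary: i rule: less_induct)
  case less
  note il = less.prems(1)
  obtain m where m: "i \<le> m" "m < length xs" "\<And>t. i \<le> t \<Longrightarrow> t < m \<Longrightarrow> L t < L (Suc t)"
    "Suc m < length xs \<Longrightarrow> L (Suc m) \<le> L m"
    "insert (xs ! m) (nb (xs ! m) \<inter> W m) \<in> \<F>"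
    using run_clique[OF il] by blast
  define Q where "Q = insert (xs ! m) (nb (xs ! m) \<inter> W m)"
  have QF: "Q \<in> \<F>" using m(5) by (simp add: Q_def)
  have clQ: "clique Q" using family_clique[OF QF] .
  have Q_eq: "Q = (nb (xs ! i) \<inter> W i) \<union> (!) xs ` {i..m}"
    using nb_W_run[OF m(1-3)] m(1) unfolding Q_def
    by (auto simp: atLeastLessThanSuc simp flip: atLeastLessThanSuc_atLeastAtMost)
  have notW: "xs ! t \<notin> W i" if "i \<le> t" "t < length xs" for t
    using nth_in_W[OF that(2), of i] that il by simp
  have QW: "Q \<inter> W i = nb (xs ! i) \<inter> W i"
    unfolding Q_eq using notW m(2) by auto
  have cQW: "card (Q \<inter> W i) = L i" unfolding QW by (simp add: L_def lab_def)
  have iQ: "xs ! i \<in> Q" unfolding Q_eq using m(1) by auto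
  obtain P where P: "P \<in> \<F>" "nb (xs ! i) \<inter> W i \<subseteq> P" "P \<subseteq> W i" "i = 0 \<longrightarrow> P = {}"
  proof (cases "i = 0")
    case True
    then have "W i = {}" by (simp add: W_def)
    then show ?thesis using that[of "{}"] family_empty by auto
  next
    case False
    then show ?thesis using that exit_clique[of i] less.prems by auto
  qed
  have PQ: "Q \<inter> W i = P \<inter> Q" using P(2,3) QW by blast
  have cPQ: "card (P \<inter> Q) = L i" using cQW PQ by simp
  have run: "L i < L t" if "i < t" "t \<le> m" for t
    using that
  proof (induction t rule: less_induct)
    case (less t)
    then have "L (t - 1) < L t" using m(3)[of "t - 1"] by auto
    moreover have "L i \<le> L (t - 1)"
    proof (cases "i < t - 1")
      case True
      then have "L i < L (t - 1)" using less.prems by (intro less.IH) linarith+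
      then show ?thesis by simp
    next
      case False
      then have "t - 1 = i" using less.prems by linarith
      then show ?thesis by simp
    qed
    ultimately show ?case by simp
  qed
  \<comment> \<open>The block ends at \<open>e\<close>. Positions up to \<open>m\<close> can be
    skipped, as \<open>run\<close> shows that the labels there exceed \<open>L i\<close>.\<close>
  define e where "e = (LEAST e. m < e \<and> (e = length xs \<or> e < length xs \<and> L e \<le> L i))"
  have e: "m < e" "e = length xs \<or> e < length xs \<and> L e \<le> L i"
    using LeastI[of "\<lambda>e. m < e \<and> (e = length xs \<or> e < length xs \<and> L e \<le> L i)" "length xs"] m(2)
    by (auto simp: e_def)
  have e_inner: "L i < L t" if "i < t" "t < e" for t
    using not_less_Least[OF that(2)[unfolded e_def]] run[of t] that e(2)
    by (cases "t \<le> m") auto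
  have Qe: "Q \<subseteq> W e"
    using W_mono[of i e] W_mono[of "Suc m" e] W_split[of i "Suc m"] m(1,2) e(1) unfolding Q_eq
    by (auto simp: atLeastLessThanSuc_atLeastAtMost)
  have blk: "blk P Q = Q \<union> (!) xs ` {i..<e}"
    unfolding blk_def cPQ using m(1) e e_inner Qe
    by (intro block_segment il clQ iQ cQW) auto
  have blk_W: "blk P Q \<inter> W i = P \<inter> Q"
    using notW e(2) PQ unfolding blk by auto
  have blk_eq: "xs ! b \<in> blk P Q \<longleftrightarrow> b < e" if "i \<le> b" "b < length xs" for b
  proof
    have "e \<le> length xs" "i \<le> e" using e m(1,2) by auto
    moreover assume "xs ! b \<in> blk P Q"
    ultimately have "xs ! b \<in> W e" using Qe W_split[of i e] unfolding blk by auto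
    then show "b < e" using nth_in_W[of b e] that \<open>e \<le> length xs\<close> by simp
  qed (use that in \<open>auto simp: blk\<close>)
  have before: "a \<le> b" if "(xs ! a, xs ! b) \<in> R" "a < length xs" "b < length xs" for a b
    using extends that unfolding order_extends_def by blast
  have position: "\<exists>a < length xs. x = xs ! a" if "x \<in> pverts G" for x
    using that set_xs by (metis in_set_conv_nth)
  have blk_verts: "blk P Q \<subseteq> pverts G"
    unfolding blk_def using clique_verts[OF clQ] by (rule clos_verts)
  have ok: "start_ok P Q"
    unfolding start_ok_def
  proof (intro ballI impI)
    fix y x assume yx: "y \<in> Q - P" "x \<in> blk P Q" "(x, y) \<in> R"
    obtain a where a: "a < length xs" "x = xs ! a" using position yx(2) blk_verts by blast
    have "y \<notin> W i" using yx(1) PQ by blast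
    then obtain b where b: "i \<le> b" "b \<le> m" "y = xs ! b" using yx(1) unfolding Q_eq by auto
    then have "a \<le> b" using before[of a b] yx(3) a m(2) by auto
    show "x \<in> Q"
    proof (cases "i \<le> a")
      case True
      then show ?thesis using a b \<open>a \<le> b\<close> unfolding Q_eq by auto
    next
      case False
      then have "x \<in> W i" using a nth_in_W[of a i] il by auto
      then show ?thesis using blk_W yx(2) by blast
    qed
  qed
  have gr: "grows P Q (D P Q)" using D P(1) QF unfolding saturated_def by blast
  define X where "X = D P Q"
  have XB: "X \<subseteq> blk P Q" using grows_subset_blk[OF gr] by (simp add: X_def)
  have "blk P Q \<subseteq> X"
  proof (rule ccontr)
    assume nsub: "\<not> blk P Q \<subseteq> X"
    have QX: "Q \<subseteq> X" using gr unfolding X_def by (induction rule: grows.induct) auto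
    obtain ys where ys: "set ys = X - W i" "X \<inter> W i = P \<inter> Q" "attached (W i) X"
      and hist: "\<And>j u. j > L i \<Longrightarrow> u \<in> pverts G - (W i \<union> X) \<Longrightarrow> j \<le> lab X u \<Longrightarrow> X \<subseteq> clos j Q"
      using grows_visit[OF gr ok closed_at_take[OF il], folded W_def X_def] cPQ PQ by metis
    have att: "nb b \<inter> W i \<subseteq> X" if "b \<in> X" "b \<notin> W i" for b
      using ys(3) that unfolding attached_def by blast
    have "\<exists>u \<in> pverts G - X. L i < lab X u"
    proof (rule ccontr)
      assume "\<not> ?thesis"
      then have "u \<in> X" if "u \<in> pverts G" "Suc (L i) \<le> lab X u" for u
        using that by (auto simp: Suc_le_eq)
      then have "blk P Q \<subseteq> X"
        unfolding blk_def cPQ using QX by (intro clos_subset)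
      with nsub show False by simp
    qed
    then obtain u' where u': "u' \<in> pverts G - X" "L i < lab X u'" by blast
    \<comment> \<open>The largest label relative to \<open>X\<close> is the only separator size with
      which \<open>X\<close> may be extended.\<close>
    define j where "j = Max (lab X ` (pverts G - X))"
    have finL: "finite (lab X ` (pverts G - X))" using pair_finite_verts by simp
    have "j \<in> lab X ` (pverts G - X)"
      unfolding j_def using finL u' by (intro Max_in) auto
    then obtain u where u: "u \<in> pverts G - X" "lab X u = j" by blast
    have jmax: "lab X v \<le> j" if "v \<in> pverts G - X" for v
      unfolding j_def using finL that by (intro Max_ge) auto
    have ji: "L i < j" using jmax[OF u'(1)] u'(2) by simp
    have new: "\<exists>b \<in> A. b \<notin> W i" if "A \<subseteq> X" "L i < card A" for A
    proof (rule ccontr)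
      assume "\<not> ?thesis"
      then have "A \<subseteq> P \<inter> Q" using that(1) ys(2) by blast
      moreover have "finite (P \<inter> Q)" using ys(2) by (metis W_def finite_Int finite_set)
      ultimately have "card A \<le> L i" using card_mono cPQ by metis
      with that(2) show False by simp
    qed
    have uW: "u \<notin> W i"
    proof
      assume "u \<in> W i"
      obtain b where "b \<in> nb u \<inter> X" "b \<notin> W i"
        using new[of "nb u \<inter> X"] ji u(2) by (auto simp: lab_def)
      then have "u \<in> X" using att[of b] \<open>u \<in> W i\<close> nb_sym by blast
      with u(1) show False by simp
    qed
    then have X_clos: "X \<subseteq> clos j Q" using hist[OF ji, of u] u by simp
    have u_clos: "u \<in> clos j Q"
      using clos_closed[of u j Q] u lab_mono[OF X_clos, of u] by simp
    \<comment> \<open>After \<open>m\<close> the labels stay at least \<open>j\<close> until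
      \<open>d\<close>, and \<open>W d\<close> is closed under threshold \<open>j\<close>. Hence it
      contains \<open>clos j Q\<close> and with it the missing vertex \<open>u\<close>, so the first
      missing vertex has label at least \<open>j\<close>.\<close>
    define d where "d = (LEAST d. m < d \<and> (d = length xs \<or> d < length xs \<and> L d < j))"
    have d: "m < d" "d = length xs \<or> d < length xs \<and> L d < j"
      using LeastI[of "\<lambda>d. m < d \<and> (d = length xs \<or> d < length xs \<and> L d < j)" "length xs"] m(2)
      by (auto simp: d_def)
    have d_inner: "j \<le> L t" if "m < t" "t < d" for t
      using not_less_Least[OF that(2)[unfolded d_def]] that d(2) by auto
    have dl: "d \<le> length xs" using d(2) by auto
    have "clos j Q \<subseteq> W d"
    proof (rule clos_subset)
      show "Q \<subseteq> W d"
        using W_mono[of i d] W_mono[of "Suc m" d] W_split[of i "Suc m"] m(1,2) d(1) unfolding Q_eq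
        by (auto simp: atLeastLessThanSuc_atLeastAtMost)
      fix v assume v: "v \<in> pverts G" "j \<le> lab (W d) v"
      show "v \<in> W d"
      proof (rule ccontr)
        assume nv: "v \<notin> W d"
        then have "d < length xs" using v(1) W_length d(2) by auto
        then show False using d(2) lab_W_le[of d v] v nv by auto
      qed
    qed
    moreover have "W d = W i \<union> (!) xs ` {i..<d}" using m(1) d(1) dl by (intro W_split) auto
    ultimately have "u \<in> (!) xs ` {i..<d}" using u_clos uW by blast
    then obtain s where s: "i \<le> s" "s < d" "u = xs ! s" by auto
    define r where "r = (LEAST r. i \<le> r \<and> xs ! r \<notin> X)"
    have r: "i \<le> r" "xs ! r \<notin> X"
      using LeastI[of "\<lambda>r. i \<le> r \<and> xs ! r \<notin> X" s] s u(1) by (auto simp: r_def)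
    have "r \<le> s" unfolding r_def by (rule Least_le) (use s u(1) in auto)
    then have rd: "r < d" and rl: "r < length xs" using s dl by auto
    have r_min: "xs ! t \<in> X" if "i \<le> t" "t < r" for t
      using not_less_Least[OF that(2)[unfolded r_def]] that by auto
    have mr: "m < r"
    proof (rule ccontr)
      assume "\<not> m < r"
      then have "xs ! r \<in> Q" unfolding Q_eq using r(1) by auto
      then show False using QX r(2) by auto
    qed
    have Lr: "j \<le> L r" using d_inner mr rd by simp
    let ?C = "nb (xs ! r) \<inter> W r"
    have Wr: "W r = W i \<union> (!) xs ` {i..<r}" using W_split[OF r(1)] rl by simp
    have cl: "clique ?C" by (rule clique_nb_W[OF rl])
    have r_vert: "xs ! r \<in> pverts G" using nth_verts[OF rl] .
    have "lab (W i) (xs ! r) \<le> L i"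
      using lab_W_le[OF il] r_vert notW[OF r(1) rl] by simp
    then have "\<not> ?C \<subseteq> nb (xs ! r) \<inter> W i"
      using Lr ji card_mono[of "nb (xs ! r) \<inter> W i" ?C] by (auto simp: L_def lab_def)
    then obtain b where b: "b \<in> ?C" "b \<notin> W i" by blast
    then have bX: "b \<in> X" using Wr r_min by auto
    \<comment> \<open>Neighbours visited before \<open>i\<close> are neighbours of \<open>b\<close>
      and lie in \<open>X\<close> by attachment; later ones lie in \<open>X\<close> because
      \<open>r\<close> is the first gap.\<close>
    have CX: "?C \<subseteq> nb (xs ! r) \<inter> X"
    proof
      fix c assume c: "c \<in> ?C"
      have "c \<in> X"
      proof (cases "c \<in> W i")
        case True
        then have "c \<in> nb b" using cliqueD[OF cl c b(1)] b(2) by blast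
        then show ?thesis using att[OF bX b(2)] True by blast
      next
        case False
        then show ?thesis using c Wr r_min by auto
      qed
      then show "c \<in> nb (xs ! r) \<inter> X" using c by blast
    qed
    have "lab X (xs ! r) \<le> j" using jmax r_vert r(2) by simp
    then have C_eq: "?C = nb (xs ! r) \<inter> X" and Lrj: "L r = j"
      using Lr CX card_seteq[OF _ CX] card_mono[OF _ CX] by (auto simp: L_def lab_def)
    \<comment> \<open>The induction hypothesis needs a position where the label does not rise: at
      \<open>Suc m\<close> the run ends, and later on the preceding label is at least
      \<open>j = L r\<close>.\<close>
    have Lr1: "L r \<le> L (r - 1)"
    proof (cases "r = Suc m")
      case True
      then show ?thesis using m(4) rl by simp
    next
      case False
      then show ?thesis using d_inner[of "r - 1"] mr rd Lrj by simp
    qed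
    have "L r \<le> card (pverts G)"
      unfolding L_def lab_def using nb_subset pair_finite_verts by (intro card_mono) auto
    then have dec: "card (pverts G) - L r < card (pverts G) - L i" using ji Lrj by linarith
    obtain P' Q' where ent: "entered r P' Q'" and ok': "start_ok P' Q'" "blk P' Q' \<subseteq> D P' Q'"
      using less.hyps[OF dec rl disjI2[OF Lr1]] by blast
    have PQ': "P' \<in> \<F>" "Q' \<in> \<F>" "xs ! r \<in> Q'" "Q' \<inter> W r = P' \<inter> Q'"
      "card (P' \<inter> Q') = j" "blk P' Q' \<inter> W r = P' \<inter> Q'"
      using ent Lrj by (simp_all add: entered_def)
    have seg': "xs ! a \<in> blk P' Q'"
      if "r \<le> a" "a \<le> b" "b < length xs" "xs ! b \<in> blk P' Q'" for a b
      using ent that unfolding entered_def by blast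
    have clQ': "clique Q'" using family_clique[OF PQ'(2)] .
    have "P' \<inter> Q' \<subseteq> ?C"
      using cliqueD[OF clQ' _ PQ'(3)] PQ'(4) nth_in_W[of r r] rl by auto
    then have S': "P' \<inter> Q' = ?C"
      using PQ'(5) Lrj by (intro card_subset_eq) (auto simp: L_def lab_def)
    have "X \<inter> Q' \<subseteq> nb (xs ! r) \<inter> X"
      using cliqueD[OF clQ' _ PQ'(3)] r(2) by blast
    then have XQ': "X \<inter> Q' = P' \<inter> Q'" using C_eq S' by blast
    \<comment> \<open>A predecessor comes earlier in the ordering: before \<open>i\<close> it lies
      in the separator, between \<open>i\<close> and \<open>r\<close> in \<open>X\<close>, and from
      \<open>r\<close> on in the interval occupied by the new block.\<close>
    have "x \<in> X \<union> blk P' Q'" if yx: "y \<in> blk P' Q' - X" "x \<in> blk P Q" "(x, y) \<in> R" for x y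
    proof -
      have "blk P' Q' \<subseteq> pverts G"
        unfolding blk_def using clique_verts[OF clQ'] by (rule clos_verts)
      then obtain b where b: "b < length xs" "y = xs ! b" using position yx(1) by blast
      obtain a where a: "a < length xs" "x = xs ! a" using position yx(2) blk_verts by blast
      have "a \<le> b" using before yx(3) a b by blast
      have "y \<notin> W r" using PQ'(6) XQ' yx(1) by blast
      then have rb: "r \<le> b" using b nth_in_W[of b r] rl by auto
      consider "a < i" | "i \<le> a" "a < r" | "r \<le> a" by linarith
      then show ?thesis
      proof cases
        case 1
        then have "x \<in> W i" using a nth_in_W[of a i] il by auto
        then show ?thesis using yx(2) blk_W QX by blast
      next
        case 2
        then show ?thesis using r_min a by auto
      next
        case 3
        then show ?thesis using seg'[of a b] \<open>a \<le> b\<close> a b yx(1) by auto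
      qed
    qed
    then have "can_extend P Q X P' Q'"
      unfolding can_extend_def using cPQ PQ'(5) ji XQ' jmax by auto
    then have "blk P' Q' \<subseteq> X"
      using D P(1) QF PQ'(1,2) ok' unfolding saturated_def X_def by blast
    then show False using subset_blk[of Q' P'] PQ'(3) r(2) by blast
  qed
  then have sub: "blk P Q \<subseteq> D P Q" by (simp add: X_def)
  have "entered i P Q"
    unfolding entered_def using blk_eq by (intro conjI P(1,4) QF iQ PQ cPQ blk_W) auto
  then show ?case using ok sub by blast
qed

end

lemma (in chordal_order) saturated_complete:
  assumes "saturated D" and \<sigma>: "mcs_ordering G \<sigma>" "order_extends \<sigma> R"
  shows "\<exists>Q \<in> \<F>. Q \<noteq> {} \<and> start_ok {} Q \<and> blk {} Q \<subseteq> D {} Q"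
proof -
  interpret mcs_run G R \<F> \<sigma> by unfold_locales (fact \<sigma>)+
  have "pverts G \<noteq> {}"
    using connected by (auto simp: connected_def strongly_connected_def mk_symmetric_def)
  then have "0 < length \<sigma>" using set_xs by auto
  then obtain P Q where PQ: "entered 0 P Q" "start_ok P Q" "blk P Q \<subseteq> D P Q"
    using saturated_block[OF assms(1), of 0] by blast
  then have "P = {}" "Q \<in> \<F>" "Q \<noteq> {}" by (auto simp: entered_def)
  with PQ show ?thesis by blast
qed

section \<open>Programs with bounded loops\<close>

text \<open>
  All loops and sums run over the numbers below the content of register 0, which makes the running
  time polynomial for syntactic reasons. Registers serve only as loop variables; they form an
  environment, so that the meaning of a program is a function on the arrays.
\<close>

datatype sexp =
    SNum nat
  | SReg nat
  | SGet nat sexp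
  | SAdd sexp sexp
  | SSub sexp sexp
  | SSum nat sexp

datatype prog =
    PPut nat sexp sexp
  | PSeq prog prog
  | PFor nat prog

fun sval :: "sexp \<Rightarrow> (nat \<Rightarrow> nat) \<Rightarrow> (nat \<Rightarrow> nat \<Rightarrow> nat) \<Rightarrow> nat" where
  "sval (SNum n) \<rho> \<alpha> = n"
| "sval (SReg x) \<rho> \<alpha> = \<rho> x"
| "sval (SGet a e) \<rho> \<alpha> = \<alpha> a (sval e \<rho> \<alpha>)"
| "sval (SAdd e1 e2) \<rho> \<alpha> = sval e1 \<rho> \<alpha> + sval e2 \<rho> \<alpha>"
| "sval (SSub e1 e2) \<rho> \<alpha> = sval e1 \<rho> \<alpha> - sval e2 \<rho> \<alpha>"
| "sval (SSum v e) \<rho> \<alpha> = (\<Sum>i < \<rho> 0. sval e (\<rho>(v := i)) \<alpha>)"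

fun iter :: "(nat \<Rightarrow> 'a \<Rightarrow> 'a) \<Rightarrow> nat \<Rightarrow> 'a \<Rightarrow> 'a" where
  "iter f 0 x = x"
| "iter f (Suc n) x = f n (iter f n x)"

fun run :: "prog \<Rightarrow> (nat \<Rightarrow> nat) \<Rightarrow> (nat \<Rightarrow> nat \<Rightarrow> nat) \<Rightarrow> nat \<Rightarrow> nat \<Rightarrow> nat" where
  "run (PPut a i e) \<rho> \<alpha> = \<alpha>(a := (\<alpha> a)(sval i \<rho> \<alpha> := sval e \<rho> \<alpha>))"
| "run (PSeq c1 c2) \<rho> \<alpha> = run c2 \<rho> (run c1 \<rho> \<alpha>)"
| "run (PFor v c) \<rho> \<alpha> = iter (\<lambda>i. run c (\<rho>(v := i))) (\<rho> 0) \<alpha>"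

text \<open>Bound variables must differ from register 0, which holds the loop bound. The condition
  on constants makes \<open>d\<close> positive in every case, so that register 0 lies below
  \<open>d\<close>.\<close>

fun sexp_below :: "nat \<Rightarrow> sexp \<Rightarrow> bool" where
  "sexp_below d (SNum n) \<longleftrightarrow> 0 < d"
| "sexp_below d (SReg x) \<longleftrightarrow> x < d"
| "sexp_below d (SGet a e) \<longleftrightarrow> sexp_below d e"
| "sexp_below d (SAdd e1 e2) \<longleftrightarrow> sexp_below d e1 \<and> sexp_below d e2"
| "sexp_below d (SSub e1 e2) \<longleftrightarrow> sexp_below d e1 \<and> sexp_below d e2"
| "sexp_below d (SSum v e) \<longleftrightarrow> 0 < v \<and> v < d \<and> sexp_below d e"

fun prog_below :: "nat \<Rightarrow> prog \<Rightarrow> bool" where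
  "prog_below d (PPut a i e) \<longleftrightarrow> sexp_below d i \<and> sexp_below d e"
| "prog_below d (PSeq c1 c2) \<longleftrightarrow> prog_below d c1 \<and> prog_below d c2"
| "prog_below d (PFor v c) \<longleftrightarrow> 0 < v \<and> v < d \<and> prog_below d c"

lemma sexp_below_pos: "sexp_below d e \<Longrightarrow> 0 < d"
  by (induction e) auto

lemma prog_below_pos: "prog_below d c \<Longrightarrow> 0 < d"
  by (induction c) (auto intro: sexp_below_pos)

lemma sval_cong: "sexp_below d e \<Longrightarrow> (\<And>x. x < d \<Longrightarrow> \<rho> x = \<rho>' x) \<Longrightarrow> sval e \<rho> \<alpha> = sval e \<rho>' \<alpha>"
proof (induction e arbitrary: \<rho> \<rho>')
  case (SSum v e)
  have "sval e (\<rho>(v := i)) \<alpha> = sval e (\<rho>'(v := i)) \<alpha>" for i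
    using SSum.prems by (intro SSum.IH) auto
  then show ?case using SSum.prems(2)[of 0] SSum.prems(1) by simp
next
  case (SAdd e1 e2)
  have "sval e1 \<rho> \<alpha> = sval e1 \<rho>' \<alpha>" "sval e2 \<rho> \<alpha> = sval e2 \<rho>' \<alpha>"
    using SAdd.prems by (auto intro!: SAdd.IH)
  then show ?case by simp
next
  case (SSub e1 e2)
  have "sval e1 \<rho> \<alpha> = sval e1 \<rho>' \<alpha>" "sval e2 \<rho> \<alpha> = sval e2 \<rho>' \<alpha>"
    using SSub.prems by (auto intro!: SSub.IH)
  then show ?case by simp
next
  case (SGet a e)
  have "sval e \<rho> \<alpha> = sval e \<rho>' \<alpha>" using SGet.prems by (intro SGet.IH) auto
  then show ?case by simp
qed auto

lemma run_cong: "prog_below d c \<Longrightarrow> (\<And>x. x < d \<Longrightarrow> \<rho> x = \<rho>' x) \<Longrightarrow> run c \<rho> \<alpha> = run c \<rho>' \<alpha>"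
proof (induction c arbitrary: \<rho> \<rho>' \<alpha>)
  case (PPut a i e)
  then show ?case using sval_cong[of d _ \<rho> \<rho>'] by simp
next
  case (PSeq c1 c2)
  have "run c1 \<rho> \<beta> = run c1 \<rho>' \<beta>" "run c2 \<rho> \<beta> = run c2 \<rho>' \<beta>" for \<beta>
    using PSeq.prems by (auto intro!: PSeq.IH)
  then show ?case by simp
next
  case (PFor v c)
  have "run c (\<rho>(v := i)) \<beta> = run c (\<rho>'(v := i)) \<beta>" for i \<beta>
    using PFor.prems by (intro PFor.IH) auto
  then have "(\<lambda>i. run c (\<rho>(v := i))) = (\<lambda>i. run c (\<rho>'(v := i)))" by blast
  moreover have "\<rho> 0 = \<rho>' 0" using PFor.prems by auto
  ultimately show ?case by simp
qed

text \<open>The registers from \<open>d\<close> upwards form a stack, and the result is left in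
  \<open>d\<close>. A sum saves the old content of its bound variable in \<open>Suc d\<close> and
  restores it, so that the lower registers behave as an environment.\<close>

fun compile_sexp :: "sexp \<Rightarrow> nat \<Rightarrow> com" where
  "compile_sexp (SNum n) d = Assign d (Num n)"
| "compile_sexp (SReg x) d = Assign d (Reg x)"
| "compile_sexp (SGet a e) d = Seq (compile_sexp e d) (Assign d (Get a (Reg d)))"
| "compile_sexp (SAdd e1 e2) d = Seq (compile_sexp e1 d) (Seq (compile_sexp e2 (Suc d))
    (Assign d (Add (Reg d) (Reg (Suc d)))))"
| "compile_sexp (SSub e1 e2) d = Seq (compile_sexp e1 d) (Seq (compile_sexp e2 (Suc d))
    (Assign d (Sub (Reg d) (Reg (Suc d)))))"
| "compile_sexp (SSum v e) d = Seq (Assign d (Num 0)) (Seq (Assign (Suc d) (Reg v))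
    (Seq (Assign v (Num 0)) (Seq
      (While (Less (Reg v) (Reg 0)) (Seq (compile_sexp e (Suc (Suc d)))
        (Seq (Assign d (Add (Reg d) (Reg (Suc (Suc d))))) (Assign v (Add (Reg v) (Num 1))))))
      (Assign v (Reg (Suc d))))))"

fun compile :: "prog \<Rightarrow> nat \<Rightarrow> com" where
  "compile (PPut a i e) d = Seq (compile_sexp i d) (Seq (compile_sexp e (Suc d))
    (Put a (Reg d) (Reg (Suc d))))"
| "compile (PSeq c1 c2) d = Seq (compile c1 d) (compile c2 d)"
| "compile (PFor v c) d = Seq (Assign d (Reg v)) (Seq (Assign v (Num 0)) (Seq
      (While (Less (Reg v) (Reg 0)) (Seq (compile c (Suc d)) (Assign v (Add (Reg v) (Num 1)))))
      (Assign v (Reg d))))"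

text \<open>The argument of the polynomial is the content of register 0, and \<open>[:0, 1:]\<close>
  is the indeterminate. The bracketing mirrors the nesting of \<open>Seq\<close> in the compiled
  code.\<close>

fun sexp_time :: "sexp \<Rightarrow> nat poly" where
  "sexp_time (SNum n) = 1"
| "sexp_time (SReg x) = 1"
| "sexp_time (SGet a e) = sexp_time e + 1"
| "sexp_time (SAdd e1 e2) = sexp_time e1 + (sexp_time e2 + 1)"
| "sexp_time (SSub e1 e2) = sexp_time e1 + (sexp_time e2 + 1)"
| "sexp_time (SSum v e) = 1 + (1 + (1 + (([:0, 1:] * (sexp_time e + (1 + 1) + 1) + 1) + 1)))"

fun prog_time :: "prog \<Rightarrow> nat poly" where
  "prog_time (PPut a i e) = sexp_time i + (sexp_time e + 1)"
| "prog_time (PSeq c1 c2) = prog_time c1 + prog_time c2"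
| "prog_time (PFor v c) = 1 + (1 + (([:0, 1:] * (prog_time c + 1 + 1) + 1) + 1))"

text \<open>A total-correctness triple with a time bound.\<close>

definition achieves :: "com \<Rightarrow> store \<Rightarrow> nat \<Rightarrow> (store \<Rightarrow> bool) \<Rightarrow> bool" where
  "achieves c s T Q \<longleftrightarrow> (\<exists>t s'. exec c s t s' \<and> t \<le> T \<and> Q s')"

lemma achieves_mono: "achieves c s T Q \<Longrightarrow> (\<And>s'. Q s' \<Longrightarrow> Q' s') \<Longrightarrow> achieves c s T Q'"
  unfolding achieves_def by blast

lemma achieves_Assign:
  "1 \<le> T \<Longrightarrow> Q (s\<lparr>reg := (reg s)(x := aval e s)\<rparr>) \<Longrightarrow> achieves (Assign x e) s T Q"
  unfolding achieves_def using exec.Assign by blast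

lemma achieves_Put:
  "1 \<le> T \<Longrightarrow> Q (s\<lparr>arr := (arr s)(a := (arr s a)(aval i s := aval e s))\<rparr>) \<Longrightarrow>
    achieves (Put a i e) s T Q"
  unfolding achieves_def using exec.Put by blast

lemma achieves_Seq:
  assumes "achieves c1 s T1 P" "\<And>s'. P s' \<Longrightarrow> achieves c2 s' T2 Q"
  shows "achieves (Seq c1 c2) s (T1 + T2) Q"
proof -
  obtain t1 s1 where 1: "exec c1 s t1 s1" "t1 \<le> T1" "P s1"
    using assms(1) unfolding achieves_def by blast
  obtain t2 s2 where 2: "exec c2 s1 t2 s2" "t2 \<le> T2" "Q s2"
    using assms(2)[OF 1(3)] unfolding achieves_def by blast
  show ?thesis
    unfolding achieves_def using exec.Seq[OF 1(1) 2(1)] 1(2) 2(2,3) by (metis add_mono)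
qed

lemma achieves_Assign_Seq:
  "achieves c (s\<lparr>reg := (reg s)(x := aval e s)\<rparr>) T Q \<Longrightarrow> achieves (Seq (Assign x e) c) s (1 + T) Q"
  by (rule achieves_Seq[OF
    achieves_Assign[where Q = "\<lambda>s'. s' = s\<lparr>reg := (reg s)(x := aval e s)\<rparr>"]]) auto

lemma achieves_While:
  assumes step: "\<And>i s. i < n \<Longrightarrow> I i s \<Longrightarrow> bval b s \<and> achieves c s T (I (Suc i))"
    and stop: "\<And>s. I n s \<Longrightarrow> \<not> bval b s" and "I 0 s"
  shows "achieves (While b c) s (n * (T + 1) + 1) (I n)"
proof -
  have "achieves (While b c) s ((n - i) * (T + 1) + 1) (I n)" if "i \<le> n" "I i s" for i s
    using that
  proof (induction "n - i" arbitrary: i s)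
    case 0
    then have "I n s" by simp
    then show ?case unfolding achieves_def using exec.WhileFalse[of b s c] stop by fastforce
  next
    case (Suc m)
    then have "i < n" by simp
    from step[OF this Suc.prems(2)] obtain t s1 where
      1: "bval b s" "exec c s t s1" "t \<le> T" "I (Suc i) s1"
      unfolding achieves_def by blast
    have "m = n - Suc i" "Suc i \<le> n" using Suc.hyps(2) \<open>i < n\<close> by auto
    from Suc.hyps(1)[OF this 1(4)] obtain t' s2 where
      2: "exec (While b c) s1 t' s2" "t' \<le> (n - Suc i) * (T + 1) + 1" "I n s2"
      unfolding achieves_def by blast
    have "n - i = Suc (n - Suc i)" using \<open>i < n\<close> by simp
    then have "1 + t + t' \<le> (n - i) * (T + 1) + 1" using 1(3) 2(2) by simp
    then show ?case
      unfolding achieves_def using exec.WhileTrue[OF 1(1,2) 2(1)] 2(3) by blast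
  qed
  from this[of 0 s] show ?thesis using assms(3) by simp
qed

text \<open>All \<open>d'\<close> from \<open>d\<close> on are covered because subexpressions are
  compiled at higher stack positions.\<close>

definition computes :: "nat \<Rightarrow> sexp \<Rightarrow> bool" where
  "computes d e \<longleftrightarrow> (\<forall>d' \<ge> d. \<forall>s. achieves (compile_sexp e d') s (poly (sexp_time e) (reg s 0))
    (\<lambda>s'. arr s' = arr s \<and> reg s' d' = sval e (reg s) (arr s) \<and> (\<forall>x < d'. reg s' x = reg s x)))"

lemma computesD:
  "computes d e \<Longrightarrow> d \<le> d' \<Longrightarrow> N = reg s 0 \<Longrightarrow> achieves (compile_sexp e d') s (poly (sexp_time e) N)
    (\<lambda>s'. arr s' = arr s \<and> reg s' d' = sval e (reg s) (arr s) \<and> (\<forall>x < d'. reg s' x = reg s x))"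
  unfolding computes_def by blast

text \<open>The common shape of \<open>SAdd\<close>, \<open>SSub\<close> and \<open>PPut\<close>.
  The first value survives the second evaluation, which preserves all registers below
  \<open>Suc d'\<close>.\<close>

lemma achieves_two:
  assumes "computes d e1" "computes d e2" "sexp_below d e2" "d \<le> d'"
    and last: "\<And>s2. arr s2 = arr s \<Longrightarrow> reg s2 d' = sval e1 (reg s) (arr s) \<Longrightarrow>
      reg s2 (Suc d') = sval e2 (reg s) (arr s) \<Longrightarrow> (\<And>x. x < d' \<Longrightarrow> reg s2 x = reg s x) \<Longrightarrow>
      achieves c s2 1 Q"
  shows "achieves (Seq (compile_sexp e1 d') (Seq (compile_sexp e2 (Suc d')) c)) s
    (poly (sexp_time e1) (reg s 0) + (poly (sexp_time e2) (reg s 0) + 1)) Q"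
proof (rule achieves_Seq[OF computesD[OF assms(1,4) refl]])
  fix s1 :: store
  assume s1: "arr s1 = arr s \<and> reg s1 d' = sval e1 (reg s) (arr s) \<and> (\<forall>x<d'. reg s1 x = reg s x)"
  have "0 < d'" using assms(3,4) sexp_below_pos by fastforce
  then have N: "reg s 0 = reg s1 0" using s1 by simp
  have val: "sval e2 (reg s1) (arr s) = sval e2 (reg s) (arr s)"
    using assms(3,4) s1 by (intro sval_cong[of d]) auto
  show "achieves (Seq (compile_sexp e2 (Suc d')) c) s1 (poly (sexp_time e2) (reg s 0) + 1) Q"
  proof (rule achieves_Seq[OF computesD[OF assms(2) _ N]])
    fix s2 :: store
    assume "arr s2 = arr s1 \<and> reg s2 (Suc d') = sval e2 (reg s1) (arr s1) \<and>
      (\<forall>x<Suc d'. reg s2 x = reg s1 x)"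
    then show "achieves c s2 1 Q" using s1 val by (intro last) auto
  qed (use assms(4) in simp)
qed

lemma sexp_below_computes: "sexp_below d e \<Longrightarrow> computes d e"
proof (induction e)
  case (SNum n)
  then show ?case unfolding computes_def by (auto intro!: achieves_Assign)
next
  case (SReg x)
  then show ?case unfolding computes_def by (auto intro!: achieves_Assign)
next
  case (SGet a e)
  show ?case
    unfolding computes_def
  proof (intro allI impI)
    fix d' and s :: store assume d': "d \<le> d'"
    have "computes d e" using SGet by simp
    from computesD[OF this d' refl]
    have "achieves (compile_sexp (SGet a e) d') s (poly (sexp_time e) (reg s 0) + 1)
      (\<lambda>s'. arr s' = arr s \<and> reg s' d' = sval (SGet a e) (reg s) (arr s) \<and>
        (\<forall>x < d'. reg s' x = reg s x))"
      unfolding compile_sexp.simps by (rule achieves_Seq) (auto intro!: achieves_Assign)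
    then show "achieves (compile_sexp (SGet a e) d') s (poly (sexp_time (SGet a e)) (reg s 0))
      (\<lambda>s'. arr s' = arr s \<and> reg s' d' = sval (SGet a e) (reg s) (arr s) \<and>
        (\<forall>x < d'. reg s' x = reg s x))" by simp
  qed
next
  case (SAdd e1 e2)
  then have "computes d e1" "computes d e2" "sexp_below d e2" by auto
  note two = achieves_two[OF this]
  show ?case
    unfolding computes_def compile_sexp.simps sexp_time.simps poly_add poly_1
    by (intro allI impI two) (auto intro!: achieves_Assign)
next
  case (SSub e1 e2)
  then have "computes d e1" "computes d e2" "sexp_below d e2" by auto
  note two = achieves_two[OF this]
  show ?case
    unfolding computes_def compile_sexp.simps sexp_time.simps poly_add poly_1
    by (intro allI impI two) (auto intro!: achieves_Assign)
next
  case (SSum v e)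
  show ?case
    unfolding computes_def
  proof (intro allI impI)
    fix d' and s :: store assume d': "d \<le> d'"
    let ?N = "reg s 0"
    let ?T = "poly (sexp_time e) ?N + (1 + 1)"
    let ?I = "\<lambda>i s'. arr s' = arr s \<and> reg s' v = i \<and> reg s' (Suc d') = reg s v \<and>
      reg s' d' = (\<Sum>j < i. sval e ((reg s)(v := j)) (arr s)) \<and>
      (\<forall>x < d'. x \<noteq> v \<longrightarrow> reg s' x = reg s x)"
    let ?body = "Seq (compile_sexp e (Suc (Suc d')))
      (Seq (Assign d' (Add (Reg d') (Reg (Suc (Suc d'))))) (Assign v (Add (Reg v) (Num 1))))"
    have v: "0 < v" "v < d'" "sexp_below d e" "computes d e" using SSum d' by auto
    have loop: "achieves (While (Less (Reg v) (Reg 0)) ?body) s1 (?N * (?T + 1) + 1) (?I ?N)"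
      if "?I 0 s1" for s1
    proof (rule achieves_While[where I = ?I])
      fix i and s2 :: store assume i: "i < ?N" and I: "?I i s2"
      have N: "?N = reg s2 0" using I v by auto
      have val: "sval e (reg s2) (arr s2) = sval e ((reg s)(v := i)) (arr s)"
        using v d' I sval_cong[of d e "reg s2" "(reg s)(v := i)"] by auto
      have "achieves ?body s2 ?T (?I (Suc i))"
      proof (rule achieves_Seq[OF computesD[OF v(4) _ N]])
        fix s3 :: store
        assume "arr s3 = arr s2 \<and> reg s3 (Suc (Suc d')) = sval e (reg s2) (arr s2) \<and>
          (\<forall>x<Suc (Suc d'). reg s3 x = reg s2 x)"
        then show "achieves (Seq (Assign d' (Add (Reg d') (Reg (Suc (Suc d')))))
          (Assign v (Add (Reg v) (Num 1)))) s3 (1 + 1) (?I (Suc i))"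
          using I v val by (intro achieves_Assign_Seq achieves_Assign) auto
      qed (use d' in simp)
      then show "bval (Less (Reg v) (Reg 0)) s2 \<and> achieves ?body s2 ?T (?I (Suc i))"
        using N I i by simp
    next
      fix s2 :: store assume "?I ?N s2"
      then show "\<not> bval (Less (Reg v) (Reg 0)) s2" using v by simp
    qed (use that in simp)
    have "achieves (compile_sexp (SSum v e) d') s (1 + (1 + (1 + ((?N * (?T + 1) + 1) + 1))))
      (\<lambda>s'. arr s' = arr s \<and> reg s' d' = sval (SSum v e) (reg s) (arr s) \<and>
        (\<forall>x < d'. reg s' x = reg s x))"
      unfolding compile_sexp.simps using v
      by (intro achieves_Assign_Seq achieves_Seq[OF loop] achieves_Assign) auto
    then show "achieves (compile_sexp (SSum v e) d') s (poly (sexp_time (SSum v e)) (reg s 0))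
      (\<lambda>s'. arr s' = arr s \<and> reg s' d' = sval (SSum v e) (reg s) (arr s) \<and>
        (\<forall>x < d'. reg s' x = reg s x))" by (simp add: algebra_simps)
  qed
qed

lemma compile_correct:
  assumes "prog_below d c" "d \<le> d'" "N = reg s 0"
  shows "achieves (compile c d') s (poly (prog_time c) N)
    (\<lambda>s'. arr s' = run c (reg s) (arr s) \<and> (\<forall>x < d'. reg s' x = reg s x))"
  using assms
proof (induction c arbitrary: s d')
  case (PPut a i e)
  then have "computes d i" "computes d e" "sexp_below d e" by (auto intro: sexp_below_computes)
  note two = achieves_two[OF this PPut.prems(2)]
  show ?case
    unfolding compile.simps prog_time.simps poly_add poly_1 PPut.prems(3)
    by (intro two) (auto intro!: achieves_Put)
next
  case (PSeq c1 c2)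
  have d': "0 < d'" using PSeq.prems prog_below_pos by fastforce
  have below: "prog_below d c1" "prog_below d c2" using PSeq.prems by auto
  show ?case
    unfolding compile.simps prog_time.simps poly_add
  proof (rule achieves_Seq[OF PSeq.IH(1)[OF below(1) PSeq.prems(2,3)]])
    fix s1 :: store
    assume s1: "arr s1 = run c1 (reg s) (arr s) \<and> (\<forall>x<d'. reg s1 x = reg s x)"
    have "run c2 (reg s1) \<alpha> = run c2 (reg s) \<alpha>" for \<alpha>
      using PSeq.prems s1 by (intro run_cong[of d]) auto
    moreover have "N = reg s1 0" using s1 d' PSeq.prems(3) by simp
    ultimately show "achieves (compile c2 d') s1 (poly (prog_time c2) N)
      (\<lambda>s'. arr s' = run (PSeq c1 c2) (reg s) (arr s) \<and> (\<forall>x<d'. reg s' x = reg s x))"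
      using s1 by (intro achieves_mono[OF PSeq.IH(2)[OF below(2) PSeq.prems(2)]]) auto
  qed
next
  case (PFor v c)
  let ?T = "poly (prog_time c) N + 1"
  let ?f = "\<lambda>i. run c ((reg s)(v := i))"
  let ?I = "\<lambda>i s'. arr s' = iter ?f i (arr s) \<and> reg s' v = i \<and> reg s' d' = reg s v \<and>
    (\<forall>x < d'. x \<noteq> v \<longrightarrow> reg s' x = reg s x)"
  let ?body = "Seq (compile c (Suc d')) (Assign v (Add (Reg v) (Num 1)))"
  have v: "0 < v" "v < d'" "prog_below d c" using PFor.prems by auto
  have loop: "achieves (While (Less (Reg v) (Reg 0)) ?body) s1 (N * (?T + 1) + 1) (?I N)"
    if "?I 0 s1" for s1
  proof (rule achieves_While[where I = ?I])
    fix i and s2 :: store assume i: "i < N" and I: "?I i s2"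
    have N: "N = reg s2 0" using I v PFor.prems(3) by auto
    have val: "run c (reg s2) \<alpha> = ?f i \<alpha>" for \<alpha>
      using PFor.prems I by (intro run_cong[of d]) auto
    have "achieves ?body s2 ?T (?I (Suc i))"
    proof (rule achieves_Seq[OF PFor.IH[OF v(3) _ N]])
      fix s3 :: store
      assume "arr s3 = run c (reg s2) (arr s2) \<and> (\<forall>x<Suc d'. reg s3 x = reg s2 x)"
      then show "achieves (Assign v (Add (Reg v) (Num 1))) s3 1 (?I (Suc i))"
        using I v val by (intro achieves_Assign) auto
    qed (use PFor.prems in simp)
    then show "bval (Less (Reg v) (Reg 0)) s2 \<and> achieves ?body s2 ?T (?I (Suc i))"
      using N I i by simp
  next
    fix s2 :: store assume "?I N s2"
    then show "\<not> bval (Less (Reg v) (Reg 0)) s2" using v PFor.prems(3) by simp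
  qed (use that in simp)
  have "achieves (compile (PFor v c) d') s (1 + (1 + ((N * (?T + 1) + 1) + 1)))
    (\<lambda>s'. arr s' = run (PFor v c) (reg s) (arr s) \<and> (\<forall>x < d'. reg s' x = reg s x))"
    unfolding compile.simps using v PFor.prems(3)
    by (intro achieves_Assign_Seq achieves_Seq[OF loop] achieves_Assign) auto
  then show ?case by (simp add: algebra_simps)
qed

section \<open>Truth values, quantifiers and table access\<close>

abbreviation holds :: "sexp \<Rightarrow> (nat \<Rightarrow> nat) \<Rightarrow> (nat \<Rightarrow> nat \<Rightarrow> nat) \<Rightarrow> bool" where
  "holds e \<rho> \<alpha> \<equiv> 0 < sval e \<rho> \<alpha>"

text \<open>Truncated subtraction sends every non-zero value to 0. Double negation thus normalises a
  truth value to 0 or 1, on which \<open>SOr\<close> and \<open>SCount\<close> rely.\<close>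

definition SNot :: "sexp \<Rightarrow> sexp" where
  "SNot e = SSub (SNum 1) e"

definition SAnd :: "sexp \<Rightarrow> sexp \<Rightarrow> sexp" where
  "SAnd e1 e2 = SNot (SAdd (SNot e1) (SNot e2))"

definition SOr :: "sexp \<Rightarrow> sexp \<Rightarrow> sexp" where
  "SOr e1 e2 = SNot (SNot (SAdd e1 e2))"

definition SImp :: "sexp \<Rightarrow> sexp \<Rightarrow> sexp" where
  "SImp e1 e2 = SOr (SNot e1) e2"

definition SIff :: "sexp \<Rightarrow> sexp \<Rightarrow> sexp" where
  "SIff e1 e2 = SAnd (SImp e1 e2) (SImp e2 e1)"

definition SLess :: "sexp \<Rightarrow> sexp \<Rightarrow> sexp" where
  "SLess e1 e2 = SNot (SNot (SSub e2 e1))"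

definition SAll :: "nat \<Rightarrow> sexp \<Rightarrow> sexp" where
  "SAll v e = SNot (SSum v (SNot e))"

definition SEx :: "nat \<Rightarrow> sexp \<Rightarrow> sexp" where
  "SEx v e = SNot (SAll v (SNot e))"

definition SCount :: "nat \<Rightarrow> sexp \<Rightarrow> sexp" where
  "SCount v e = SSum v (SNot (SNot e))"

lemma sval_SNot [simp]: "sval (SNot e) \<rho> \<alpha> = of_bool (\<not> holds e \<rho> \<alpha>)"
  by (simp add: SNot_def)

lemma sval_SAnd [simp]: "sval (SAnd e1 e2) \<rho> \<alpha> = of_bool (holds e1 \<rho> \<alpha> \<and> holds e2 \<rho> \<alpha>)"
  by (simp add: SAnd_def)

lemma sval_SOr [simp]: "sval (SOr e1 e2) \<rho> \<alpha> = of_bool (holds e1 \<rho> \<alpha> \<or> holds e2 \<rho> \<alpha>)"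
  by (simp add: SOr_def)

lemma sval_SImp [simp]: "sval (SImp e1 e2) \<rho> \<alpha> = of_bool (holds e1 \<rho> \<alpha> \<longrightarrow> holds e2 \<rho> \<alpha>)"
  by (auto simp: SImp_def)

lemma sval_SIff [simp]: "sval (SIff e1 e2) \<rho> \<alpha> = of_bool (holds e1 \<rho> \<alpha> \<longleftrightarrow> holds e2 \<rho> \<alpha>)"
  by (auto simp: SIff_def)

lemma sval_SLess [simp]: "sval (SLess e1 e2) \<rho> \<alpha> = of_bool (sval e1 \<rho> \<alpha> < sval e2 \<rho> \<alpha>)"
  by (simp add: SLess_def)

lemma sval_SAll [simp]: "sval (SAll v e) \<rho> \<alpha> = of_bool (\<forall>i < \<rho> 0. holds e (\<rho>(v := i)) \<alpha>)"
  by (auto simp: SAll_def)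

lemma sval_SEx [simp]: "sval (SEx v e) \<rho> \<alpha> = of_bool (\<exists>i < \<rho> 0. holds e (\<rho>(v := i)) \<alpha>)"
  by (auto simp: SEx_def)

lemma sval_SCount [simp]:
  "sval (SCount v e) \<rho> \<alpha> = card {i. i < \<rho> 0 \<and> holds e (\<rho>(v := i)) \<alpha>}"
proof -
  have "sval (SCount v e) \<rho> \<alpha> = (\<Sum>i < \<rho> 0. of_bool (holds e (\<rho>(v := i)) \<alpha>))"
    by (simp add: SCount_def)
  also have "\<dots> = card ({..<\<rho> 0} \<inter> {i. holds e (\<rho>(v := i)) \<alpha>})"
    by (simp add: sum_of_bool_eq)
  also have "{..<\<rho> 0} \<inter> {i. holds e (\<rho>(v := i)) \<alpha>} = {i. i < \<rho> 0 \<and> holds e (\<rho>(v := i)) \<alpha>}"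
    by auto
  finally show ?thesis .
qed

lemma sexp_below_derived [simp]:
  "sexp_below d (SNot e) \<longleftrightarrow> 0 < d \<and> sexp_below d e"
  "sexp_below d (SAnd e1 e2) \<longleftrightarrow> 0 < d \<and> sexp_below d e1 \<and> sexp_below d e2"
  "sexp_below d (SOr e1 e2) \<longleftrightarrow> 0 < d \<and> sexp_below d e1 \<and> sexp_below d e2"
  "sexp_below d (SImp e1 e2) \<longleftrightarrow> 0 < d \<and> sexp_below d e1 \<and> sexp_below d e2"
  "sexp_below d (SIff e1 e2) \<longleftrightarrow> 0 < d \<and> sexp_below d e1 \<and> sexp_below d e2"
  "sexp_below d (SLess e1 e2) \<longleftrightarrow> 0 < d \<and> sexp_below d e1 \<and> sexp_below d e2"
  "sexp_below d (SAll v e) \<longleftrightarrow> 0 < v \<and> v < d \<and> sexp_below d e"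
  "sexp_below d (SEx v e) \<longleftrightarrow> 0 < v \<and> v < d \<and> sexp_below d e"
  "sexp_below d (SCount v e) \<longleftrightarrow> 0 < v \<and> v < d \<and> sexp_below d e"
  by (auto simp: SNot_def SAnd_def SOr_def SImp_def SIff_def SLess_def SAll_def SEx_def SCount_def)

text \<open>
  A sum of equal terms is a multiplication by the content of register 0, which gives the indices
  of two- and three-dimensional tables. Its bound variable is register 1.
\<close>

definition index2 :: "nat \<Rightarrow> nat \<Rightarrow> sexp" where
  "index2 p q = SAdd (SSum 1 (SReg p)) (SReg q)"

definition index3 :: "nat \<Rightarrow> nat \<Rightarrow> nat \<Rightarrow> sexp" where
  "index3 p q x = SAdd (SSum 1 (index2 p q)) (SReg x)"

definition get2 :: "nat \<Rightarrow> nat \<Rightarrow> nat \<Rightarrow> sexp" where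
  "get2 a p q = SGet a (index2 p q)"

definition get3 :: "nat \<Rightarrow> nat \<Rightarrow> nat \<Rightarrow> nat \<Rightarrow> sexp" where
  "get3 a p q x = SGet a (index3 p q x)"

lemma sval_index2 [simp]: "p \<noteq> 1 \<Longrightarrow> sval (index2 p q) \<rho> \<alpha> = \<rho> 0 * \<rho> p + \<rho> q"
  by (simp add: index2_def)

lemma sval_index3 [simp]:
  "p \<noteq> 1 \<Longrightarrow> q \<noteq> 1 \<Longrightarrow> sval (index3 p q x) \<rho> \<alpha> = \<rho> 0 * (\<rho> 0 * \<rho> p + \<rho> q) + \<rho> x"
  by (simp add: index3_def)

lemma sval_get2 [simp]: "p \<noteq> 1 \<Longrightarrow> sval (get2 a p q) \<rho> \<alpha> = \<alpha> a (\<rho> 0 * \<rho> p + \<rho> q)"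
  by (simp add: get2_def)

lemma sval_get3 [simp]:
  "p \<noteq> 1 \<Longrightarrow> q \<noteq> 1 \<Longrightarrow> sval (get3 a p q x) \<rho> \<alpha> = \<alpha> a (\<rho> 0 * (\<rho> 0 * \<rho> p + \<rho> q) + \<rho> x)"
  by (simp add: get3_def)

lemma sexp_below_index [simp]:
  "sexp_below d (index2 p q) \<longleftrightarrow> 1 < d \<and> p < d \<and> q < d"
  "sexp_below d (index3 p q x) \<longleftrightarrow> 1 < d \<and> p < d \<and> q < d \<and> x < d"
  "sexp_below d (get2 a p q) \<longleftrightarrow> 1 < d \<and> p < d \<and> q < d"
  "sexp_below d (get3 a p q x) \<longleftrightarrow> 1 < d \<and> p < d \<and> q < d \<and> x < d"
  by (auto simp: index2_def index3_def get2_def get3_def)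

lemma index_eq_iff: "q < N \<Longrightarrow> q' < N \<Longrightarrow> N * p + q = N * p' + q' \<longleftrightarrow> p = p' \<and> q = q'" for N :: nat
  by (metis add.commute add_right_cancel div_mult_self2 div_less add_cancel_right_right
    less_nat_zero_code mod_less mod_mult_self2)

section \<open>Iteration, simulation and fixed points\<close>

lemma iter_inv:
  assumes "I 0 x" "\<And>i x. i < n \<Longrightarrow> I i x \<Longrightarrow> I (Suc i) (f i x)"
  shows "I n (iter f n x)"
proof -
  have "m \<le> n \<Longrightarrow> I m (iter f m x)" for m
    by (induction m) (use assms in auto)
  then show ?thesis by simp
qed

text \<open>\<open>m\<close> abstracts a store to the set represented by a table, so that loops over
  arrays become iterations of set functions.\<close>

lemma iter_sim:
  assumes "\<And>i x. i < n \<Longrightarrow> I x \<Longrightarrow> I (f i x) \<and> m (f i x) = F i (m x)" "I x"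
  shows "I (iter f n x) \<and> m (iter f n x) = iter F n (m x)"
proof -
  have "k \<le> n \<Longrightarrow> I (iter f k x) \<and> m (iter f k x) = iter F k (m x)" for k
    by (induction k) (use assms in auto)
  then show ?thesis by simp
qed

lemma run_PFor_sim:
  assumes "\<And>i \<alpha>. i < \<rho> 0 \<Longrightarrow> I \<alpha> \<Longrightarrow> I (run c (\<rho>(v := i)) \<alpha>) \<and> m (run c (\<rho>(v := i)) \<alpha>) = F i (m \<alpha>)"
    and "I \<alpha>" "N = \<rho> 0"
  shows "I (run (PFor v c) \<rho> \<alpha>) \<and> m (run (PFor v c) \<rho> \<alpha>) = iter F N (m \<alpha>)"
  using iter_sim[of "\<rho> 0" I "\<lambda>i. run c (\<rho>(v := i))" m F \<alpha>] assms by simp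

definition inflationary :: "'a set \<Rightarrow> ('a set \<Rightarrow> 'a set) \<Rightarrow> bool" where
  "inflationary U g \<longleftrightarrow> (\<forall>T \<subseteq> U. T \<subseteq> g T \<and> g T \<subseteq> U)"

lemma inflationary_iter:
  assumes "\<And>i. i < n \<Longrightarrow> inflationary U (F i)"
  shows "inflationary U (iter F n)"
proof -
  have "k \<le> n \<Longrightarrow> inflationary U (iter F k)" for k
  proof (induction k)
    case (Suc k)
    then have IH: "inflationary U (iter F k)" and F: "inflationary U (F k)" using assms by auto
    show ?case
      unfolding inflationary_def
    proof (intro allI impI)
      fix T assume "T \<subseteq> U"
      then have "T \<subseteq> iter F k T \<and> iter F k T \<subseteq> U" using IH unfolding inflationary_def by simp
      then show "T \<subseteq> iter F (Suc k) T \<and> iter F (Suc k) T \<subseteq> U"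
        using F unfolding inflationary_def by (metis iter.simps(2) order_trans)
    qed
  qed (simp add: inflationary_def)
  then show ?thesis by simp
qed

text \<open>Each step of a sweep only adds, so a sweep without total effect has no effect at any
  intermediate stage. The induction runs backwards from the end of the sweep.\<close>

lemma iter_fixed:
  assumes "\<And>i. i < n \<Longrightarrow> inflationary U (F i)" "T \<subseteq> U" "iter F n T = T" "i < n"
  shows "F i T = T"
proof -
  have inf: "inflationary U (iter F k)" if "k \<le> n" for k
    using that assms(1) by (intro inflationary_iter) auto
  have "iter F (n - k) T = T" if "k \<le> n" for k
    using that
  proof (induction k)
    case (Suc k)
    then have eq: "n - k = Suc (n - Suc k)" by simp
    let ?T = "iter F (n - Suc k) T"
    have T: "T \<subseteq> ?T" "?T \<subseteq> U" using inf[of "n - Suc k"] assms(2) unfolding inflationary_def by auto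
    then have "?T \<subseteq> F (n - Suc k) ?T"
      using assms(1)[of "n - Suc k"] Suc.prems unfolding inflationary_def by auto
    also have "\<dots> = T" using Suc unfolding eq by simp
    finally show ?case using T by auto
  qed (use assms in simp)
  from this[of "n - i"] this[of "n - Suc i"] assms(4) show ?thesis
    by (simp add: Suc_leI)
qed

text \<open>A chain that grows strictly for \<open>m + 1\<close> steps would outgrow
  \<open>U\<close>.\<close>

lemma funpow_fixed:
  assumes "inflationary U g" "T \<subseteq> U" "finite U" "card U \<le> m"
  shows "g ((g ^^ m) T) = (g ^^ m) T"
proof (rule ccontr)
  assume neq: "g ((g ^^ m) T) \<noteq> (g ^^ m) T"
  have U: "(g ^^ k) T \<subseteq> U" for k
    by (induction k) (use assms in \<open>auto simp: inflationary_def\<close>)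
  have step: "(g ^^ k) T \<subseteq> g ((g ^^ k) T)" for k
    using U[of k] assms(1) unfolding inflationary_def by blast
  have stable: "(g ^^ (k + l)) T = (g ^^ k) T" if "g ((g ^^ k) T) = (g ^^ k) T" for k l
    by (induction l) (use that in auto)
  have ne: "g ((g ^^ k) T) \<noteq> (g ^^ k) T" if "k \<le> m" for k
  proof
    assume fx: "g ((g ^^ k) T) = (g ^^ k) T"
    then have "(g ^^ m) T = (g ^^ k) T" using stable[OF fx, of "m - k"] that by simp
    with fx neq show False by simp
  qed
  have "k \<le> Suc m \<Longrightarrow> k \<le> card ((g ^^ k) T)" for k
  proof (induction k)
    case (Suc k)
    have "(g ^^ k) T \<subset> g ((g ^^ k) T)" using step[of k] ne[of k] Suc.prems by auto
    moreover have "finite (g ((g ^^ k) T))" using U[of "Suc k"] assms(3) by (auto intro: finite_subset)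
    ultimately have "card ((g ^^ k) T) < card (g ((g ^^ k) T))" by (rule psubset_card_mono[rotated])
    then show ?case using Suc by simp
  qed simp
  from this[of "Suc m"] have "Suc m \<le> card ((g ^^ Suc m) T)" by simp
  also have "\<dots> \<le> card U" using U assms(3) by (rule card_mono[rotated])
  finally show False using assms(4) by simp
qed

lemma iter_const: "iter (\<lambda>_. g) n = g ^^ n"
proof
  show "iter (\<lambda>_. g) n x = (g ^^ n) x" for x by (induction n) auto
qed

lemma iter3_fixed:
  assumes "inflationary U g" "T \<subseteq> U" "finite U" "card U \<le> N * N * N"
    and T': "T' = iter (\<lambda>_. iter (\<lambda>_. iter (\<lambda>_. g) N) N) N T"
  shows "g T' = T'" "T \<subseteq> T'" "T' \<subseteq> U"
proof -
  have "T' = (g ^^ (N * N * N)) T"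
    unfolding T' iter_const funpow_mult by (simp add: mult.assoc)
  then show "g T' = T'" using funpow_fixed[OF assms(1-4)] by simp
  have "inflationary U (iter (\<lambda>_. iter (\<lambda>_. iter (\<lambda>_. g) N) N) N)"
    by (intro inflationary_iter assms(1))
  then show "T \<subseteq> T'" "T' \<subseteq> U" using assms(2) unfolding T' inflationary_def by auto
qed

text \<open>A table over triples has \<open>N ^ 3\<close> entries, so this many repetitions of an
  inflationary sweep reach a fixed point.\<close>

definition PFor3 :: "prog \<Rightarrow> prog" where
  "PFor3 c = PFor 8 (PFor 9 (PFor 10 c))"

text \<open>Each entry is written once, and its new value depends only on its own old value and on
  other arrays; so the loop in place acts like a simultaneous assignment.\<close>

lemma run_fill1:
  assumes N: "\<rho> 0 = N" and v: "v \<noteq> 0"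
    and val: "\<And>p \<beta>. p < N \<Longrightarrow> (\<And>b. b \<noteq> a \<Longrightarrow> \<beta> b = \<alpha> b) \<Longrightarrow> \<beta> a p = \<alpha> a p \<Longrightarrow>
      sval e (\<rho>(v := p)) \<beta> = f p"
    and \<alpha>': "\<alpha>' = run (PFor v (PPut a (SReg v) e)) \<rho> \<alpha>"
  shows "(\<forall>b. b \<noteq> a \<longrightarrow> \<alpha>' b = \<alpha> b) \<and> (\<forall>p < N. \<alpha>' a p = f p)"
proof -
  define I where "I m \<beta> \<longleftrightarrow> (\<forall>b. b \<noteq> a \<longrightarrow> \<beta> b = \<alpha> b) \<and> (\<forall>p. \<beta> a p = (if p < m then f p else \<alpha> a p))"
    for m \<beta>
  have "I N \<alpha>'"
    unfolding \<alpha>' run.simps N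
  proof (rule iter_inv[where I = I])
    fix i \<beta> assume i: "i < N" and I: "I i \<beta>"
    have "sval e (\<rho>(v := i)) \<beta> = f i"
      by (rule val[OF i]) (use I in \<open>simp_all add: I_def\<close>)
    then show "I (Suc i) (\<beta>(a := (\<beta> a)(sval (SReg v) (\<rho>(v := i)) \<beta> := sval e (\<rho>(v := i)) \<beta>)))"
      using I by (simp add: I_def less_Suc_eq)
  qed (simp add: I_def)
  then show ?thesis by (auto simp: I_def)
qed

lemma run_fill2:
  assumes N: "\<rho> 0 = N"
    and val: "\<And>p q \<beta>. p < N \<Longrightarrow> q < N \<Longrightarrow> (\<And>b. b \<noteq> a \<Longrightarrow> \<beta> b = \<alpha> b) \<Longrightarrow>
      \<beta> a (N * p + q) = \<alpha> a (N * p + q) \<Longrightarrow> sval e (\<rho>(2 := p, 3 := q)) \<beta> = f p q"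
    and \<alpha>': "\<alpha>' = run (PFor 2 (PFor 3 (PPut a (index2 2 3) e))) \<rho> \<alpha>"
  shows "(\<forall>b. b \<noteq> a \<longrightarrow> \<alpha>' b = \<alpha> b) \<and> (\<forall>p < N. \<forall>q < N. \<alpha>' a (N * p + q) = f p q)"
proof -
  define I where "I S \<beta> \<longleftrightarrow> (\<forall>b. b \<noteq> a \<longrightarrow> \<beta> b = \<alpha> b) \<and>
    (\<forall>p q. q < N \<longrightarrow> \<beta> a (N * p + q) = (if (p, q) \<in> S then f p q else \<alpha> a (N * p + q)))"
    for S \<beta>
  have "I ({..<N} \<times> {..<N}) \<alpha>'"
    unfolding \<alpha>' run.simps(3) N
  proof (rule iter_inv[where I = "\<lambda>i. I ({..<i} \<times> {..<N})"])
    fix i \<beta> assume i: "i < N" and I: "I ({..<i} \<times> {..<N}) \<beta>"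
    have "I ({..<i} \<times> {..<N} \<union> {i} \<times> {..<N})
      (iter (\<lambda>j. run (PPut a (index2 2 3) e) (\<rho>(2 := i, 3 := j))) N \<beta>)"
    proof (rule iter_inv[where I = "\<lambda>j. I ({..<i} \<times> {..<N} \<union> {i} \<times> {..<j})"])
      fix j \<beta> assume j: "j < N" and I: "I ({..<i} \<times> {..<N} \<union> {i} \<times> {..<j}) \<beta>"
      have "sval e (\<rho>(2 := i, 3 := j)) \<beta> = f i j"
        by (rule val[OF i j]) (use I j in \<open>simp_all add: I_def\<close>)
      then show "I ({..<i} \<times> {..<N} \<union> {i} \<times> {..<Suc j})
        (run (PPut a (index2 2 3) e) (\<rho>(2 := i, 3 := j)) \<beta>)"
        using I i j N by (auto simp: I_def index_eq_iff less_Suc_eq)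
    qed (use I in simp)
    moreover have "{..<i} \<times> {..<N} \<union> {i} \<times> {..<N} = {..<Suc i} \<times> {..<N}" by auto
    moreover have "(\<rho>(2 := i)) 0 = N" using N by simp
    ultimately show "I ({..<Suc i} \<times> {..<N})
      (iter (\<lambda>j. run (PPut a (index2 2 3) e) (\<rho>(2 := i, 3 := j))) ((\<rho>(2 := i)) 0) \<beta>)"
      by (simp del: run.simps)
  qed (simp add: I_def)
  then show ?thesis by (auto simp: I_def)
qed

lemma run_fill3:
  assumes N: "\<rho> 0 = N" and a: "a \<noteq> b"
    and \<alpha>': "\<alpha>' = run (PFor 2 (PFor 3 (PFor 4 (PPut a (index3 2 3 4) (get2 b 3 4))))) \<rho> \<alpha>"
  shows "(\<forall>c. c \<noteq> a \<longrightarrow> \<alpha>' c = \<alpha> c) \<and>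
    (\<forall>p < N. \<forall>q < N. \<forall>x < N. \<alpha>' a (N * (N * p + q) + x) = \<alpha> b (N * q + x))"
proof -
  define I where "I S \<beta> \<longleftrightarrow> (\<forall>c. c \<noteq> a \<longrightarrow> \<beta> c = \<alpha> c) \<and>
    (\<forall>p q x. q < N \<longrightarrow> x < N \<longrightarrow> (p, q, x) \<in> S \<longrightarrow> \<beta> a (N * (N * p + q) + x) = \<alpha> b (N * q + x))"
    for S \<beta>
  let ?V = "{..<N}"
  let ?c = "PPut a (index3 2 3 4) (get2 b 3 4)"
  have "I (?V \<times> ?V \<times> ?V) \<alpha>'"
    unfolding \<alpha>' run.simps(3) N
  proof (rule iter_inv[where I = "\<lambda>i. I ({..<i} \<times> ?V \<times> ?V)"])
    fix i \<beta> assume i: "i < N" and I: "I ({..<i} \<times> ?V \<times> ?V) \<beta>"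
    have "I ({..<i} \<times> ?V \<times> ?V \<union> {i} \<times> ?V \<times> ?V)
      (iter (\<lambda>j. iter (\<lambda>k. run ?c (\<rho>(2 := i, 3 := j, 4 := k))) N) N \<beta>)"
    proof (rule iter_inv[where I = "\<lambda>j. I ({..<i} \<times> ?V \<times> ?V \<union> {i} \<times> {..<j} \<times> ?V)"])
      fix j \<beta> assume j: "j < N" and I: "I ({..<i} \<times> ?V \<times> ?V \<union> {i} \<times> {..<j} \<times> ?V) \<beta>"
      have "I ({..<i} \<times> ?V \<times> ?V \<union> {i} \<times> {..<j} \<times> ?V \<union> {i} \<times> {j} \<times> ?V)
        (iter (\<lambda>k. run ?c (\<rho>(2 := i, 3 := j, 4 := k))) N \<beta>)"
      proof (rule iter_inv[where
            I = "\<lambda>k. I ({..<i} \<times> ?V \<times> ?V \<union> {i} \<times> {..<j} \<times> ?V \<union> {i} \<times> {j} \<times> {..<k})"])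
        fix k \<beta>
        assume k: "k < N"
          and I: "I ({..<i} \<times> ?V \<times> ?V \<union> {i} \<times> {..<j} \<times> ?V \<union> {i} \<times> {j} \<times> {..<k}) \<beta>"
        then show "I ({..<i} \<times> ?V \<times> ?V \<union> {i} \<times> {..<j} \<times> ?V \<union> {i} \<times> {j} \<times> {..<Suc k})
          (run ?c (\<rho>(2 := i, 3 := j, 4 := k)) \<beta>)"
          using N i j a by (auto simp: I_def index_eq_iff less_Suc_eq)
      qed (use I in simp)
      moreover have "{..<i} \<times> ?V \<times> ?V \<union> {i} \<times> {..<j} \<times> ?V \<union> {i} \<times> {j} \<times> ?V =
        {..<i} \<times> ?V \<times> ?V \<union> {i} \<times> {..<Suc j} \<times> ?V" by auto
      ultimately show "I ({..<i} \<times> ?V \<times> ?V \<union> {i} \<times> {..<Suc j} \<times> ?V)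
        (iter (\<lambda>k. run ?c (\<rho>(2 := i, 3 := j, 4 := k))) N \<beta>)" by simp
    qed (use I in simp)
    moreover have "{..<i} \<times> ?V \<times> ?V \<union> {i} \<times> ?V \<times> ?V = {..<Suc i} \<times> ?V \<times> ?V" by auto
    moreover have "(\<rho>(2 := i)) 0 = N" "(\<rho>(2 := i, 3 := j)) 0 = N" for j using N by simp_all
    ultimately show "I ({..<Suc i} \<times> ?V \<times> ?V)
      (iter (\<lambda>j. iter (\<lambda>k. run ?c (\<rho>(2 := i, 3 := j, 4 := k))) ((\<rho>(2 := i, 3 := j)) 0))
        ((\<rho>(2 := i)) 0) \<beta>)"
      by (simp del: run.simps)
  qed (simp add: I_def)
  then show ?thesis by (auto simp: I_def)
qed

section \<open>The decision procedure\<close>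

text \<open>
  Arrays 2 and 3 hold the two input matrices with rows of length \<open>n + 1\<close>, arrays 5, 7 and 8 the
  cliques \<open>K p\<close>, the blocks of pairs of cliques and the grown parts of these blocks. Array 4 holds
  the visited vertices and array 6 the chosen one. The dummy vertex \<open>n\<close> has the empty clique.
\<close>

definition last_vertex :: sexp where
  "last_vertex = SSub (SReg 0) (SNum 1)"

text \<open>Register 0 holds \<open>n + 1\<close>, so \<open>index2 2 3\<close> denotes
  \<open>(n + 1) * p + q\<close>; subtracting \<open>p\<close> gives the position in the source,
  whose rows have length \<open>n\<close>. The guards leave zeros in the row and the column of the
  dummy vertex.\<close>

definition copy_prog :: "nat \<Rightarrow> nat \<Rightarrow> prog" where
  "copy_prog src dst = PFor 2 (PFor 3 (PPut dst (index2 2 3)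
    (SAnd (SLess (SReg 2) last_vertex) (SAnd (SLess (SReg 3) last_vertex)
      (SGet src (SSub (index2 2 3) (SReg 2)))))))"

definition label_exp :: "nat \<Rightarrow> sexp" where
  "label_exp v = SCount 5 (SAnd (SGet 4 (SReg 5)) (get2 2 5 v))"

definition fresh_exp :: "nat \<Rightarrow> sexp" where
  "fresh_exp v = SAnd (SLess (SReg v) last_vertex) (SNot (SGet 4 (SReg v)))"

text \<open>Ties go to the smallest vertex, so exactly one vertex passes the test as long as some
  vertex is unvisited.\<close>

definition chosen_exp :: sexp where
  "chosen_exp = SAnd (fresh_exp 2) (SAll 3 (SImp (fresh_exp 3)
    (SAnd (SNot (SLess (label_exp 2) (label_exp 3)))
      (SImp (SNot (SLess (label_exp 3) (label_exp 2))) (SNot (SLess (SReg 3) (SReg 2)))))))"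

definition clique_exp :: sexp where
  "clique_exp = SOr (get2 5 2 3) (SAnd (SGet 6 (SReg 3)) (SAnd (SNot (SGet 4 (SReg 2)))
    (SOr (get2 2 3 2) (SNot (SOr (SLess (SReg 2) (SReg 3)) (SLess (SReg 3) (SReg 2)))))))"

text \<open>Clique rows are updated before the visited flags: the chosen vertex still counts as
  unvisited and so enters its own row, which is final from then on.\<close>

definition mcs_round :: prog where
  "mcs_round = PSeq (PFor 2 (PPut 6 (SReg 2) chosen_exp))
    (PSeq (PFor 2 (PFor 3 (PPut 5 (index2 2 3) clique_exp)))
      (PFor 2 (PPut 4 (SReg 2) (SOr (SGet 4 (SReg 2)) (SGet 6 (SReg 2))))))"

text \<open>There is one round more than there are vertices; the last one chooses nothing.\<close>

definition mcs_prog :: prog where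
  "mcs_prog = PFor 7 mcs_round"

definition init_prog :: "nat \<Rightarrow> prog" where
  "init_prog a = PFor 2 (PFor 3 (PFor 4 (PPut a (index3 2 3 4) (get2 5 3 4))))"

definition inter_exp :: "nat \<Rightarrow> nat \<Rightarrow> sexp" where
  "inter_exp p q = SCount 6 (SAnd (get2 5 p 6) (get2 5 q 6))"

definition block_step :: prog where
  "block_step = PPut 7 (index3 2 3 4) (SOr (get3 7 2 3 4)
    (SLess (inter_exp 2 3) (SCount 5 (SAnd (get3 7 2 3 5) (get2 2 5 4)))))"

definition block_prog :: prog where
  "block_prog = PFor3 (PFor 2 (PFor 3 (PFor 4 block_step)))"

definition start_exp :: "nat \<Rightarrow> nat \<Rightarrow> sexp" where
  "start_exp p q = SAll 6 (SImp (SAnd (get2 5 q 6) (SNot (get2 5 p 6)))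
    (SAll 7 (SImp (SAnd (get3 7 p q 7) (get2 3 7 6)) (get2 5 q 7))))"

definition full_exp :: "nat \<Rightarrow> nat \<Rightarrow> sexp" where
  "full_exp p q = SAll 6 (SImp (get3 7 p q 6) (get3 8 p q 6))"

definition extend_exp :: sexp where
  "extend_exp = SAnd (SLess (inter_exp 2 3) (inter_exp 4 5))
    (SAnd (SAll 6 (SImp (get2 5 5 6) (SIff (get3 8 2 3 6) (get2 5 4 6))))
    (SAnd (SAll 6 (SOr (get3 8 2 3 6)
        (SNot (SLess (inter_exp 4 5) (SCount 7 (SAnd (get3 8 2 3 7) (get2 2 7 6)))))))
      (SAll 6 (SImp (SAnd (get3 7 4 5 6) (SNot (get3 8 2 3 6)))
        (SAll 7 (SImp (SAnd (get3 7 2 3 7) (get2 3 7 6)) (SOr (get3 8 2 3 7) (get3 7 4 5 7))))))))"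

text \<open>The test is evaluated once into array 9, because the loop that follows alters array 8,
  on which the test depends.\<close>

definition grow_step :: prog where
  "grow_step = PSeq (PPut 9 (SNum 0) (SAnd extend_exp (SAnd (start_exp 4 5) (full_exp 4 5))))
    (PFor 6 (PPut 8 (index3 2 3 6) (SOr (get3 8 2 3 6) (SAnd (SGet 9 (SNum 0)) (get3 7 4 5 6)))))"

definition grow_prog :: prog where
  "grow_prog = PFor3 (PFor 2 (PFor 3 (PFor 4 (PFor 5 grow_step))))"

definition psop_prog :: prog where
  "psop_prog = PSeq (copy_prog 0 2) (PSeq (copy_prog 1 3) (PSeq mcs_prog
    (PSeq (init_prog 7) (PSeq block_prog (PSeq (init_prog 8) grow_prog)))))"

text \<open>The first guard forces register 2 to be the dummy vertex, whose clique is empty; the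
  second excludes it as the clique to be entered.\<close>

definition answer_exp :: sexp where
  "answer_exp = SEx 2 (SEx 3 (SAnd (SNot (SLess (SReg 2) last_vertex))
    (SAnd (SLess (SReg 3) last_vertex) (SAnd (start_exp 2 3) (full_exp 2 3)))))"

lemma sval_last_vertex [simp]: "sval last_vertex \<rho> \<alpha> = \<rho> 0 - 1"
  by (simp add: last_vertex_def)

text \<open>The loop variables are registers up to 10; 20 is any bound above them, where the stack
  of the compiled code begins.\<close>

lemma below: "prog_below 20 psop_prog" "sexp_below 20 answer_exp"
  by (simp_all add: psop_prog_def answer_exp_def copy_prog_def mcs_prog_def mcs_round_def
    chosen_exp_def fresh_exp_def label_exp_def clique_exp_def init_prog_def block_prog_def PFor3_def
    block_step_def inter_exp_def grow_prog_def grow_step_def extend_exp_def start_exp_def full_exp_def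
    last_vertex_def)

lemma run_copy:
  assumes N: "\<rho> 0 = Suc n" and src: "\<alpha> src = matrix_array n A" and ne: "src \<noteq> dst"
    and \<alpha>': "\<alpha>' = run (copy_prog src dst) \<rho> \<alpha>"
  shows "\<And>b. b \<noteq> dst \<Longrightarrow> \<alpha>' b = \<alpha> b"
    "\<And>p q. p < Suc n \<Longrightarrow> q < Suc n \<Longrightarrow> 0 < \<alpha>' dst (Suc n * p + q) \<longleftrightarrow> p < n \<and> q < n \<and> (p, q) \<in> A"
proof -
  let ?e = "SAnd (SLess (SReg 2) last_vertex) (SAnd (SLess (SReg 3) last_vertex)
      (SGet src (SSub (index2 2 3) (SReg 2))))"
  have val: "sval ?e (\<rho>(2 := p, 3 := q)) \<beta> = of_bool (p < n \<and> q < n \<and> (p, q) \<in> A)"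
    if \<beta>: "\<And>b. b \<noteq> dst \<Longrightarrow> \<beta> b = \<alpha> b" for p q \<beta>
  proof -
    have "\<beta> src = matrix_array n A" using \<beta> ne src by auto
    moreover have "matrix_array n A (n * p + q) = of_bool ((p, q) \<in> A)" if "p < n" "q < n"
    proof -
      have "n * p + q < n * Suc p" using that by simp
      also have "\<dots> \<le> n * n" using that by (intro mult_le_mono) auto
      finally show ?thesis using that by (simp add: matrix_array_def)
    qed
    moreover have "Suc n * p + q - p = n * p + q" by simp
    ultimately show ?thesis using N by auto
  qed
  have fill: "(\<forall>b. b \<noteq> dst \<longrightarrow> \<alpha>' b = \<alpha> b) \<and> (\<forall>p < Suc n. \<forall>q < Suc n.
      \<alpha>' dst (Suc n * p + q) = of_bool (p < n \<and> q < n \<and> (p, q) \<in> A))"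
    using N \<alpha>' unfolding copy_prog_def by (intro run_fill2[where \<rho> = \<rho> and e = ?e] val)
  then show "\<And>b. b \<noteq> dst \<Longrightarrow> \<alpha>' b = \<alpha> b" by blast
  show "0 < \<alpha>' dst (Suc n * p + q) \<longleftrightarrow> p < n \<and> q < n \<and> (p, q) \<in> A"
    if "p < Suc n" "q < Suc n" for p q using fill that by simp
qed

section \<open>Correctness of the clique search\<close>

context chordal_graph
begin

text \<open>The cliques \<open>K w\<close> consist of \<open>w\<close> and its neighbours visited before.\<close>

definition search_cliques :: "'a list \<Rightarrow> ('a \<Rightarrow> 'a set) \<Rightarrow> bool" where
  "search_cliques ws K \<longleftrightarrow> (\<forall>w \<in> pverts G - set ws. K w = nb w \<inter> set ws) \<and>
    (\<forall>w \<in> set ws. w \<in> K w \<and> clique (K w)) \<and>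
    (\<forall>A. clique A \<longrightarrow> A \<noteq> {} \<longrightarrow> A \<subseteq> set ws \<longrightarrow> (\<exists>w \<in> set ws. A \<subseteq> K w))"

text \<open>A row is final once its vertex has been visited. A clique containing the new vertex
  \<open>v\<close> fits into the row of \<open>v\<close>, since its other members are earlier
  neighbours of \<open>v\<close>.\<close>

lemma search_cliques_snoc:
  assumes K: "search_cliques ws K" and mcs: "mcs_visited G (ws @ [v])"
    and K': "\<And>w. w \<in> pverts G \<Longrightarrow> K' w = K w \<union> (if w \<notin> set ws \<and> (v \<in> nb w \<or> w = v) then {v} else {})"
  shows "search_cliques (ws @ [v]) K'"
proof -
  have v: "v \<in> pverts G" "v \<notin> set ws" "set ws \<subseteq> pverts G"
    using mcs mcs_visited_distinct[OF mcs] by auto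
  have Kv: "K' v = insert v (nb v \<inter> set ws)"
    using K'[OF v(1)] K v unfolding search_cliques_def by auto
  have old: "K' w = K w" if "w \<in> set ws" for w
    using K'[of w] v(3) that by auto
  have "K' w = nb w \<inter> set (ws @ [v])" if "w \<in> pverts G - set (ws @ [v])" for w
    using K'[of w] K that unfolding search_cliques_def by auto
  moreover have "clique (K' v)"
    unfolding Kv using mcs_clique[OF mcs] v(1) by (intro clique_insert_nb) auto
  moreover have "\<exists>w \<in> set (ws @ [v]). A \<subseteq> K' w"
    if A: "clique A" "A \<noteq> {}" "A \<subseteq> set (ws @ [v])" for A
  proof (cases "v \<in> A")
    case True
    then have "A \<subseteq> K' v" using cliqueD[OF A(1) _ True] A(3) unfolding Kv by auto
    then show ?thesis by auto
  next
    case False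
    then have "A \<subseteq> set ws" using A(3) by auto
    then obtain w where "w \<in> set ws" "A \<subseteq> K w" using K A(1,2) unfolding search_cliques_def by blast
    then show ?thesis using old by auto
  qed
  moreover have "w \<in> K' w \<and> clique (K' w)" if "w \<in> set ws" for w
    using K that old unfolding search_cliques_def by auto
  ultimately show ?thesis
    unfolding search_cliques_def using Kv by auto
qed

end

definition row :: "nat \<Rightarrow> (nat \<Rightarrow> nat) \<Rightarrow> nat \<Rightarrow> nat set" where
  "row N A p = {x. x < N \<and> 0 < A (N * p + x)}"

definition tri :: "nat \<Rightarrow> (nat \<Rightarrow> nat) \<Rightarrow> (nat \<times> nat \<times> nat) set" where
  "tri N A = {(p, q, x). p < N \<and> q < N \<and> x < N \<and> 0 < A (N * (N * p + q) + x)}"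

lemma tri_update:
  "p < N \<Longrightarrow> q < N \<Longrightarrow> x < N \<Longrightarrow> tri N (A(N * (N * p + q) + x := k)) =
    (if 0 < k then insert (p, q, x) (tri N A) else tri N A - {(p, q, x)})"
  by (auto simp: tri_def index_eq_iff)

locale psop_graph = chordal_graph G for G :: "nat pair_pre_digraph" +
  fixes R :: "nat rel" and n N :: nat
  assumes verts: "pverts G = {..<n}" and N_def: "N = Suc n"
    and conn: "Digraph_Component.connected (with_proj G)" and ord: "partial_order_on (pverts G) R"
begin

lemma nb_less: "x \<in> nb y \<Longrightarrow> x < n \<and> y < n"
  using nb_subset[of y] nb_empty[of y] verts by auto

definition graph_arrays :: "(nat \<Rightarrow> nat \<Rightarrow> nat) \<Rightarrow> bool" where
  "graph_arrays \<alpha> \<longleftrightarrow> (\<forall>p < N. \<forall>q < N. 0 < \<alpha> 2 (N * p + q) \<longleftrightarrow> p \<in> nb q) \<and>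
    (\<forall>p < N. \<forall>q < N. 0 < \<alpha> 3 (N * p + q) \<longleftrightarrow> (p, q) \<in> R)"

text \<open>The alternative \<open>set ws = pverts G\<close> covers idle rounds after the search is
  complete.\<close>

definition searching :: "nat \<Rightarrow> (nat \<Rightarrow> nat \<Rightarrow> nat) \<Rightarrow> bool" where
  "searching t \<alpha> \<longleftrightarrow> graph_arrays \<alpha> \<and> row N (\<alpha> 5) n = {} \<and>
    (\<exists>ws. mcs_visited G ws \<and> (length ws = t \<or> set ws = pverts G) \<and>
      (\<forall>v < N. 0 < \<alpha> 4 v \<longleftrightarrow> v \<in> set ws) \<and> search_cliques ws (row N (\<alpha> 5)))"

lemma run_mcs_round:
  assumes "searching t \<alpha>" and N0: "\<rho> 0 = N"
  shows "searching (Suc t) (run mcs_round \<rho> \<alpha>)"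
proof -
  obtain ws where ga: "graph_arrays \<alpha>" and rn: "row N (\<alpha> 5) n = {}" and ws: "mcs_visited G ws"
    "length ws = t \<or> set ws = pverts G" "\<And>v. v < N \<Longrightarrow> 0 < \<alpha> 4 v \<longleftrightarrow> v \<in> set ws"
    and K: "search_cliques ws (row N (\<alpha> 5))"
    using assms(1) unfolding searching_def by blast
  have adj: "0 < \<alpha> 2 (N * p + q) \<longleftrightarrow> p \<in> nb q" if "p < N" "q < N" for p q
    using ga that unfolding graph_arrays_def by simp
  have wsV: "set ws \<subseteq> {..<n}" using mcs_visited_distinct[OF ws(1)] verts by simp
  define chosen where "chosen v \<longleftrightarrow> v \<in> pverts G - set ws \<and> (\<forall>w \<in> pverts G - set ws.
    lab (set ws) w \<le> lab (set ws) v \<and> (lab (set ws) v \<le> lab (set ws) w \<longrightarrow> v \<le> w))" for v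
  define \<alpha>1 where "\<alpha>1 = run (PFor 2 (PPut 6 (SReg 2) chosen_exp)) \<rho> \<alpha>"
  define \<alpha>2 where "\<alpha>2 = run (PFor 2 (PFor 3 (PPut 5 (index2 2 3) clique_exp))) \<rho> \<alpha>1"
  define \<alpha>3 where
    "\<alpha>3 = run (PFor 2 (PPut 4 (SReg 2) (SOr (SGet 4 (SReg 2)) (SGet 6 (SReg 2))))) \<rho> \<alpha>2"
  have run: "run mcs_round \<rho> \<alpha> = \<alpha>3" by (simp add: mcs_round_def \<alpha>1_def \<alpha>2_def \<alpha>3_def)
  have label: "sval (label_exp v) \<rho>' \<beta> = lab (set ws) (\<rho>' v)"
    if "\<rho>' 0 = N" "\<rho>' v < N" "v \<noteq> 5" "\<beta> 4 = \<alpha> 4" "\<beta> 2 = \<alpha> 2" for \<rho>' \<beta> v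
  proof -
    have "{i. i < N \<and> 0 < \<alpha> 4 i \<and> 0 < \<alpha> 2 (N * i + \<rho>' v)} = nb (\<rho>' v) \<inter> set ws"
      using that(2) ws(3) adj wsV N_def by (auto dest: nb_less)
    then show ?thesis using that by (simp add: label_exp_def lab_def)
  qed
  have fresh: "holds (fresh_exp v) \<rho>' \<beta> \<longleftrightarrow> \<rho>' v \<in> pverts G - set ws"
    if "\<rho>' 0 = N" "\<beta> 4 = \<alpha> 4" for \<rho>' \<beta> v
    using that ws(3)[of "\<rho>' v"] N_def by (auto simp: fresh_exp_def verts)
  have ch: "sval chosen_exp (\<rho>(2 := p)) \<beta> = of_bool (chosen p)"
    if "p < N" "\<And>b. b \<noteq> 6 \<Longrightarrow> \<beta> b = \<alpha> b" for p \<beta>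
  proof -
    have "holds chosen_exp (\<rho>(2 := p)) \<beta> \<longleftrightarrow> p \<in> pverts G - set ws \<and> (\<forall>w < N. w \<in> pverts G - set ws \<longrightarrow>
      lab (set ws) w \<le> lab (set ws) p \<and> (lab (set ws) p \<le> lab (set ws) w \<longrightarrow> p \<le> w))"
      using that N0 by (auto simp: chosen_exp_def fresh label not_less)
    also have "\<dots> \<longleftrightarrow> chosen p"
      unfolding chosen_def using N_def by (auto simp: verts)
    finally show ?thesis by (auto simp: chosen_exp_def)
  qed
  have \<alpha>1: "(\<forall>b. b \<noteq> 6 \<longrightarrow> \<alpha>1 b = \<alpha> b) \<and> (\<forall>p < N. \<alpha>1 6 p = of_bool (chosen p))"
    by (rule run_fill1[OF N0 _ ch \<alpha>1_def]) simp_all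
  have cl: "sval clique_exp (\<rho>(2 := p, 3 := q)) \<beta> =
      of_bool (0 < \<alpha> 5 (N * p + q) \<or> chosen q \<and> p \<notin> set ws \<and> (q \<in> nb p \<or> p = q))"
    if "p < N" "q < N" "\<And>b. b \<noteq> 5 \<Longrightarrow> \<beta> b = \<alpha>1 b" "\<beta> 5 (N * p + q) = \<alpha>1 5 (N * p + q)" for p q \<beta>
    using that N0 \<alpha>1 ws(3)[of p] adj[of q p] by (auto simp: clique_exp_def)
  have \<alpha>2: "(\<forall>b. b \<noteq> 5 \<longrightarrow> \<alpha>2 b = \<alpha>1 b) \<and> (\<forall>p < N. \<forall>q < N. \<alpha>2 5 (N * p + q) =
      of_bool (0 < \<alpha> 5 (N * p + q) \<or> chosen q \<and> p \<notin> set ws \<and> (q \<in> nb p \<or> p = q)))"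
    by (rule run_fill2[OF N0 cl \<alpha>2_def])
  have vis: "sval (SOr (SGet 4 (SReg 2)) (SGet 6 (SReg 2))) (\<rho>(2 := p)) \<beta> = of_bool (p \<in> set ws \<or> chosen p)"
    if "p < N" "\<And>b. b \<noteq> 4 \<Longrightarrow> \<beta> b = \<alpha>2 b" "\<beta> 4 p = \<alpha>2 4 p" for p \<beta>
    using that \<alpha>1 \<alpha>2 ws(3)[of p] by auto
  have \<alpha>3: "(\<forall>b. b \<noteq> 4 \<longrightarrow> \<alpha>3 b = \<alpha>2 b) \<and> (\<forall>p < N. \<alpha>3 4 p = of_bool (p \<in> set ws \<or> chosen p))"
    by (rule run_fill1[OF N0 _ vis \<alpha>3_def]) simp_all
  have frame: "\<alpha>3 2 = \<alpha> 2" "\<alpha>3 3 = \<alpha> 3" "\<alpha>3 5 = \<alpha>2 5" using \<alpha>1 \<alpha>2 \<alpha>3 by simp_all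
  have ga': "graph_arrays \<alpha>3" using ga frame by (simp add: graph_arrays_def)
  have K': "row N (\<alpha>3 5) p = row N (\<alpha> 5) p \<union>
      {q. chosen q \<and> p \<notin> set ws \<and> (q \<in> nb p \<or> p = q)}" if "p < N" for p
    using that \<alpha>2 N_def by (auto simp: row_def frame chosen_def verts)
  have rn': "row N (\<alpha>3 5) n = {}"
    using K'[of n] rn N_def by (auto simp: chosen_def verts dest: nb_less)
  have V: "\<forall>v < N. 0 < \<alpha>3 4 v \<longleftrightarrow> v \<in> set ws \<or> chosen v" using \<alpha>3 by simp
  show ?thesis
  proof (cases "set ws = pverts G")
    case True
    then have "\<not> chosen v" for v by (simp add: chosen_def)
    then have "\<forall>p < N. row N (\<alpha>3 5) p = row N (\<alpha> 5) p" "\<forall>v < N. 0 < \<alpha>3 4 v \<longleftrightarrow> v \<in> set ws"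
      using K' V by simp_all
    moreover from this have "search_cliques ws (row N (\<alpha>3 5))"
      using K True N_def verts unfolding search_cliques_def by auto
    ultimately show ?thesis
      unfolding searching_def run using ga' rn' ws(1) True by auto
  next
    case False
    let ?L = "{v \<in> pverts G - set ws. \<forall>w \<in> pverts G - set ws. lab (set ws) w \<le> lab (set ws) v}"
    let ?M = "lab (set ws) ` (pverts G - set ws)"
    have "?M \<noteq> {}" using False wsV verts by auto
    moreover have fin: "finite ?M" using pair_finite_verts by simp
    ultimately have "Max ?M \<in> ?M" by (intro Max_in)
    then obtain v0 where v0: "v0 \<in> pverts G - set ws" "lab (set ws) v0 = Max ?M" by auto
    then have "v0 \<in> ?L" using Max_ge[OF fin] by simp
    define v where "v = (LEAST v. v \<in> ?L)"
    have vL: "v \<in> ?L" unfolding v_def using \<open>v0 \<in> ?L\<close> by (rule LeastI)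
    have v_min: "v \<le> w" if "w \<in> ?L" for w unfolding v_def using that by (rule Least_le)
    have chosen_iff: "chosen w \<longleftrightarrow> w = v" for w
    proof
      assume w: "chosen w"
      then have "w \<in> ?L" by (auto simp: chosen_def)
      moreover from this have "w \<le> v" using w vL unfolding chosen_def by auto
      ultimately show "w = v" using v_min by fastforce
    next
      assume "w = v"
      moreover have "chosen v"
        unfolding chosen_def
      proof (intro conjI ballI impI)
        fix u assume u: "u \<in> pverts G - set ws" "lab (set ws) v \<le> lab (set ws) u"
        then have "u \<in> ?L" using vL by (auto intro: order_trans)
        then show "v \<le> u" by (rule v_min)
      qed (use vL in auto)
      ultimately show "chosen w" by simp
    qed
    have mcs': "mcs_visited G (ws @ [v])" using ws(1) vL by (simp add: mcs_snoc)
    have "search_cliques (ws @ [v]) (row N (\<alpha>3 5))"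
    proof (rule search_cliques_snoc[OF K mcs'])
      fix w assume "w \<in> pverts G"
      then show "row N (\<alpha>3 5) w = row N (\<alpha> 5) w \<union>
          (if w \<notin> set ws \<and> (v \<in> nb w \<or> w = v) then {v} else {})"
        using K'[of w] N_def verts by (auto simp: chosen_iff)
    qed
    moreover have "\<forall>u < N. 0 < \<alpha>3 4 u \<longleftrightarrow> u \<in> set (ws @ [v])" using V chosen_iff by auto
    ultimately show ?thesis
      unfolding searching_def run using ga' rn' mcs' ws(2) False by (auto intro!: exI[of _ "ws @ [v]"])
  qed
qed

definition clique_arrays :: "(nat \<Rightarrow> nat \<Rightarrow> nat) \<Rightarrow> bool" where
  "clique_arrays \<alpha> \<longleftrightarrow> graph_arrays \<alpha> \<and> row N (\<alpha> 5) n = {} \<and>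
    (\<forall>w < n. w \<in> row N (\<alpha> 5) w \<and> clique (row N (\<alpha> 5) w)) \<and>
    (\<forall>A. clique A \<longrightarrow> A \<noteq> {} \<longrightarrow> (\<exists>w < n. A \<subseteq> row N (\<alpha> 5) w))"

lemma run_mcs:
  assumes "graph_arrays \<alpha>" "\<alpha> 4 = (\<lambda>_. 0)" "\<alpha> 5 = (\<lambda>_. 0)" and N0: "\<rho> 0 = N"
  shows "clique_arrays (run mcs_prog \<rho> \<alpha>)"
proof -
  have "searching 0 \<alpha>"
    unfolding searching_def using assms
    by (intro conjI exI[of _ "[]"]) (auto simp: row_def search_cliques_def mcs_visited.start)
  then have "searching N (iter (\<lambda>i. run mcs_round (\<rho>(7 := i))) N \<alpha>)"
    using N0 by (intro iter_inv[where I = searching] run_mcs_round) auto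
  then have s: "searching N (run mcs_prog \<rho> \<alpha>)" using N0 by (simp add: mcs_prog_def)
  obtain ws where ws: "mcs_visited G ws" "length ws = N \<or> set ws = pverts G"
    "search_cliques ws (row N (run mcs_prog \<rho> \<alpha> 5))"
    using s unfolding searching_def by blast
  have "length ws = card (set ws)" using mcs_visited_distinct[OF ws(1)] by (simp add: distinct_card)
  also have "\<dots> \<le> n"
    using mcs_visited_distinct[OF ws(1)] verts card_mono[of "{..<n}" "set ws"] by simp
  finally have V: "set ws = {..<n}" using ws(2) N_def verts by auto
  have "A \<subseteq> {..<n}" if "clique A" for A using clique_verts[OF that] verts by simp
  then show ?thesis
    using s ws(3) unfolding clique_arrays_def searching_def search_cliques_def V by auto
qed

end

section \<open>Correctness of the tables of blocks and of their grown parts\<close>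

lemma iter_invariant:
  assumes "\<And>i x. i < n \<Longrightarrow> I x \<Longrightarrow> I (f i x)" "I x"
  shows "I (iter f n x)"
  using iter_inv[of "\<lambda>_. I" x n f] assms by simp

lemma sim_PFor3:
  assumes "\<And>\<rho> \<alpha>. \<rho> 0 = N \<Longrightarrow> I \<alpha> \<Longrightarrow> I (run c \<rho> \<alpha>) \<and> m (run c \<rho> \<alpha>) = g (m \<alpha>)"
    and "I \<alpha>" "\<rho> 0 = N"
  shows "I (run (PFor3 c) \<rho> \<alpha>) \<and>
    m (run (PFor3 c) \<rho> \<alpha>) = iter (\<lambda>_. iter (\<lambda>_. iter (\<lambda>_. g) N) N) N (m \<alpha>)"
  unfolding PFor3_def using assms(2,3)
  by (intro run_PFor_sim[where I = I and m = m] assms(1)) auto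

definition section_of :: "(nat \<times> nat \<times> nat) set \<Rightarrow> nat \<Rightarrow> nat \<Rightarrow> nat set" where
  "section_of T p q = {x. (p, q, x) \<in> T}"

locale psop_cliques = psop_graph +
  fixes \<alpha>0 :: "nat \<Rightarrow> nat \<Rightarrow> nat"
  assumes arrays: "clique_arrays \<alpha>0"
begin

definition K :: "nat \<Rightarrow> nat set" where
  "K = row N (\<alpha>0 5)"

definition U :: "(nat \<times> nat \<times> nat) set" where
  "U = {..<N} \<times> {..<N} \<times> {..<N}"

definition same_input :: "(nat \<Rightarrow> nat \<Rightarrow> nat) \<Rightarrow> bool" where
  "same_input \<alpha> \<longleftrightarrow> \<alpha> 2 = \<alpha>0 2 \<and> \<alpha> 3 = \<alpha>0 3 \<and> \<alpha> 5 = \<alpha>0 5"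

lemma K_n: "K n = {}"
  using arrays by (simp add: clique_arrays_def K_def)

lemma K_self: "w < n \<Longrightarrow> w \<in> K w"
  using arrays by (simp add: clique_arrays_def K_def)

lemma K_clique:
  assumes "w < N"
  shows "clique (K w)"
proof (cases "w = n")
  case True
  then show ?thesis using K_n by (simp add: clique_def)
next
  case False
  then have "w < n" using assms by (simp add: N_def)
  then show ?thesis using arrays by (simp add: clique_arrays_def K_def)
qed

lemma verts_nonempty: "pverts G \<noteq> {}"
  using conn by (auto simp: connected_def strongly_connected_def mk_symmetric_def)

sublocale chordal_order G R "K ` {..<N}"
proof
  show "Digraph_Component.connected (with_proj G)" "partial_order_on (pverts G) R"
    by (fact conn ord)+
  show "clique Q" if "Q \<in> K ` {..<N}" for Q using that K_clique by auto
  show "{} \<in> K ` {..<N}" using K_n by (intro image_eqI[of _ _ n]) (auto simp: N_def)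
  fix Q assume Q: "clique Q" "\<And>v. v \<in> pverts G \<Longrightarrow> \<not> Q \<subseteq> nb v"
  have "Q \<noteq> {}" using Q(2) verts_nonempty by auto
  then obtain w where w: "w < n" "Q \<subseteq> K w"
    using arrays Q(1) unfolding clique_arrays_def K_def by blast
  have cl: "clique (K w)" using K_clique w(1) N_def by simp
  \<comment> \<open>A vertex of \<open>K w\<close> outside \<open>Q\<close> would see all of
    \<open>Q\<close>, against its maximality.\<close>
  have "K w \<subseteq> Q"
  proof
    fix v assume v: "v \<in> K w"
    show "v \<in> Q"
    proof (rule ccontr)
      assume "v \<notin> Q"
      then have "Q \<subseteq> nb v" using cliqueD[OF cl _ v] w(2) by blast
      then show False using Q(2) v clique_verts[OF cl] by blast
    qed
  qed
  then show "Q \<in> K ` {..<N}" using w N_def by (intro image_eqI[of _ _ w]) auto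
qed

lemma adjacency: "p < N \<Longrightarrow> q < N \<Longrightarrow> 0 < \<alpha>0 2 (N * p + q) \<longleftrightarrow> p \<in> nb q"
  and relation: "p < N \<Longrightarrow> q < N \<Longrightarrow> 0 < \<alpha>0 3 (N * p + q) \<longleftrightarrow> (p, q) \<in> R"
  using arrays by (simp_all add: clique_arrays_def graph_arrays_def)

lemma K_mem: "x < N \<Longrightarrow> 0 < \<alpha>0 5 (N * p + x) \<longleftrightarrow> x \<in> K p"
  by (simp add: K_def row_def)

lemma K_less: "x \<in> K p \<Longrightarrow> x < N"
  by (simp add: K_def row_def)

lemma tri_mem: "p < N \<Longrightarrow> q < N \<Longrightarrow> x < N \<Longrightarrow>
    0 < A (N * (N * p + q) + x) \<longleftrightarrow> x \<in> section_of (tri N A) p q"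
  by (simp add: section_of_def tri_def)

lemma finite_U: "finite U" and card_U: "card U = N * N * N"
  by (simp_all add: U_def)

lemma tri_U: "tri N A \<subseteq> U"
  by (auto simp: tri_def U_def)

lemma verts_N: "x \<in> pverts G \<Longrightarrow> x < N"
  by (simp add: verts N_def)

lemma blk_verts: "p < N \<Longrightarrow> blk (K q) (K p) \<subseteq> pverts G"
  unfolding blk_def using K_clique clique_verts by (intro clos_verts) blast

lemma sval_inter:
  assumes "same_input \<alpha>" "\<rho> 0 = N" "p \<noteq> 1" "q \<noteq> 1" "p \<noteq> 6" "q \<noteq> 6"
  shows "sval (inter_exp p q) \<rho> \<alpha> = card (K (\<rho> p) \<inter> K (\<rho> q))"
proof -
  have "{i. i < N \<and> 0 < \<alpha>0 5 (N * \<rho> p + i) \<and> 0 < \<alpha>0 5 (N * \<rho> q + i)} = K (\<rho> p) \<inter> K (\<rho> q)"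
    by (auto simp: K_def row_def)
  then show ?thesis using assms by (simp add: inter_exp_def same_input_def)
qed

lemma count_neighbours:
  assumes "p < N" "q < N" "u < N"
  shows "card {i. i < N \<and> 0 < A (N * (N * p + q) + i) \<and> 0 < \<alpha>0 2 (N * i + u)} =
    lab (section_of (tri N A) p q) u"
  unfolding lab_def
  by (rule arg_cong[where f = card]) (use assms adjacency in \<open>auto simp: section_of_def tri_def\<close>)

definition block_add :: "nat \<Rightarrow> nat \<Rightarrow> nat \<Rightarrow> (nat \<times> nat \<times> nat) set \<Rightarrow> (nat \<times> nat \<times> nat) set" where
  "block_add p q u T = (if card (K p \<inter> K q) < lab (section_of T p q) u then insert (p, q, u) T else T)"

lemma run_block_step:
  assumes "\<rho> 0 = N" "\<rho> 2 < N" "\<rho> 3 < N" "\<rho> 4 < N" "same_input \<alpha>"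
  shows "same_input (run block_step \<rho> \<alpha>) \<and>
    tri N (run block_step \<rho> \<alpha> 7) = block_add (\<rho> 2) (\<rho> 3) (\<rho> 4) (tri N (\<alpha> 7))"
proof -
  have "sval (SCount 5 (SAnd (get3 7 2 3 5) (get2 2 5 4))) \<rho> \<alpha> =
      lab (section_of (tri N (\<alpha> 7)) (\<rho> 2) (\<rho> 3)) (\<rho> 4)"
    using assms count_neighbours[OF assms(2-4)] by (simp add: same_input_def)
  then have "holds (SLess (inter_exp 2 3) (SCount 5 (SAnd (get3 7 2 3 5) (get2 2 5 4)))) \<rho> \<alpha> \<longleftrightarrow>
      card (K (\<rho> 2) \<inter> K (\<rho> 3)) < lab (section_of (tri N (\<alpha> 7)) (\<rho> 2) (\<rho> 3)) (\<rho> 4)"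
    using sval_inter[of \<alpha> \<rho> 2 3] assms by simp
  then show ?thesis
    using assms tri_update[OF assms(2-4), of "\<alpha> 7"]
      tri_mem[OF assms(2-4), of "\<alpha> 7"]
    by (auto simp: block_step_def block_add_def same_input_def section_of_def
      simp del: sval_SLess sval_SCount)
qed

lemma run_block:
  assumes "\<rho> 0 = N" "same_input \<alpha>"
    and init: "\<forall>p < N. \<forall>q < N. \<forall>x < N. \<alpha> 7 (N * (N * p + q) + x) = \<alpha> 5 (N * q + x)"
    and \<alpha>': "\<alpha>' = run block_prog \<rho> \<alpha>"
  shows "same_input \<alpha>' \<and> (\<forall>p < N. \<forall>q < N. section_of (tri N (\<alpha>' 7)) p q = blk (K p) (K q))"
proof -
  define g where "g = iter (\<lambda>p. iter (\<lambda>q. iter (block_add p q) N) N) N"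
  define T where "T = tri N (\<alpha>' 7)"
  have "same_input (run block_prog \<rho> \<alpha>) \<and> tri N (run block_prog \<rho> \<alpha> 7) =
      iter (\<lambda>_. iter (\<lambda>_. iter (\<lambda>_. g) N) N) N (tri N (\<alpha> 7))"
    unfolding block_prog_def
  proof (rule sim_PFor3[where I = same_input and m = "\<lambda>\<alpha>. tri N (\<alpha> 7)"])
    fix \<rho> :: "nat \<Rightarrow> nat" and \<alpha> :: "nat \<Rightarrow> nat \<Rightarrow> nat" assume "\<rho> 0 = N" "same_input \<alpha>"
    then show "same_input (run (PFor 2 (PFor 3 (PFor 4 block_step))) \<rho> \<alpha>) \<and>
      tri N (run (PFor 2 (PFor 3 (PFor 4 block_step))) \<rho> \<alpha> 7) = g (tri N (\<alpha> 7))"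
      unfolding g_def
    proof (intro run_PFor_sim[where I = same_input and m = "\<lambda>\<alpha>. tri N (\<alpha> 7)"])
      fix p q x and \<alpha> :: "nat \<Rightarrow> nat \<Rightarrow> nat"
      assume "\<rho> 0 = N" "p < \<rho> 0" "q < (\<rho>(2 := p)) 0" "x < (\<rho>(2 := p, 3 := q)) 0" "same_input \<alpha>"
      then show "same_input (run block_step (\<rho>(2 := p, 3 := q, 4 := x)) \<alpha>) \<and>
          tri N (run block_step (\<rho>(2 := p, 3 := q, 4 := x)) \<alpha> 7) = block_add p q x (tri N (\<alpha> 7))"
        using run_block_step[of "\<rho>(2 := p, 3 := q, 4 := x)" \<alpha>] by simp
    qed simp_all
  qed (use assms in simp_all)
  then have same: "same_input \<alpha>'"
    and T: "T = iter (\<lambda>_. iter (\<lambda>_. iter (\<lambda>_. g) N) N) N (tri N (\<alpha> 7))"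
    by (simp_all add: T_def \<alpha>')
  have inf1: "inflationary U (block_add p q u)" if "p < N" "q < N" "u < N" for p q u
    using that by (auto simp: inflationary_def block_add_def U_def)
  have inf2: "inflationary U (iter (block_add p q) N)" if "p < N" "q < N" for p q
    by (rule inflationary_iter) (intro inf1 that)
  have inf3: "inflationary U (iter (\<lambda>q. iter (block_add p q) N) N)" if "p < N" for p
    by (rule inflationary_iter) (intro inf2 that)
  have inf: "inflationary U g" unfolding g_def by (rule inflationary_iter) (rule inf3)
  have fixed: "g T = T" "tri N (\<alpha> 7) \<subseteq> T" "T \<subseteq> U"
    using iter3_fixed[OF inf tri_U finite_U _ T] card_U by auto
  \<comment> \<open>A fixed point of the whole sweep is peeled loop by loop down to a fixed point of
    every single update.\<close>
  have stable: "block_add p q u T = T" if "p < N" "q < N" "u < N" for p q u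
    using iter_fixed[OF inf1 fixed(3) iter_fixed[OF inf2 fixed(3)
      iter_fixed[OF inf3 fixed(3) fixed(1)[unfolded g_def]]]] that by simp
  have start: "section_of (tri N (\<alpha> 7)) p q = K q" if "p < N" "q < N" for p q
    using that init assms(2) by (auto simp: section_of_def tri_def K_def row_def same_input_def)
  \<comment> \<open>\<open>ok\<close> bounds the table by the blocks from above;
    \<open>stable\<close> makes it closed under the rule of \<open>clos\<close>, which gives the
    bound from below.\<close>
  define ok where "ok T \<longleftrightarrow> (\<forall>p < N. \<forall>q < N. section_of T p q \<subseteq> blk (K p) (K q))" for T
  have step: "ok (block_add p q u T)" if "ok T" "p < N" "q < N" for p q u T
  proof -
    have "u \<in> blk (K p) (K q)" if lt: "card (K p \<inter> K q) < lab (section_of T p q) u"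
    proof -
      have sub: "section_of T p q \<subseteq> blk (K p) (K q)" using \<open>ok T\<close> \<open>p < N\<close> \<open>q < N\<close> by (simp add: ok_def)
      have "nb u \<noteq> {}" using lt by (auto simp: lab_def)
      then have "u \<in> pverts G" using nb_empty by blast
      moreover have "Suc (card (K p \<inter> K q)) \<le> lab (blk (K p) (K q)) u"
        using lt lab_mono[OF sub, of u] by simp
      ultimately show ?thesis unfolding blk_def by (rule clos_closed)
    qed
    then show ?thesis using that(1) by (auto simp: ok_def block_add_def section_of_def)
  qed
  have "ok (tri N (\<alpha> 7))" unfolding ok_def using start subset_blk by blast
  moreover have "ok (g T)" if "ok T" for T
    unfolding g_def by (intro iter_invariant[where I = ok] step that)
  ultimately have "ok T" unfolding T by (intro iter_invariant[where I = ok])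
  have "section_of T p q = blk (K p) (K q)" if pq: "p < N" "q < N" for p q
  proof
    show "section_of T p q \<subseteq> blk (K p) (K q)" using \<open>ok T\<close> pq by (simp add: ok_def)
    show "blk (K p) (K q) \<subseteq> section_of T p q"
      unfolding blk_def
    proof (rule clos_subset)
      show "K q \<subseteq> section_of T p q" using start[OF pq] fixed(2) by (auto simp: section_of_def)
      fix u assume "u \<in> pverts G" "Suc (card (K p \<inter> K q)) \<le> lab (section_of T p q) u"
      then show "u \<in> section_of T p q"
        using stable[OF pq verts_N[of u]] by (auto simp: block_add_def section_of_def)
    qed
  qed
  then show ?thesis using same by (simp add: T_def)
qed

definition blocks :: "(nat \<Rightarrow> nat \<Rightarrow> nat) \<Rightarrow> bool" where
  "blocks \<alpha> \<longleftrightarrow> same_input \<alpha> \<and> (\<forall>p < N. \<forall>q < N. section_of (tri N (\<alpha> 7)) p q = blk (K p) (K q))"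

lemma blocks_mem:
  "blocks \<alpha> \<Longrightarrow> p < N \<Longrightarrow> q < N \<Longrightarrow> x < N \<Longrightarrow> 0 < \<alpha> 7 (N * (N * p + q) + x) \<longleftrightarrow> x \<in> blk (K p) (K q)"
  using tri_mem[of p q x "\<alpha> 7"] by (simp add: blocks_def)

lemma holds_start:
  assumes "blocks \<alpha>" "\<rho> 0 = N" "\<rho> p < N" "\<rho> q < N" "p \<notin> {1, 6, 7}" "q \<notin> {1, 6, 7}"
  shows "holds (start_exp p q) \<rho> \<alpha> \<longleftrightarrow> start_ok (K (\<rho> p)) (K (\<rho> q))"
proof -
  have same: "\<alpha> 5 = \<alpha>0 5" "\<alpha> 3 = \<alpha>0 3" using assms(1) by (simp_all add: blocks_def same_input_def)
  have "holds (start_exp p q) \<rho> \<alpha> \<longleftrightarrow> (\<forall>y < N. y \<in> K (\<rho> q) \<and> y \<notin> K (\<rho> p) \<longrightarrow>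
      (\<forall>x < N. x \<in> blk (K (\<rho> p)) (K (\<rho> q)) \<and> (x, y) \<in> R \<longrightarrow> x \<in> K (\<rho> q)))"
    using assms(2-) blocks_mem[OF assms(1)] by (simp add: start_exp_def same K_mem relation)
  also have "\<dots> \<longleftrightarrow> start_ok (K (\<rho> p)) (K (\<rho> q))"
    unfolding start_ok_def using K_less blk_verts[OF assms(4)] verts_N by blast
  finally show ?thesis .
qed

lemma holds_full:
  assumes "blocks \<alpha>" "\<rho> 0 = N" "\<rho> p < N" "\<rho> q < N" "p \<notin> {1, 6}" "q \<notin> {1, 6}"
  shows "holds (full_exp p q) \<rho> \<alpha> \<longleftrightarrow>
    blk (K (\<rho> p)) (K (\<rho> q)) \<subseteq> section_of (tri N (\<alpha> 8)) (\<rho> p) (\<rho> q)"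
proof -
  have "holds (full_exp p q) \<rho> \<alpha> \<longleftrightarrow> (\<forall>x < N. x \<in> blk (K (\<rho> p)) (K (\<rho> q)) \<longrightarrow>
      x \<in> section_of (tri N (\<alpha> 8)) (\<rho> p) (\<rho> q))"
    using assms(2-) blocks_mem[OF assms(1)] tri_mem[of "\<rho> p" "\<rho> q" _ "\<alpha> 8"]
    by (simp add: full_exp_def)
  also have "\<dots> \<longleftrightarrow> blk (K (\<rho> p)) (K (\<rho> q)) \<subseteq> section_of (tri N (\<alpha> 8)) (\<rho> p) (\<rho> q)"
    using blk_verts[OF assms(4)] verts_N by blast
  finally show ?thesis .
qed

lemma holds_extend:
  assumes "blocks \<alpha>" and \<rho>: "\<rho> 0 = N" "\<rho> 2 < N" "\<rho> 3 < N" "\<rho> 4 < N" "\<rho> 5 < N"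
  shows "holds extend_exp \<rho> \<alpha> \<longleftrightarrow>
    can_extend (K (\<rho> 2)) (K (\<rho> 3)) (section_of (tri N (\<alpha> 8)) (\<rho> 2) (\<rho> 3)) (K (\<rho> 4)) (K (\<rho> 5))"
proof -
  let ?P = "K (\<rho> 2)" and ?Q = "K (\<rho> 3)" and ?P' = "K (\<rho> 4)" and ?Q' = "K (\<rho> 5)"
  let ?X = "section_of (tri N (\<alpha> 8)) (\<rho> 2) (\<rho> 3)"
  let ?c = "card (?P' \<inter> ?Q')"
  have si: "same_input \<alpha>" using assms(1) by (simp add: blocks_def)
  then have same: "\<alpha> 5 = \<alpha>0 5" "\<alpha> 3 = \<alpha>0 3" "\<alpha> 2 = \<alpha>0 2" by (simp_all add: same_input_def)
  have inter: "sval (inter_exp 2 3) \<rho> \<alpha> = card (?P \<inter> ?Q)" "sval (inter_exp 4 5) \<rho> \<alpha> = ?c"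
    "\<And>i. sval (inter_exp 4 5) (\<rho>(6 := i)) \<alpha> = ?c"
    using sval_inter[OF si] \<rho> by simp_all
  have count: "sval (SCount 7 (SAnd (get3 8 2 3 7) (get2 2 7 6))) (\<rho>(6 := i)) \<alpha> = lab ?X i"
    if "i < N" for i
    using \<rho> count_neighbours[OF \<rho>(2,3) that, of "\<alpha> 8"] by (simp add: same)
  note mem = blocks_mem[OF assms(1)] tri_mem[of "\<rho> 2" "\<rho> 3" _ "\<alpha> 8", OF \<rho>(2,3)]
  have "holds (SAll 6 (SImp (get2 5 5 6) (SIff (get3 8 2 3 6) (get2 5 4 6)))) \<rho> \<alpha> \<longleftrightarrow>
      (\<forall>i < N. i \<in> ?Q' \<longrightarrow> (i \<in> ?X \<longleftrightarrow> i \<in> ?P'))"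
    using \<rho> mem by (simp add: same K_mem)
  also have "\<dots> \<longleftrightarrow> ?X \<inter> ?Q' = ?P' \<inter> ?Q'" using K_less by blast
  finally have 1: "holds (SAll 6 (SImp (get2 5 5 6) (SIff (get3 8 2 3 6) (get2 5 4 6)))) \<rho> \<alpha> \<longleftrightarrow>
      ?X \<inter> ?Q' = ?P' \<inter> ?Q'" .
  let ?e2 = "SAll 6 (SOr (get3 8 2 3 6)
      (SNot (SLess (inter_exp 4 5) (SCount 7 (SAnd (get3 8 2 3 7) (get2 2 7 6))))))"
  have "holds ?e2 \<rho> \<alpha> \<longleftrightarrow> (\<forall>i < N. i \<notin> ?X \<longrightarrow> lab ?X i \<le> ?c)"
    using \<rho> mem inter(3) count by (simp add: not_less del: sval_SCount cong: conj_cong) blast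
  also have "\<dots> \<longleftrightarrow> (\<forall>u \<in> pverts G - ?X. lab ?X u \<le> ?c)"
  proof -
    \<comment> \<open>The quantifier of the program also reaches the dummy vertex, whose label is
      0.\<close>
    have "lab ?X u = 0" if "u \<notin> pverts G" for u using nb_empty[OF that] by (simp add: lab_def)
    then show ?thesis using verts_N by (metis DiffD1 DiffD2 DiffI le0)
  qed
  finally have 2: "holds ?e2 \<rho> \<alpha> \<longleftrightarrow> (\<forall>u \<in> pverts G - ?X. lab ?X u \<le> ?c)" .
  let ?e3 = "SAll 6 (SImp (SAnd (get3 7 4 5 6) (SNot (get3 8 2 3 6)))
      (SAll 7 (SImp (SAnd (get3 7 2 3 7) (get2 3 7 6)) (SOr (get3 8 2 3 7) (get3 7 4 5 7)))))"
  have "holds ?e3 \<rho> \<alpha> \<longleftrightarrow> (\<forall>i < N. i \<in> blk ?P' ?Q' \<and> i \<notin> ?X \<longrightarrow>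
      (\<forall>j < N. j \<in> blk ?P ?Q \<and> (j, i) \<in> R \<longrightarrow> j \<notin> ?X \<longrightarrow> j \<in> blk ?P' ?Q'))"
    using \<rho> mem by (simp add: same relation) blast
  also have "\<dots> \<longleftrightarrow>
      (\<forall>y \<in> blk ?P' ?Q' - ?X. \<forall>x \<in> blk ?P ?Q. (x, y) \<in> R \<longrightarrow> x \<in> ?X \<union> blk ?P' ?Q')"
    using blk_verts[OF \<rho>(3)] blk_verts[OF \<rho>(5)] verts_N by blast
  finally have 3: "holds ?e3 \<rho> \<alpha> \<longleftrightarrow>
      (\<forall>y \<in> blk ?P' ?Q' - ?X. \<forall>x \<in> blk ?P ?Q. (x, y) \<in> R \<longrightarrow> x \<in> ?X \<union> blk ?P' ?Q')" .
  have "holds extend_exp \<rho> \<alpha> \<longleftrightarrow> card (?P \<inter> ?Q) < ?c \<and>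
      holds (SAll 6 (SImp (get2 5 5 6) (SIff (get3 8 2 3 6) (get2 5 4 6)))) \<rho> \<alpha> \<and>
      holds ?e2 \<rho> \<alpha> \<and> holds ?e3 \<rho> \<alpha>"
    unfolding extend_exp_def sval_SAnd sval_SLess inter(1,2) by simp
  then show ?thesis unfolding 1 2 3 can_extend_def .
qed

definition grow_add ::
    "nat \<Rightarrow> nat \<Rightarrow> nat \<Rightarrow> nat \<Rightarrow> (nat \<times> nat \<times> nat) set \<Rightarrow> (nat \<times> nat \<times> nat) set" where
  "grow_add p q p' q' T = (if can_extend (K p) (K q) (section_of T p q) (K p') (K q') \<and>
      start_ok (K p') (K q') \<and> blk (K p') (K q') \<subseteq> section_of T p' q'
    then T \<union> {p} \<times> {q} \<times> blk (K p') (K q') else T)"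

lemma run_grow_step:
  assumes \<rho>: "\<rho> 0 = N" "\<rho> 2 < N" "\<rho> 3 < N" "\<rho> 4 < N" "\<rho> 5 < N" and bl: "blocks \<alpha>"
  shows "blocks (run grow_step \<rho> \<alpha>) \<and>
    tri N (run grow_step \<rho> \<alpha> 8) = grow_add (\<rho> 2) (\<rho> 3) (\<rho> 4) (\<rho> 5) (tri N (\<alpha> 8))"
proof -
  let ?T = "tri N (\<alpha> 8)" and ?B = "blk (K (\<rho> 4)) (K (\<rho> 5))"
  let ?cond = "SAnd extend_exp (SAnd (start_exp 4 5) (full_exp 4 5))"
  define ok where "ok \<longleftrightarrow> holds ?cond \<rho> \<alpha>"
  have ok: "ok \<longleftrightarrow> can_extend (K (\<rho> 2)) (K (\<rho> 3)) (section_of ?T (\<rho> 2) (\<rho> 3)) (K (\<rho> 4)) (K (\<rho> 5)) \<and>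
      start_ok (K (\<rho> 4)) (K (\<rho> 5)) \<and> ?B \<subseteq> section_of ?T (\<rho> 4) (\<rho> 5)"
    unfolding ok_def using holds_extend[OF bl \<rho>] holds_start[OF bl, of \<rho> 4 5]
      holds_full[OF bl, of \<rho> 4 5] \<rho> by simp
  define \<alpha>1 where "\<alpha>1 = run (PPut 9 (SNum 0) ?cond) \<rho> \<alpha>"
  let ?c = "PPut 8 (index3 2 3 6) (SOr (get3 8 2 3 6) (SAnd (SGet 9 (SNum 0)) (get3 7 4 5 6)))"
  define I where "I i \<beta> \<longleftrightarrow> (\<forall>b. b \<noteq> 8 \<longrightarrow> \<beta> b = \<alpha>1 b) \<and>
    tri N (\<beta> 8) = ?T \<union> (if ok then {\<rho> 2} \<times> {\<rho> 3} \<times> (?B \<inter> {..<i}) else {})" for i \<beta>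
  have \<alpha>1: "\<alpha>1 b = \<alpha> b" if "b \<noteq> 9" for b using that by (simp add: \<alpha>1_def)
  have flag: "0 < \<alpha>1 9 0 \<longleftrightarrow> ok" by (simp add: \<alpha>1_def ok_def)
  have "I N (iter (\<lambda>i. run ?c (\<rho>(6 := i))) N \<alpha>1)"
  proof (rule iter_inv[where I = I])
    show "I 0 \<alpha>1" using \<alpha>1 by (simp add: I_def)
    fix i \<beta> assume i: "i < N" and I: "I i \<beta>"
    have frame: "\<beta> 9 = \<alpha>1 9" "\<beta> 7 = \<alpha> 7" using I \<alpha>1 by (simp_all add: I_def)
    let ?v = "sval (SOr (get3 8 2 3 6) (SAnd (SGet 9 (SNum 0)) (get3 7 4 5 6))) (\<rho>(6 := i)) \<beta>"
    have v: "0 < ?v \<longleftrightarrow> (\<rho> 2, \<rho> 3, i) \<in> tri N (\<beta> 8) \<or> ok \<and> i \<in> ?B"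
      using \<rho> i flag tri_mem[OF \<rho>(2,3) i, of "\<beta> 8"] blocks_mem[OF bl \<rho>(4,5) i]
      by (auto simp: frame section_of_def)
    have r: "run ?c (\<rho>(6 := i)) \<beta> = \<beta>(8 := (\<beta> 8)(N * (N * \<rho> 2 + \<rho> 3) + i := ?v))"
      using \<rho>(1) by simp
    have "tri N (run ?c (\<rho>(6 := i)) \<beta> 8) =
        tri N (\<beta> 8) \<union> (if ok \<and> i \<in> ?B then {(\<rho> 2, \<rho> 3, i)} else {})"
      unfolding r using tri_update[OF \<rho>(2,3) i, of "\<beta> 8" ?v] v by auto
    also have "\<dots> = ?T \<union> (if ok then {\<rho> 2} \<times> {\<rho> 3} \<times> (?B \<inter> {..<Suc i}) else {})"
      using I by (auto simp: I_def less_Suc_eq)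
    finally show "I (Suc i) (run ?c (\<rho>(6 := i)) \<beta>)"
      using I unfolding I_def r by simp
  qed
  moreover have "run grow_step \<rho> \<alpha> = iter (\<lambda>i. run ?c (\<rho>(6 := i))) N \<alpha>1"
    using \<rho>(1) by (simp add: grow_step_def \<alpha>1_def del: run.simps(1))
  ultimately have I: "I N (run grow_step \<rho> \<alpha>)" by simp
  have "?B \<inter> {..<N} = ?B" using blk_verts[OF \<rho>(5)] verts_N by blast
  then have "tri N (run grow_step \<rho> \<alpha> 8) = grow_add (\<rho> 2) (\<rho> 3) (\<rho> 4) (\<rho> 5) ?T"
    using I ok by (simp add: I_def grow_add_def)
  moreover have "blocks (run grow_step \<rho> \<alpha>)"
    using I bl \<alpha>1 by (simp add: I_def blocks_def same_input_def)
  ultimately show ?thesis by simp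
qed

lemma run_grow:
  assumes "\<rho> 0 = N" "blocks \<alpha>"
    and init: "\<forall>p < N. \<forall>q < N. \<forall>x < N. \<alpha> 8 (N * (N * p + q) + x) = \<alpha> 5 (N * q + x)"
    and \<alpha>': "\<alpha>' = run grow_prog \<rho> \<alpha>"
  shows "blocks \<alpha>' \<and> (\<forall>p < N. \<forall>q < N. grows (K p) (K q) (section_of (tri N (\<alpha>' 8)) p q) \<and>
    (\<forall>p' < N. \<forall>q' < N. grow_add p q p' q' (tri N (\<alpha>' 8)) = tri N (\<alpha>' 8)))"
proof -
  define g where "g = iter (\<lambda>p. iter (\<lambda>q. iter (\<lambda>p'. iter (grow_add p q p') N) N) N) N"
  define T where "T = tri N (\<alpha>' 8)"
  have "blocks (run grow_prog \<rho> \<alpha>) \<and> tri N (run grow_prog \<rho> \<alpha> 8) =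
      iter (\<lambda>_. iter (\<lambda>_. iter (\<lambda>_. g) N) N) N (tri N (\<alpha> 8))"
    unfolding grow_prog_def
  proof (rule sim_PFor3[where I = blocks and m = "\<lambda>\<alpha>. tri N (\<alpha> 8)"])
    fix \<rho> :: "nat \<Rightarrow> nat" and \<alpha> :: "nat \<Rightarrow> nat \<Rightarrow> nat" assume "\<rho> 0 = N" "blocks \<alpha>"
    then show "blocks (run (PFor 2 (PFor 3 (PFor 4 (PFor 5 grow_step)))) \<rho> \<alpha>) \<and>
      tri N (run (PFor 2 (PFor 3 (PFor 4 (PFor 5 grow_step)))) \<rho> \<alpha> 8) = g (tri N (\<alpha> 8))"
      unfolding g_def
    proof (intro run_PFor_sim[where I = blocks and m = "\<lambda>\<alpha>. tri N (\<alpha> 8)"])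
      fix p q p' q' and \<alpha> :: "nat \<Rightarrow> nat \<Rightarrow> nat"
      assume "\<rho> 0 = N" "p < \<rho> 0" "q < (\<rho>(2 := p)) 0" "p' < (\<rho>(2 := p, 3 := q)) 0"
        "q' < (\<rho>(2 := p, 3 := q, 4 := p')) 0" "blocks \<alpha>"
      then show "blocks (run grow_step (\<rho>(2 := p, 3 := q, 4 := p', 5 := q')) \<alpha>) \<and>
          tri N (run grow_step (\<rho>(2 := p, 3 := q, 4 := p', 5 := q')) \<alpha> 8) =
          grow_add p q p' q' (tri N (\<alpha> 8))"
        using run_grow_step[of "\<rho>(2 := p, 3 := q, 4 := p', 5 := q')" \<alpha>] by simp
    qed simp_all
  qed (use assms in simp_all)
  then have bl: "blocks \<alpha>'"
    and T: "T = iter (\<lambda>_. iter (\<lambda>_. iter (\<lambda>_. g) N) N) N (tri N (\<alpha> 8))"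
    by (simp_all add: T_def \<alpha>')
  have inf1: "inflationary U (grow_add p q p' q')" if "p < N" "q < N" "p' < N" "q' < N" for p q p' q'
    using that blk_verts[of q' p'] verts_N by (fastforce simp: inflationary_def grow_add_def U_def)
  have inf2: "inflationary U (iter (grow_add p q p') N)" if "p < N" "q < N" "p' < N" for p q p'
    by (rule inflationary_iter) (intro inf1 that)
  have inf3: "inflationary U (iter (\<lambda>p'. iter (grow_add p q p') N) N)" if "p < N" "q < N" for p q
    by (rule inflationary_iter) (intro inf2 that)
  have inf4: "inflationary U (iter (\<lambda>q. iter (\<lambda>p'. iter (grow_add p q p') N) N) N)" if "p < N" for p
    by (rule inflationary_iter) (intro inf3 that)
  have inf: "inflationary U g" unfolding g_def by (rule inflationary_iter) (rule inf4)
  have fixed: "g T = T" "tri N (\<alpha> 8) \<subseteq> T" "T \<subseteq> U"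
    using iter3_fixed[OF inf tri_U finite_U _ T] card_U by auto
  have stable: "grow_add p q p' q' T = T" if "p < N" "q < N" "p' < N" "q' < N" for p q p' q'
    using iter_fixed[OF inf1 fixed(3) iter_fixed[OF inf2 fixed(3) iter_fixed[OF inf3 fixed(3)
      iter_fixed[OF inf4 fixed(3) fixed(1)[unfolded g_def]]]]] that by simp
  have start: "section_of (tri N (\<alpha> 8)) p q = K q" if "p < N" "q < N" for p q
    using that init assms(2)
    by (auto simp: section_of_def tri_def K_def row_def blocks_def same_input_def)
  define ok where "ok T \<longleftrightarrow> (\<forall>p < N. \<forall>q < N. grows (K p) (K q) (section_of T p q))" for T
  have step: "ok (grow_add p q p' q' T)" if T: "ok T" and pq: "p < N" "q < N" "p' < N" "q' < N"
    for p q p' q' T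
  proof (cases "can_extend (K p) (K q) (section_of T p q) (K p') (K q') \<and>
      start_ok (K p') (K q') \<and> blk (K p') (K q') \<subseteq> section_of T p' q'")
    case True
    have gr: "grows (K p') (K q') (section_of T p' q')" "grows (K p) (K q) (section_of T p q)"
      using T pq by (simp_all add: ok_def)
    \<comment> \<open>Being grown, the entry lies inside its block; being full, it contains the
      block. So the premise of the extension rule is met exactly.\<close>
    then have "section_of T p' q' = blk (K p') (K q')" using grows_subset_blk True by blast
    then have new: "grows (K p) (K q) (section_of T p q \<union> blk (K p') (K q'))"
      using gr True by (intro grows.extend) simp_all
    have "section_of (grow_add p q p' q' T) a b =
        (if a = p \<and> b = q then section_of T p q \<union> blk (K p') (K q') else section_of T a b)" for a b
      using True by (auto simp: grow_add_def section_of_def)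
    then show ?thesis using new T by (simp add: ok_def)
  next
    case False
    then have "grow_add p q p' q' T = T" unfolding grow_add_def by (rule if_not_P)
    then show ?thesis using T by simp
  qed
  have "ok (tri N (\<alpha> 8))" unfolding ok_def using start by (auto intro!: grows.start)
  moreover have "ok (g T)" if "ok T" for T
    unfolding g_def by (intro iter_invariant[where I = ok] step that)
  ultimately have "ok T" unfolding T by (intro iter_invariant[where I = ok])
  then show ?thesis using bl stable unfolding ok_def T_def by blast
qed

lemma answer_correct:
  assumes "\<rho> 0 = N" "blocks \<alpha>"
    and grown: "\<forall>p < N. \<forall>q < N. grows (K p) (K q) (section_of (tri N (\<alpha> 8)) p q) \<and>
      (\<forall>p' < N. \<forall>q' < N. grow_add p q p' q' (tri N (\<alpha> 8)) = tri N (\<alpha> 8))"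
  shows "sval answer_exp \<rho> \<alpha> = of_bool (\<exists>\<sigma>. mcs_ordering G \<sigma> \<and> order_extends \<sigma> R)"
proof -
  let ?T = "tri N (\<alpha> 8)"
  have "holds answer_exp \<rho> \<alpha> \<longleftrightarrow>
      (\<exists>q < n. start_ok {} (K q) \<and> blk {} (K q) \<subseteq> section_of ?T n q)"
  proof -
    have eq: "holds (start_exp 2 3) (\<rho>(2 := p, 3 := q)) \<alpha> \<and>
        holds (full_exp 2 3) (\<rho>(2 := p, 3 := q)) \<alpha> \<longleftrightarrow>
        start_ok (K p) (K q) \<and> blk (K p) (K q) \<subseteq> section_of ?T p q" if "p < N" "q < N" for p q
      using that assms(1) holds_start[OF assms(2), of "\<rho>(2 := p, 3 := q)" 2 3]
        holds_full[OF assms(2), of "\<rho>(2 := p, 3 := q)" 2 3] by simp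
    have "N - 1 = n" by (simp add: N_def)
    then have "holds answer_exp \<rho> \<alpha> \<longleftrightarrow> (\<exists>p < N. \<exists>q < N. \<not> p < n \<and> q < n \<and>
        holds (start_exp 2 3) (\<rho>(2 := p, 3 := q)) \<alpha> \<and> holds (full_exp 2 3) (\<rho>(2 := p, 3 := q)) \<alpha>)"
      using assms(1) by (simp add: answer_exp_def)
    also have "\<dots> \<longleftrightarrow> (\<exists>p < N. \<exists>q < N. \<not> p < n \<and> q < n \<and>
        start_ok (K p) (K q) \<and> blk (K p) (K q) \<subseteq> section_of ?T p q)"
      by (intro ex_cong1 conj_cong refl eq)
    also have "\<dots> \<longleftrightarrow> (\<exists>q < n. start_ok (K n) (K q) \<and> blk (K n) (K q) \<subseteq> section_of ?T n q)"
      unfolding N_def by (auto simp: less_Suc_eq)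
    finally show ?thesis unfolding K_n .
  qed
  also have "\<dots> \<longleftrightarrow> (\<exists>\<sigma>. mcs_ordering G \<sigma> \<and> order_extends \<sigma> R)"
  proof
    assume "\<exists>q < n. start_ok {} (K q) \<and> blk {} (K q) \<subseteq> section_of ?T n q"
    then obtain q where q: "q < n" "start_ok {} (K q)" "blk {} (K q) \<subseteq> section_of ?T n q" by blast
    have "grows (K n) (K q) (section_of ?T n q)" using grown q(1) N_def by simp
    then have "grows {} (K q) (section_of ?T n q)" using K_n by simp
    moreover from this have "section_of ?T n q = blk {} (K q)" using grows_subset_blk q(3) by blast
    ultimately have "grows {} (K q) (blk {} (K q))" by simp
    then show "\<exists>\<sigma>. mcs_ordering G \<sigma> \<and> order_extends \<sigma> R"
      using grows_sound q(2) K_self[OF q(1)] by blast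
  next
    assume "\<exists>\<sigma>. mcs_ordering G \<sigma> \<and> order_extends \<sigma> R"
    then obtain \<sigma> where \<sigma>: "mcs_ordering G \<sigma>" "order_extends \<sigma> R" by blast
    \<comment> \<open>The table is indexed by vertices, whereas \<open>saturated\<close> speaks
      about cliques; \<open>rep\<close> selects an index for each clique.\<close>
    define rep where "rep = inv_into {..<N} K"
    have rep: "rep P < N" "K (rep P) = P" if "P \<in> K ` {..<N}" for P
      using inv_into_into[OF that] f_inv_into_f[OF that] by (simp_all add: rep_def)
    define D where "D P Q = section_of ?T (rep P) (rep Q)" for P Q
    have "saturated D"
      unfolding saturated_def
    proof (intro ballI conjI impI)
      fix P Q assume PQ: "P \<in> K ` {..<N}" "Q \<in> K ` {..<N}"
      show "grows P Q (D P Q)" using grown rep[OF PQ(1)] rep[OF PQ(2)] by (metis D_def)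
      fix P' Q'
      assume PQ': "P' \<in> K ` {..<N}" "Q' \<in> K ` {..<N}"
        and c: "can_extend P Q (D P Q) P' Q' \<and> start_ok P' Q' \<and> blk P' Q' \<subseteq> D P' Q'"
      have "grow_add (rep P) (rep Q) (rep P') (rep Q') ?T = ?T"
        using grown rep[OF PQ(1)] rep[OF PQ(2)] rep[OF PQ'(1)] rep[OF PQ'(2)] by blast
      moreover have "grow_add (rep P) (rep Q) (rep P') (rep Q') ?T =
          ?T \<union> {rep P} \<times> {rep Q} \<times> blk P' Q'"
        using c rep[OF PQ(1)] rep[OF PQ(2)] rep[OF PQ'(1)] rep[OF PQ'(2)]
        by (simp add: grow_add_def D_def)
      ultimately show "blk P' Q' \<subseteq> D P Q" by (auto simp: D_def section_of_def)
    qed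
    from saturated_complete[OF this \<sigma>] obtain Q where
      Q: "Q \<in> K ` {..<N}" "Q \<noteq> {}" "start_ok {} Q" "blk {} Q \<subseteq> D {} Q" by blast
    \<comment> \<open>Every \<open>K w\<close> with \<open>w < n\<close> contains \<open>w\<close>,
      so only \<open>n\<close> can represent the empty clique.\<close>
    have "rep {} = n"
      using rep[OF family_empty] K_self[of "rep {}"] N_def by (auto simp: less_Suc_eq)
    moreover have "rep Q < n" using rep[OF Q(1)] Q(2) K_n N_def by (auto simp: less_Suc_eq)
    ultimately show "\<exists>q < n. start_ok {} (K q) \<and> blk {} (K q) \<subseteq> section_of ?T n q"
      using Q rep(2)[OF Q(1)] by (intro exI[of _ "rep Q"]) (simp add: D_def)
  qed
  finally show ?thesis by (auto simp: answer_exp_def)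
qed

end

section \<open>Assembling the program\<close>

lemma (in psop_graph) psop_prog_correct:
  assumes "\<rho> 0 = N" "graph_arrays \<alpha>" "\<alpha> 4 = (\<lambda>_. 0)" "\<alpha> 5 = (\<lambda>_. 0)"
  shows "sval answer_exp \<rho> (run (PSeq mcs_prog
      (PSeq (init_prog 7) (PSeq block_prog (PSeq (init_prog 8) grow_prog)))) \<rho> \<alpha>) =
    of_bool (\<exists>\<sigma>. mcs_ordering G \<sigma> \<and> order_extends \<sigma> R)"
proof -
  define \<alpha>0 where "\<alpha>0 = run mcs_prog \<rho> \<alpha>"
  define \<alpha>1 where "\<alpha>1 = run (init_prog 7) \<rho> \<alpha>0"
  define \<alpha>2 where "\<alpha>2 = run block_prog \<rho> \<alpha>1"
  define \<alpha>3 where "\<alpha>3 = run (init_prog 8) \<rho> \<alpha>2"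
  define \<alpha>4 where "\<alpha>4 = run grow_prog \<rho> \<alpha>3"
  interpret psop_cliques G R n N \<alpha>0
    by unfold_locales (use run_mcs[of \<alpha> \<rho>] assms in \<open>simp add: \<alpha>0_def\<close>)
  have 1: "(\<forall>c. c \<noteq> 7 \<longrightarrow> \<alpha>1 c = \<alpha>0 c) \<and>
      (\<forall>p < N. \<forall>q < N. \<forall>x < N. \<alpha>1 7 (N * (N * p + q) + x) = \<alpha>0 5 (N * q + x))"
    using assms(1) \<alpha>1_def unfolding init_prog_def by (intro run_fill3[where \<rho> = \<rho>]) auto
  have 2: "blocks \<alpha>2"
    unfolding blocks_def using 1 assms(1) by (intro run_block[OF _ _ _ \<alpha>2_def]) (auto simp: same_input_def)
  have 3: "(\<forall>c. c \<noteq> 8 \<longrightarrow> \<alpha>3 c = \<alpha>2 c) \<and>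
      (\<forall>p < N. \<forall>q < N. \<forall>x < N. \<alpha>3 8 (N * (N * p + q) + x) = \<alpha>2 5 (N * q + x))"
    using assms(1) \<alpha>3_def unfolding init_prog_def by (intro run_fill3[where \<rho> = \<rho>]) auto
  have b3: "blocks \<alpha>3" using 2 3 by (simp add: blocks_def same_input_def)
  have "\<forall>p < N. \<forall>q < N. \<forall>x < N. \<alpha>3 8 (N * (N * p + q) + x) = \<alpha>3 5 (N * q + x)"
    using 3 by simp
  from run_grow[OF assms(1) b3 this \<alpha>4_def]
  have "sval answer_exp \<rho> \<alpha>4 = of_bool (\<exists>\<sigma>. mcs_ordering G \<sigma> \<and> order_extends \<sigma> R)"
    using assms(1) by (intro answer_correct) auto
  then show ?thesis by (simp add: \<alpha>0_def \<alpha>1_def \<alpha>2_def \<alpha>3_def \<alpha>4_def)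
qed

text \<open>Register 0 is raised to \<open>n + 1\<close> to make room for the dummy vertex; at the
  end it is overwritten with the answer.\<close>

definition psop_com :: com where
  "psop_com = Seq (Assign 0 (Add (Reg 0) (Num 1))) (Seq (compile psop_prog 20)
    (Seq (compile_sexp answer_exp 20) (Assign 0 (Reg 20))))"

theorem theorem1:
  shows "poly_time_decidable psop_chordal_instances encode_graph_rel
    (\<lambda>(G, R). card (pverts G))
    (\<lambda>(G, R). \<exists>\<sigma>. mcs_ordering G \<sigma> \<and> order_extends \<sigma> R)"
  unfolding poly_time_decidable_def
\<comment> \<open>The time bounds are polynomials in register 0, which holds \<open>n + 1\<close>
  while loops run; composition with \<open>[:1, 1:]\<close> expresses them in \<open>n\<close>. The
  leading 1 pays for the increment.\<close>
proof (intro exI[of _ psop_com]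
    exI[of _ "pcompose (1 + (prog_time psop_prog + (sexp_time answer_exp + 1))) [:1, 1:]"] ballI)
  fix inst assume inst: "inst \<in> psop_chordal_instances"
  obtain G R where GR: "inst = (G, R)" by (cases inst)
  define n where "n = card (pverts G)"
  define N where "N = Suc n"
  let ?yes = "\<exists>\<sigma>. mcs_ordering G \<sigma> \<and> order_extends \<sigma> R"
  interpret pair_graph G using inst by (simp add: psop_chordal_instances_def GR)
  interpret psop_graph G R n N
    by unfold_locales (use inst in \<open>auto simp: psop_chordal_instances_def GR n_def N_def\<close>)
  define s where "s = encode_graph_rel inst"
  define s1 where "s1 = s\<lparr>reg := (reg s)(0 := N)\<rparr>"
  have s: "reg s 0 = n" "arr s 0 = matrix_array n (parcs G)" "arr s 1 = matrix_array n R"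
    "\<And>a. 1 < a \<Longrightarrow> arr s a = (\<lambda>_. 0)"
    by (auto simp: s_def GR encode_graph_rel_def Let_def n_def)
  have s1: "reg s1 0 = N" "arr s1 = arr s" by (simp_all add: s1_def)
  let ?\<rho> = "reg s1"
  define \<beta> where "\<beta> = run (copy_prog 1 3) ?\<rho> (run (copy_prog 0 2) ?\<rho> (arr s))"
  have copy1: "\<And>b. b \<noteq> 2 \<Longrightarrow> run (copy_prog 0 2) ?\<rho> (arr s) b = arr s b"
    "\<And>p q. p < N \<Longrightarrow> q < N \<Longrightarrow> 0 < run (copy_prog 0 2) ?\<rho> (arr s) 2 (N * p + q) \<longleftrightarrow>
      p < n \<and> q < n \<and> (p, q) \<in> parcs G"
    using run_copy[of ?\<rho> n "arr s" 0 "parcs G" 2, OF _ _ _ refl] s(2) s1(1) by (simp_all add: N_def)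
  have copy2: "\<And>b. b \<noteq> 3 \<Longrightarrow> \<beta> b = run (copy_prog 0 2) ?\<rho> (arr s) b"
    "\<And>p q. p < N \<Longrightarrow> q < N \<Longrightarrow> 0 < \<beta> 3 (N * p + q) \<longleftrightarrow> p < n \<and> q < n \<and> (p, q) \<in> R"
    using run_copy[of ?\<rho> n "run (copy_prog 0 2) ?\<rho> (arr s)" 1 R 3, OF _ _ _ \<beta>_def]
      copy1(1) s(3) s1(1) by (simp_all add: N_def)
  \<comment> \<open>Copying keeps only pairs below \<open>n\<close>; since \<open>R\<close> relates
    vertices only, no pair of it is lost.\<close>
  have "R \<subseteq> pverts G \<times> pverts G" using partial_order_onD(4)[OF ord] .
  then have "graph_arrays \<beta>"
    unfolding graph_arrays_def using copy1(2) copy2 verts nb_less by (auto simp: nb_def)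
  moreover have "\<beta> 4 = (\<lambda>_. 0)" "\<beta> 5 = (\<lambda>_. 0)" using copy1(1) copy2(1) s(4) by simp_all
  ultimately have "sval answer_exp ?\<rho> (run (PSeq mcs_prog
      (PSeq (init_prog 7) (PSeq block_prog (PSeq (init_prog 8) grow_prog)))) ?\<rho> \<beta>) = of_bool ?yes"
    using s1(1) by (intro psop_prog_correct)
  then have answer: "sval answer_exp ?\<rho> (run psop_prog ?\<rho> (arr s)) = of_bool ?yes"
    by (simp add: psop_prog_def \<beta>_def)
  have "achieves (Seq (compile psop_prog 20) (Seq (compile_sexp answer_exp 20) (Assign 0 (Reg 20)))) s1
      (poly (prog_time psop_prog) N + (poly (sexp_time answer_exp) N + 1))
      (\<lambda>s'. reg s' 0 = of_bool ?yes)"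
  proof (rule achieves_Seq[OF compile_correct[OF below(1) order_refl s1(1)[symmetric]]])
    fix s2 :: store
    assume s2: "arr s2 = run psop_prog ?\<rho> (arr s1) \<and> (\<forall>x<20. reg s2 x = ?\<rho> x)"
    then have N2: "N = reg s2 0" using s1(1) by simp
    have "sval answer_exp (reg s2) (arr s2) = of_bool ?yes"
      using answer s2 s1(2) sval_cong[OF below(2), of "reg s2" ?\<rho>] by simp
    then show "achieves (Seq (compile_sexp answer_exp 20) (Assign 0 (Reg 20))) s2
        (poly (sexp_time answer_exp) N + 1) (\<lambda>s'. reg s' 0 = of_bool ?yes)"
      by (intro achieves_Seq[OF computesD[OF sexp_below_computes[OF below(2)] order_refl N2]])
        (auto intro!: achieves_Assign)
  qed
  moreover have "s1 = s\<lparr>reg := (reg s)(0 := aval (Add (Reg 0) (Num 1)) s)\<rparr>"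
    using s(1) by (simp add: s1_def N_def)
  ultimately have "achieves psop_com s
      (1 + (poly (prog_time psop_prog) N + (poly (sexp_time answer_exp) N + 1)))
      (\<lambda>s'. reg s' 0 = of_bool ?yes)"
    unfolding psop_com_def by (intro achieves_Assign_Seq) simp
  then obtain t s' where "exec psop_com s t s'"
    "t \<le> 1 + (poly (prog_time psop_prog) N + (poly (sexp_time answer_exp) N + 1))"
    "reg s' 0 = of_bool ?yes"
    unfolding achieves_def by blast
  then show "\<exists>t s'. exec psop_com (encode_graph_rel inst) t s' \<and>
      t \<le> poly (pcompose (1 + (prog_time psop_prog + (sexp_time answer_exp + 1))) [:1, 1:])
        (case inst of (G, R) \<Rightarrow> card (pverts G)) \<and>
      reg s' 0 = (if case inst of (G, R) \<Rightarrow> \<exists>\<sigma>. mcs_ordering G \<sigma> \<and> order_extends \<sigma> R then 1 else 0)"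
    by (intro exI[of _ t] exI[of _ s']) (simp add: s_def GR poly_pcompose n_def N_def of_bool_def)
qed

end
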